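(* If $M\to N$ is an $\mathbb{F}_1$-algebra homomorphism such that $N$ becomes a finitely generated $M$-module, then there is a transfer map $\mathbf{G}(N)\to\mathbf{G}(M)$.
   Context: An $\mathbb{F}_1$-algebra is a pointed monoid $M$ (a unital, not necessarily commutative monoid with an absorbing element $0$); homomorphisms preserve $1$, $0$ and products. A (right, unital) $M$-module is a pointed set $(S,0_S)$ with a right unital $M$-action by pointed maps such that $0\in M$ acts as the constant map to $0_S$; homomorphisms are $M$-equivariant pointed maps. $\mathtt{FG}(M)$ is the category of finitely generated $M$-modules (those of the form $\bigcup_{s\in S'}sM$ with $S'$ finite), regarded as a Waldhausen category: cofibrations are the split monomorphisms of $M$-modules $S_1\to S_2$ (having an $M$-module retraction) with $S_2/S_1$ in $\mathtt{FG}(M)$; weak equivalences are isomorphisms. $\mathbf{G}(M)$ is the Waldhausen $\mathrm{K}$-theory spectrum of $\mathtt{FG}(M)$. A Waldhausen exact functor (one preserving zero objects, cofibrations, weak equivalences and pushouts along cofibrations) induces a map of $\mathrm{K}$-theory spectra. "Transfer map" means the map $\mathbf{G}(N)\to\mathbf{G}(M)$ induced by the restriction of scalars functor $\mathtt{FG}(N)\to\mathtt{FG}(M)$ along $M\to N$, as a Waldhausen exact functor. *)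

theory Defs
  imports Main "HOL-Library.FuncSet"
begin

section \<open>Waldhausen categories\<close>

record ('o, 'a) wcat =
  Obj :: "'o set"
  Arr :: "'a set"
  Dom :: "'a \<Rightarrow> 'o"
  Cod :: "'a \<Rightarrow> 'o"
  Id :: "'o \<Rightarrow> 'a"
  Comp :: "'a \<Rightarrow> 'a \<Rightarrow> 'a"  (* Comp g f is "g after f" *)
  Zero :: "'o"
  Cof :: "'a set"
  Weq :: "'a set"

definition hom :: "('o, 'a) wcat \<Rightarrow> 'o \<Rightarrow> 'o \<Rightarrow> 'a set" where
  "hom C x y = {f \<in> Arr C. Dom C f = x \<and> Cod C f = y}"

definition is_iso :: "('o, 'a) wcat \<Rightarrow> 'a \<Rightarrow> bool" where
  "is_iso C f \<longleftrightarrow> f \<in> Arr C \<and>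
    (\<exists>g \<in> hom C (Cod C f) (Dom C f).
       Comp C g f = Id C (Dom C f) \<and> Comp C f g = Id C (Cod C f))"

text \<open>The square with legs \<open>f : A \<rightarrow> B\<close>, \<open>g : A \<rightarrow> D\<close> and \<open>h : B \<rightarrow> P\<close>, \<open>k : D \<rightarrow> P\<close> is a pushout.\<close>

definition is_pushout :: "('o, 'a) wcat \<Rightarrow> 'a \<Rightarrow> 'a \<Rightarrow> 'a \<Rightarrow> 'a \<Rightarrow> bool" where
  "is_pushout C f g h k \<longleftrightarrow>
    f \<in> Arr C \<and> g \<in> Arr C \<and> Dom C f = Dom C g \<and>
    (\<exists>P. h \<in> hom C (Cod C f) P \<and> k \<in> hom C (Cod C g) P \<and> Comp C h f = Comp C k g \<and>
      (\<forall>T. \<forall>h' \<in> hom C (Cod C f) T. \<forall>k' \<in> hom C (Cod C g) T.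
         Comp C h' f = Comp C k' g \<longrightarrow>
         (\<exists>!u. u \<in> hom C P T \<and> Comp C u h = h' \<and> Comp C u k = k')))"

locale category =
  fixes C :: "('o, 'a) wcat"
  assumes Dom_Obj: "f \<in> Arr C \<Longrightarrow> Dom C f \<in> Obj C"
    and Cod_Obj: "f \<in> Arr C \<Longrightarrow> Cod C f \<in> Obj C"
    and Id_hom: "x \<in> Obj C \<Longrightarrow> Id C x \<in> hom C x x"
    and Comp_hom: "f \<in> hom C x y \<Longrightarrow> g \<in> hom C y z \<Longrightarrow> Comp C g f \<in> hom C x z"
    and Comp_Id_right: "f \<in> hom C x y \<Longrightarrow> Comp C f (Id C x) = f"
    and Comp_Id_left: "f \<in> hom C x y \<Longrightarrow> Comp C (Id C y) f = f"
    and Comp_assoc: "f \<in> hom C w x \<Longrightarrow> g \<in> hom C x y \<Longrightarrow> h \<in> hom C y z \<Longrightarrow>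
      Comp C h (Comp C g f) = Comp C (Comp C h g) f"

locale waldhausen_category = category +
  assumes Zero_Obj: "Zero C \<in> Obj C"
    and Zero_initial: "x \<in> Obj C \<Longrightarrow> \<exists>!f. f \<in> hom C (Zero C) x"
    and Zero_terminal: "x \<in> Obj C \<Longrightarrow> \<exists>!f. f \<in> hom C x (Zero C)"
    and Cof_Arr: "Cof C \<subseteq> Arr C"
    and Weq_Arr: "Weq C \<subseteq> Arr C"
    and iso_Cof: "is_iso C f \<Longrightarrow> f \<in> Cof C"
    and iso_Weq: "is_iso C f \<Longrightarrow> f \<in> Weq C"
    and Comp_Cof: "f \<in> Cof C \<Longrightarrow> g \<in> Cof C \<Longrightarrow> Cod C f = Dom C g \<Longrightarrow> Comp C g f \<in> Cof C"
    and Comp_Weq: "f \<in> Weq C \<Longrightarrow> g \<in> Weq C \<Longrightarrow> Cod C f = Dom C g \<Longrightarrow> Comp C g f \<in> Weq C"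
    and Zero_Cof: "f \<in> hom C (Zero C) x \<Longrightarrow> f \<in> Cof C"
    and pushout_exists: "f \<in> Cof C \<Longrightarrow> g \<in> Arr C \<Longrightarrow> Dom C f = Dom C g \<Longrightarrow>
      \<exists>h k. is_pushout C f g h k"
    and cobase_change: "f \<in> Cof C \<Longrightarrow> is_pushout C f g h k \<Longrightarrow> k \<in> Cof C"
    and gluing: "\<lbrakk>f \<in> Cof C; f' \<in> Cof C; is_pushout C f g h k; is_pushout C f' g' h' k';
        a \<in> Weq C; b \<in> Weq C; d \<in> Weq C;
        a \<in> hom C (Dom C f) (Dom C f'); b \<in> hom C (Cod C f) (Cod C f');
        d \<in> hom C (Cod C g) (Cod C g');
        Comp C b f = Comp C f' a; Comp C d g = Comp C g' a;
        u \<in> hom C (Cod C h) (Cod C h');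
        Comp C u h = Comp C h' b; Comp C u k = Comp C k' d\<rbrakk> \<Longrightarrow> u \<in> Weq C"

locale exact_functor =
  C: waldhausen_category C + D: waldhausen_category D
  for C :: "('o, 'a) wcat" and D :: "('p, 'b) wcat" +
  fixes FO :: "'o \<Rightarrow> 'p" and FA :: "'a \<Rightarrow> 'b"
  assumes F_Obj: "x \<in> Obj C \<Longrightarrow> FO x \<in> Obj D"
    and F_hom: "f \<in> hom C x y \<Longrightarrow> FA f \<in> hom D (FO x) (FO y)"
    and F_Id: "x \<in> Obj C \<Longrightarrow> FA (Id C x) = Id D (FO x)"
    and F_Comp: "f \<in> hom C x y \<Longrightarrow> g \<in> hom C y z \<Longrightarrow> FA (Comp C g f) = Comp D (FA g) (FA f)"
    and F_Zero: "FO (Zero C) = Zero D"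
    and F_Cof: "f \<in> Cof C \<Longrightarrow> FA f \<in> Cof D"
    and F_Weq: "f \<in> Weq C \<Longrightarrow> FA f \<in> Weq D"
    and F_pushout: "f \<in> Cof C \<Longrightarrow> is_pushout C f g h k \<Longrightarrow>
      is_pushout D (FA f) (FA g) (FA h) (FA k)"


section \<open>Diagrams and cofibration cubes\<close>

text \<open>A functor from a preordered set \<open>(J, le)\<close> is given by its arrows \<open>X p q\<close> for \<open>p \<le> q\<close>; its
  value on the object \<open>p\<close> is the domain of the identity arrow \<open>X p p\<close>.\<close>

definition vertex :: "('o, 'a) wcat \<Rightarrow> ('j \<Rightarrow> 'j \<Rightarrow> 'a) \<Rightarrow> 'j \<Rightarrow> 'o" where
  "vertex C X p = Dom C (X p p)"

definition diagram :: "('o, 'a) wcat \<Rightarrow> 'j set \<Rightarrow> ('j \<Rightarrow> 'j \<Rightarrow> bool) \<Rightarrow> ('j \<Rightarrow> 'j \<Rightarrow> 'a) \<Rightarrow> bool" where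
  "diagram C J le X \<longleftrightarrow>
    (\<forall>p\<in>J. vertex C X p \<in> Obj C \<and> X p p = Id C (vertex C X p)) \<and>
    (\<forall>p\<in>J. \<forall>q\<in>J. le p q \<longrightarrow> X p q \<in> hom C (vertex C X p) (vertex C X q)) \<and>
    (\<forall>p\<in>J. \<forall>q\<in>J. \<forall>r\<in>J. le p q \<longrightarrow> le q r \<longrightarrow> X p r = Comp C (X q r) (X p q))"

definition is_cocone ::
    "('o, 'a) wcat \<Rightarrow> 'j set \<Rightarrow> ('j \<Rightarrow> 'j \<Rightarrow> bool) \<Rightarrow> ('j \<Rightarrow> 'j \<Rightarrow> 'a) \<Rightarrow> 'o \<Rightarrow> ('j \<Rightarrow> 'a) \<Rightarrow> bool" where
  "is_cocone C J le X T \<tau> \<longleftrightarrow> T \<in> Obj C \<and>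
    (\<forall>p\<in>J. \<tau> p \<in> hom C (vertex C X p) T) \<and>
    (\<forall>p\<in>J. \<forall>q\<in>J. le p q \<longrightarrow> Comp C (\<tau> q) (X p q) = \<tau> p)"

definition is_colimit ::
    "('o, 'a) wcat \<Rightarrow> 'j set \<Rightarrow> ('j \<Rightarrow> 'j \<Rightarrow> bool) \<Rightarrow> ('j \<Rightarrow> 'j \<Rightarrow> 'a) \<Rightarrow> 'o \<Rightarrow> ('j \<Rightarrow> 'a) \<Rightarrow> bool" where
  "is_colimit C J le X L \<iota> \<longleftrightarrow> is_cocone C J le X L \<iota> \<and>
    (\<forall>T \<tau>. is_cocone C J le X T \<tau> \<longrightarrow>
      (\<exists>!u. u \<in> hom C L T \<and> (\<forall>p\<in>J. Comp C u (\<iota> p) = \<tau> p)))"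

text \<open>A cube is a functor \<open>Y\<close> on the subsets of \<open>{..<n}\<close>. It is a cofibration cube if, for every \<open>U\<close>,
  the colimit of the values on the proper subsets of \<open>U\<close> exists and maps to the value at \<open>U\<close>
  by a cofibration.\<close>

definition cofibration_cube :: "('o, 'a) wcat \<Rightarrow> nat \<Rightarrow> (nat set \<Rightarrow> nat set \<Rightarrow> 'a) \<Rightarrow> bool" where
  "cofibration_cube C n Y \<longleftrightarrow> (\<forall>U \<subseteq> {..<n}. \<exists>L \<iota>. \<exists>u \<in> Cof C.
     is_colimit C {V. V \<subset> U} (\<subseteq>) Y L \<iota> \<and> u \<in> hom C L (vertex C Y U) \<and>
     (\<forall>V. V \<subset> U \<longrightarrow> Comp C u (\<iota> V) = Y V U))"


section \<open>Spectra of simplicial sets\<close>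

text \<open>The operators \<open>[l] \<rightarrow> [k]\<close> of the simplex category; only the values on \<open>{..l}\<close> matter.\<close>

definition simplex_op :: "nat \<Rightarrow> nat \<Rightarrow> (nat \<Rightarrow> nat) \<Rightarrow> bool" where
  "simplex_op l k \<theta> \<longleftrightarrow> mono_on {..l} \<theta> \<and> \<theta> ` {..l} \<subseteq> {..k}"

text \<open>\<open>pull X l k \<theta>\<close> is the map \<open>\<theta>\<^sup>* : X\<^sub>k \<rightarrow> X\<^sub>l\<close> induced by \<open>\<theta> : [l] \<rightarrow> [k]\<close>.\<close>

record 'x psset =
  simplices :: "nat \<Rightarrow> 'x set"
  pull :: "nat \<Rightarrow> nat \<Rightarrow> (nat \<Rightarrow> nat) \<Rightarrow> 'x \<Rightarrow> 'x"
  base :: "nat \<Rightarrow> 'x"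

locale pointed_simplicial_set =
  fixes X :: "'x psset"
  assumes pull_in: "simplex_op l k \<theta> \<Longrightarrow> x \<in> simplices X k \<Longrightarrow> pull X l k \<theta> x \<in> simplices X l"
    and pull_cong: "simplex_op l k \<theta> \<Longrightarrow> (\<And>i. i \<le> l \<Longrightarrow> \<theta> i = \<theta>' i) \<Longrightarrow> x \<in> simplices X k \<Longrightarrow>
      pull X l k \<theta> x = pull X l k \<theta>' x"
    and pull_id: "x \<in> simplices X k \<Longrightarrow> pull X k k id x = x"
    and pull_comp: "simplex_op j l \<eta> \<Longrightarrow> simplex_op l k \<theta> \<Longrightarrow> x \<in> simplices X k \<Longrightarrow>
      pull X j k (\<theta> \<circ> \<eta>) x = pull X j l \<eta> (pull X l k \<theta> x)"
    and base_in: "base X k \<in> simplices X k"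
    and pull_base: "simplex_op l k \<theta> \<Longrightarrow> pull X l k \<theta> (base X k) = base X l"

text \<open>The simplicial circle is \<open>\<Delta>[1] / \<partial>\<Delta>[1]\<close>: its \<open>k\<close>-simplices are the operators
  \<open>\<sigma> : [k] \<rightarrow> [1]\<close> with the two constant ones identified to the base point. A pointed simplicial map
  \<open>S\<^sup>1 \<and> X\<^sub>n \<rightarrow> X\<^sub>n\<^sub>+\<^sub>1\<close> is thus the same as a natural family of maps \<open>(\<sigma>, x) \<mapsto> bond n k \<sigma> x\<close> on
  \<open>k\<close>-simplices sending \<open>(\<sigma>, x)\<close> to the base point if \<open>\<sigma>\<close> is constant or \<open>x\<close> is the base point.\<close>

record 'x spectrum =
  level :: "nat \<Rightarrow> 'x psset"
  bond :: "nat \<Rightarrow> nat \<Rightarrow> (nat \<Rightarrow> nat) \<Rightarrow> 'x \<Rightarrow> 'x"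

locale simplicial_spectrum =
  fixes E :: "'x spectrum"
  assumes level_psset: "pointed_simplicial_set (level E n)"
    and bond_in: "simplex_op k 1 \<sigma> \<Longrightarrow> x \<in> simplices (level E n) k \<Longrightarrow>
      bond E n k \<sigma> x \<in> simplices (level E (Suc n)) k"
    and bond_cong: "simplex_op k 1 \<sigma> \<Longrightarrow> (\<And>i. i \<le> k \<Longrightarrow> \<sigma> i = \<sigma>' i) \<Longrightarrow>
      x \<in> simplices (level E n) k \<Longrightarrow> bond E n k \<sigma> x = bond E n k \<sigma>' x"
    and bond_const: "simplex_op k 1 \<sigma> \<Longrightarrow> \<sigma> 0 = \<sigma> k \<Longrightarrow> x \<in> simplices (level E n) k \<Longrightarrow>
      bond E n k \<sigma> x = base (level E (Suc n)) k"
    and bond_base: "simplex_op k 1 \<sigma> \<Longrightarrow>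
      bond E n k \<sigma> (base (level E n) k) = base (level E (Suc n)) k"
    and bond_pull: "simplex_op l k \<theta> \<Longrightarrow> simplex_op k 1 \<sigma> \<Longrightarrow> x \<in> simplices (level E n) k \<Longrightarrow>
      pull (level E (Suc n)) l k \<theta> (bond E n k \<sigma> x)
        = bond E n l (\<sigma> \<circ> \<theta>) (pull (level E n) l k \<theta> x)"

locale spectrum_map =
  E: simplicial_spectrum E + F: simplicial_spectrum F
  for E :: "'x spectrum" and F :: "'y spectrum" +
  fixes f :: "nat \<Rightarrow> nat \<Rightarrow> 'x \<Rightarrow> 'y"
  assumes map_in: "x \<in> simplices (level E n) k \<Longrightarrow> f n k x \<in> simplices (level F n) k"
    and map_pull: "simplex_op l k \<theta> \<Longrightarrow> x \<in> simplices (level E n) k \<Longrightarrow>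
      f n l (pull (level E n) l k \<theta> x) = pull (level F n) l k \<theta> (f n k x)"
    and map_base: "f n k (base (level E n) k) = base (level F n) k"
    and map_bond: "simplex_op k 1 \<sigma> \<Longrightarrow> x \<in> simplices (level E n) k \<Longrightarrow>
      f (Suc n) k (bond E n k \<sigma> x) = bond F n k \<sigma> (f n k x)"


section \<open>The Waldhausen K-theory spectrum\<close>

text \<open>The \<open>n\<close>-th level is the diagonal of the \<open>(n+1)\<close>-fold multisimplicial set
  \<open>N\<^sub>\<bullet> w S\<^sub>\<bullet> \<dots> S\<^sub>\<bullet> C\<close> with \<open>n\<close> iterations of the \<open>S\<^sub>\<bullet>\<close>-construction; level 0 is the nerve of \<open>w C\<close>.
  The iterated construction is written out as an \<open>n\<close>-fold one: a \<open>k\<close>-simplex is a functor on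
  \<open>[k] \<times> Ar[k]\<^sup>n\<close>. The factor \<open>[k]\<close> is the direction of the nerve, and the objects of the arrow poset
  \<open>Ar[k]\<close> are the pairs \<open>i \<le> j\<close> in \<open>{0..k}\<close>, ordered componentwise.\<close>

type_synonym index = "nat \<times> (nat \<times> nat) list"

definition indices :: "nat \<Rightarrow> nat \<Rightarrow> index set" where
  "indices n k = {(s, p). s \<le> k \<and> length p = n \<and> (\<forall>(i, j) \<in> set p. i \<le> j \<and> j \<le> k)}"

definition index_le :: "index \<Rightarrow> index \<Rightarrow> bool" where
  "index_le x y \<longleftrightarrow> fst x \<le> fst y \<and>
     list_all2 (\<lambda>a b. fst a \<le> fst b \<and> snd a \<le> snd b) (snd x) (snd y)"

text \<open>Extending by \<open>undefined\<close> makes equality of diagrams mean equality on the index poset.\<close>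

definition index_restrict :: "nat \<Rightarrow> nat \<Rightarrow> (index \<Rightarrow> index \<Rightarrow> 'a) \<Rightarrow> index \<Rightarrow> index \<Rightarrow> 'a" where
  "index_restrict n k X = (\<lambda>x y.
     if x \<in> indices n k \<and> y \<in> indices n k \<and> index_le x y then X x y else undefined)"

text \<open>The corners of the cube spanned by \<open>p\<close> and \<open>q\<close>.\<close>

definition corner :: "(nat \<times> nat) list \<Rightarrow> (nat \<times> nat) list \<Rightarrow> nat set \<Rightarrow> (nat \<times> nat) list" where
  "corner p q V = map (\<lambda>c. if c \<in> V then q ! c else p ! c) [0..<length p]"

text \<open>The four conditions are: vertices with a degenerate coordinate \<open>(i, i)\<close> are zero; enlarging second
  indices \<open>(i, j) \<rightarrow> (i, j')\<close> in all coordinates gives cofibration cubes (the cofibrations of the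
  iterated \<open>S\<^sub>\<bullet>\<close>-construction); in every coordinate, \<open>(i, j) \<rightarrow> (i, l) \<rightarrow> (j, l)\<close> is a cofibre sequence,
  i.e. the square with fourth corner \<open>(j, j)\<close> is a pushout; the nerve direction consists of
  weak equivalences.\<close>

definition wS_simplices :: "('o, 'a) wcat \<Rightarrow> nat \<Rightarrow> nat \<Rightarrow> (index \<Rightarrow> index \<Rightarrow> 'a) set" where
  "wS_simplices C n k = {X.
     index_restrict n k X = X \<and>
     diagram C (indices n k) index_le X \<and>
     (\<forall>(s, p) \<in> indices n k. (\<exists>(i, j) \<in> set p. i = j) \<longrightarrow> vertex C X (s, p) = Zero C) \<and>
     (\<forall>s p q. (s, p) \<in> indices n k \<longrightarrow> (s, q) \<in> indices n k \<longrightarrow> index_le (s, p) (s, q) \<longrightarrow>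
        map fst p = map fst q \<longrightarrow>
        cofibration_cube C n (\<lambda>V W. X (s, corner p q V) (s, corner p q W))) \<and>
     (\<forall>s p c i j l. (s, p) \<in> indices n k \<longrightarrow> c < n \<longrightarrow> p ! c = (i, j) \<longrightarrow> j \<le> l \<longrightarrow> l \<le> k \<longrightarrow>
        is_pushout C
          (X (s, p) (s, p[c := (i, l)])) (X (s, p) (s, p[c := (j, j)]))
          (X (s, p[c := (i, l)]) (s, p[c := (j, l)])) (X (s, p[c := (j, j)]) (s, p[c := (j, l)]))) \<and>
     (\<forall>s t p. (s, p) \<in> indices n k \<longrightarrow> (t, p) \<in> indices n k \<longrightarrow> s \<le> t \<longrightarrow>
        X (s, p) (t, p) \<in> Weq C)}"

definition reindex :: "(nat \<Rightarrow> nat) \<Rightarrow> index \<Rightarrow> index" where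
  "reindex \<theta> x = (\<theta> (fst x), map (map_prod \<theta> \<theta>) (snd x))"

definition zero_arrow :: "('o, 'a) wcat \<Rightarrow> 'o \<Rightarrow> 'o \<Rightarrow> 'a" where
  "zero_arrow C x y =
     Comp C (THE f. f \<in> hom C (Zero C) y) (THE f. f \<in> hom C x (Zero C))"

definition K_level :: "('o, 'a) wcat \<Rightarrow> nat \<Rightarrow> (index \<Rightarrow> index \<Rightarrow> 'a) psset" where
  "K_level C n = \<lparr>
     simplices = wS_simplices C n,
     pull = (\<lambda>l k \<theta> X. index_restrict n l (\<lambda>x y. X (reindex \<theta> x) (reindex \<theta> y))),
     base = (\<lambda>k. index_restrict n k (\<lambda>x y. Id C (Zero C)))\<rparr>"

text \<open>The structure map comes from \<open>D = S\<^sub>1 D\<close>: the simplex \<open>\<sigma> : [k] \<rightarrow> [1]\<close> of the circle sends an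
  object \<open>A\<close> of \<open>D\<close> to \<open>\<sigma>\<^sup>* A\<close> in \<open>S\<^sub>k D\<close>, whose value at \<open>(a, b)\<close> is \<open>A\<close> if \<open>\<sigma> a = 0\<close> and \<open>\<sigma> b = 1\<close>, and zero
  otherwise. Here \<open>D\<close> is the \<open>n\<close>-fold construction and the new coordinate is put first.\<close>

definition K_bond ::
    "('o, 'a) wcat \<Rightarrow> nat \<Rightarrow> nat \<Rightarrow> (nat \<Rightarrow> nat) \<Rightarrow> (index \<Rightarrow> index \<Rightarrow> 'a) \<Rightarrow> (index \<Rightarrow> index \<Rightarrow> 'a)" where
  "K_bond C n k \<sigma> X =
    (let live = (\<lambda>x :: index. \<sigma> (fst (hd (snd x))) = 0 \<and> \<sigma> (snd (hd (snd x))) = 1);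
         rest = (\<lambda>x :: index. (fst x, tl (snd x)));
         ob = (\<lambda>x. if live x then vertex C X (rest x) else Zero C)
     in index_restrict (Suc n) k (\<lambda>x y.
          if live x \<and> live y then X (rest x) (rest y) else zero_arrow C (ob x) (ob y)))"

definition K_spectrum :: "('o, 'a) wcat \<Rightarrow> (index \<Rightarrow> index \<Rightarrow> 'a) spectrum" where
  "K_spectrum C = \<lparr>level = K_level C, bond = K_bond C\<rparr>"

definition K_map ::
    "('a \<Rightarrow> 'b) \<Rightarrow> nat \<Rightarrow> nat \<Rightarrow> (index \<Rightarrow> index \<Rightarrow> 'a) \<Rightarrow> (index \<Rightarrow> index \<Rightarrow> 'b)" where
  "K_map FA n k X = index_restrict n k (\<lambda>x y. FA (X x y))"


section \<open>Modules over pointed monoids\<close>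

text \<open>A pointed monoid is a type of sort \<open>{monoid_mult, mult_zero}\<close>. It may be the trivial one with
  \<open>0 = 1\<close>.\<close>

definition pointed_monoid_hom ::
    "('m::{monoid_mult, mult_zero} \<Rightarrow> 'n::{monoid_mult, mult_zero}) \<Rightarrow> bool" where
  "pointed_monoid_hom \<phi> \<longleftrightarrow> \<phi> 1 = 1 \<and> \<phi> 0 = 0 \<and> (\<forall>x y. \<phi> (x * y) = \<phi> x * \<phi> y)"

record ('m, 's) pmod =
  carrier :: "'s set"
  pt :: "'s"
  act :: "'s \<Rightarrow> 'm \<Rightarrow> 's"

text \<open>The last condition only normalises the irrelevant values of the action outside the carrier.\<close>

locale pointed_module =
  fixes S :: "('m::{monoid_mult, mult_zero}, 's) pmod"
  assumes pt_carrier: "pt S \<in> carrier S"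
    and act_carrier: "s \<in> carrier S \<Longrightarrow> act S s m \<in> carrier S"
    and act_one: "s \<in> carrier S \<Longrightarrow> act S s 1 = s"
    and act_mult: "s \<in> carrier S \<Longrightarrow> act S s (m * m') = act S (act S s m) m'"
    and act_pt: "act S (pt S) m = pt S"
    and act_zero: "s \<in> carrier S \<Longrightarrow> act S s 0 = pt S"
    and act_outside: "s \<notin> carrier S \<Longrightarrow> act S s m = pt S"

definition finitely_generated :: "('m::{monoid_mult, mult_zero}, 's) pmod \<Rightarrow> bool" where
  "finitely_generated S \<longleftrightarrow>
     (\<exists>S'. finite S' \<and> S' \<subseteq> carrier S \<and> carrier S = (\<Union>s\<in>S'. range (act S s)))"

definition fg_modules :: "('m::{monoid_mult, mult_zero}, 's) pmod set" where
  "fg_modules = {S. pointed_module S \<and> finitely_generated S}"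

definition regular_module :: "('n::{monoid_mult, mult_zero}, 'n) pmod" where
  "regular_module = \<lparr>carrier = UNIV, pt = 0, act = (*)\<rparr>"

definition module_homs ::
    "('m::{monoid_mult, mult_zero}, 's) pmod \<Rightarrow> ('m, 't) pmod \<Rightarrow> ('s \<Rightarrow> 't) set" where
  "module_homs S T = {f \<in> carrier S \<rightarrow>\<^sub>E carrier T.
     f (pt S) = pt T \<and> (\<forall>s \<in> carrier S. \<forall>m. f (act S s m) = act T (f s) m)}"

text \<open>\<open>T / A\<close> for a submodule with carrier \<open>A\<close>, realised on \<open>(T - A) \<union> {0}\<close>.\<close>

definition quotient_module ::
    "('m::{monoid_mult, mult_zero}, 's) pmod \<Rightarrow> 's set \<Rightarrow> ('m, 's) pmod" where
  "quotient_module T A = \<lparr>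
     carrier = insert (pt T) (carrier T - A),
     pt = pt T,
     act = (\<lambda>s m. if s \<in> carrier T - A \<and> act T s m \<notin> A then act T s m else pt T)\<rparr>"

record ('m, 's) marrow =
  src :: "('m, 's) pmod"
  fn :: "'s \<Rightarrow> 's"
  tgt :: "('m, 's) pmod"

text \<open>The finitely generated modules whose underlying set is a subset of the type \<open>'u\<close>. If \<open>'u\<close> is
  infinite and \<open>'m\<close> embeds into \<open>'u\<close>, then every finitely generated \<open>'m\<close>-module is isomorphic to
  one of these. The distinguished zero object has the one-element set \<open>{undefined}\<close> as carrier.\<close>

definition FG ::
    "'m::{monoid_mult, mult_zero} itself \<Rightarrow> 'u itself \<Rightarrow> (('m, 'u) pmod, ('m, 'u) marrow) wcat" where
  "FG _ _ =
    (let arrows = {f :: ('m, 'u) marrow. src f \<in> fg_modules \<and> tgt f \<in> fg_modules \<and>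
                     fn f \<in> module_homs (src f) (tgt f)};
         ident = (\<lambda>S. \<lparr>src = S, fn = restrict id (carrier S), tgt = S\<rparr>);
         cmp = (\<lambda>g f. \<lparr>src = src f, fn = compose (carrier (src f)) (fn g) (fn f), tgt = tgt g\<rparr>)
     in \<lparr>
      Obj = fg_modules,
      Arr = arrows,
      Dom = src,
      Cod = tgt,
      Id = ident,
      Comp = cmp,
      Zero = \<lparr>carrier = {undefined}, pt = undefined, act = (\<lambda>_ _. undefined)\<rparr>,
      Cof = {f \<in> arrows.
        (\<exists>r \<in> module_homs (tgt f) (src f). \<forall>s \<in> carrier (src f). r (fn f s) = s) \<and>
        quotient_module (tgt f) (fn f ` carrier (src f)) \<in> fg_modules},
      Weq = {f \<in> arrows. \<exists>g \<in> arrows. src g = tgt f \<and> tgt g = src f \<and>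
        cmp g f = ident (src f) \<and> cmp f g = ident (tgt f)}\<rparr>)"

text \<open>\<open>G_spectrum TYPE('m) TYPE('u)\<close> is the K-theory spectrum \<open>G(M)\<close>.\<close>

definition G_spectrum ::
    "'m::{monoid_mult, mult_zero} itself \<Rightarrow> 'u itself \<Rightarrow> (index \<Rightarrow> index \<Rightarrow> ('m, 'u) marrow) spectrum"
  where "G_spectrum m u = K_spectrum (FG m u)"

definition restrict_scalars ::
    "('m::{monoid_mult, mult_zero} \<Rightarrow> 'n::{monoid_mult, mult_zero}) \<Rightarrow> ('n, 's) pmod \<Rightarrow> ('m, 's) pmod"
  where "restrict_scalars \<phi> S = \<lparr>carrier = carrier S, pt = pt S, act = (\<lambda>s m. act S s (\<phi> m))\<rparr>"

definition restrict_scalars_arrow ::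
    "('m::{monoid_mult, mult_zero} \<Rightarrow> 'n::{monoid_mult, mult_zero}) \<Rightarrow> ('n, 's) marrow \<Rightarrow> ('m, 's) marrow"
  where "restrict_scalars_arrow \<phi> f =
     \<lparr>src = restrict_scalars \<phi> (src f), fn = fn f, tgt = restrict_scalars \<phi> (tgt f)\<rparr>"

definition transfer_map ::
    "('m::{monoid_mult, mult_zero} \<Rightarrow> 'n::{monoid_mult, mult_zero}) \<Rightarrow> nat \<Rightarrow> nat \<Rightarrow>
     (index \<Rightarrow> index \<Rightarrow> ('n, 'u) marrow) \<Rightarrow> (index \<Rightarrow> index \<Rightarrow> ('m, 'u) marrow)" where
  "transfer_map \<phi> = K_map (restrict_scalars_arrow \<phi>)"

end

theory Submission
  imports Defs
begin

text \<open>The category of finitely generated modules over an infinite universe has all finite colimits, and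
  they are computed on pointed sets: a cocone is a colimit if and only if it is jointly surjective and
  identifies exactly the elements related by the equivalence relation which the diagram generates.
  This criterion does not mention the monoid, so restriction of scalars preserves finite colimits;
  finite generation of \<open>N\<close> over \<open>M\<close> is needed only to land in finitely generated modules.

  An exact functor that also preserves the finite colimits in the definition of cofibration cubes acts
  on the simplices of every level of the K-theory spectrum. That the structure maps of the spectrum
  are well defined comes down to a cube with one new direction being either constant in it, or
  zero on one of the two faces; in both cases the latching objects are read off the old cube.\<close>

text \<open>The universal property of a colimit in \<open>FG\<close> tests only against modules over
  the same monoid, and a finitely generated \<open>M\<close>-module need not come from an
  \<open>N\<close>-module. So universality cannot be carried along restriction of scalars directly.
  Instead, any colimit in \<open>FG\<close> is compared with one built by hand as a quotient of a
  disjoint union, and the criterion on pointed sets is read off through the comparison maps. This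
  construction explains the finiteness conditions: a disjoint union of finitely many carriers fits
  again into the infinite universe \<open>'u\<close>, and its quotient is generated by the finitely
  many generators of the pieces.

  Pushouts along cofibrations alone do not cover the definition of a cofibration cube, whose
  latching objects are colimits over the proper subsets of a finite set. For the empty set this is
  the empty diagram, with the zero module as colimit. The Waldhausen axioms are formal by
  comparison: weak equivalences are isomorphisms, and cofibrations are maps with a
  retraction.\<close>

section \<open>Categories with pushouts\<close>

context category
begin

lemma hom_Obj: "f \<in> hom C x y \<Longrightarrow> x \<in> Obj C \<and> y \<in> Obj C"
  using Dom_Obj Cod_Obj by (auto simp: hom_def)

lemma hom_Dom_Cod: "f \<in> hom C x y \<Longrightarrow> f \<in> Arr C \<and> Dom C f = x \<and> Cod C f = y"
  by (simp add: hom_def)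

lemma iso_inverse:
  assumes "is_iso C f" "f \<in> hom C x y"
  obtains g where "g \<in> hom C y x" "Comp C g f = Id C x" "Comp C f g = Id C y"
  using assms unfolding is_iso_def by (auto simp: hom_def)

lemma isoI:
  assumes "f \<in> hom C x y" "g \<in> hom C y x" "Comp C g f = Id C x" "Comp C f g = Id C y"
  shows "is_iso C f"
  using assms unfolding is_iso_def by (auto simp: hom_def)

lemma Comp_cancel:
  assumes "f \<in> hom C x y" "g \<in> hom C y x" "Comp C g f = Id C x"
  shows "h \<in> hom C x z \<Longrightarrow> Comp C (Comp C h g) f = h"
    and "k \<in> hom C w x \<Longrightarrow> Comp C g (Comp C f k) = k"
proof -
  show "Comp C (Comp C h g) f = h" if "h \<in> hom C x z"
    using Comp_assoc[OF assms(1,2) that] Comp_Id_right[OF that] assms(3) by simp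
  show "Comp C g (Comp C f k) = k" if "k \<in> hom C w x"
    using Comp_assoc[OF that assms(1,2)] Comp_Id_left[OF that] assms(3) by simp
qed

lemma iso_Comp:
  assumes "is_iso C f" "is_iso C g" "f \<in> hom C x y" "g \<in> hom C y z"
  shows "is_iso C (Comp C g f)"
proof -
  obtain f' where f': "f' \<in> hom C y x" "Comp C f' f = Id C x" "Comp C f f' = Id C y"
    using iso_inverse[OF assms(1,3)] by blast
  obtain g' where g': "g' \<in> hom C z y" "Comp C g' g = Id C y" "Comp C g g' = Id C z"
    using iso_inverse[OF assms(2,4)] by blast
  show ?thesis
  proof (rule isoI)
    show "Comp C g f \<in> hom C x z" "Comp C f' g' \<in> hom C z x"
      by (rule Comp_hom[OF assms(3,4)] Comp_hom[OF g'(1) f'(1)])+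
    have "Comp C (Comp C f' g') (Comp C g f) = Comp C f' (Comp C g' (Comp C g f))"
      using Comp_assoc[OF Comp_hom[OF assms(3,4)] g'(1) f'(1)] by simp
    then show "Comp C (Comp C f' g') (Comp C g f) = Id C x"
      using Comp_cancel(2)[OF assms(4) g'(1,2) assms(3)] f' by simp
    have "Comp C (Comp C g f) (Comp C f' g') = Comp C g (Comp C f (Comp C f' g'))"
      using Comp_assoc[OF Comp_hom[OF g'(1) f'(1)] assms(3,4)] by simp
    then show "Comp C (Comp C g f) (Comp C f' g') = Id C z"
      using Comp_cancel(2)[OF f'(1) assms(3) f'(3) g'(1)] g' by simp
  qed
qed

lemma pushout_homs:
  assumes "is_pushout C f g h k"
  shows "f \<in> hom C (Dom C f) (Cod C f)" "g \<in> hom C (Dom C f) (Cod C g)"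
    "h \<in> hom C (Cod C f) (Cod C h)" "k \<in> hom C (Cod C g) (Cod C h)" "Comp C h f = Comp C k g"
  using assms unfolding is_pushout_def by (auto simp: hom_def)

lemma pushout_factor:
  assumes "is_pushout C f g h k" "h' \<in> hom C (Cod C f) T" "k' \<in> hom C (Cod C g) T"
    and "Comp C h' f = Comp C k' g"
  shows "\<exists>!u. u \<in> hom C (Cod C h) T \<and> Comp C u h = h' \<and> Comp C u k = k'"
proof -
  obtain P where "h \<in> hom C (Cod C f) P" "\<forall>T. \<forall>h' \<in> hom C (Cod C f) T. \<forall>k' \<in> hom C (Cod C g) T.
         Comp C h' f = Comp C k' g \<longrightarrow>
         (\<exists>!u. u \<in> hom C P T \<and> Comp C u h = h' \<and> Comp C u k = k')"
    using assms(1) unfolding is_pushout_def by blast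
  moreover from this have "Cod C h = P" by (simp add: hom_def)
  ultimately show ?thesis using assms(2-4) by blast
qed

text \<open>The identity has the same composites with the legs, so uniqueness of the induced map
  applies. This is the test by which maps between two pushouts are recognised as mutually
  inverse.\<close>

lemma pushout_endo_eq_Id:
  assumes "is_pushout C f g h k" "u \<in> hom C (Cod C h) (Cod C h)" "Comp C u h = h" "Comp C u k = k"
  shows "u = Id C (Cod C h)"
proof -
  note po = pushout_homs[OF assms(1)]
  have "Id C (Cod C h) \<in> hom C (Cod C h) (Cod C h)"
    using po hom_Obj Id_hom by blast
  moreover have "Comp C (Id C (Cod C h)) h = h" "Comp C (Id C (Cod C h)) k = k"
    using po Comp_Id_left by blast+
  ultimately show ?thesis
    using pushout_factor[OF assms(1) po(3,4,5)] assms(2-4) by blast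
qed

text \<open>The inverses of \<open>a\<close>, \<open>b\<close>, \<open>d\<close> form a map of spans
  in the opposite direction and induce \<open>v\<close>; both composites of \<open>u\<close> and
  \<open>v\<close> fix the legs of a pushout. With isomorphisms as weak equivalences this is the
  gluing axiom.\<close>

lemma pushout_iso:
  assumes po: "is_pushout C f g h k" and po': "is_pushout C f' g' h' k'"
    and iso: "is_iso C a" "is_iso C b" "is_iso C d"
    and a: "a \<in> hom C (Dom C f) (Dom C f')" and b: "b \<in> hom C (Cod C f) (Cod C f')"
    and d: "d \<in> hom C (Cod C g) (Cod C g')"
    and sq: "Comp C b f = Comp C f' a" "Comp C d g = Comp C g' a"
    and u: "u \<in> hom C (Cod C h) (Cod C h')" "Comp C u h = Comp C h' b" "Comp C u k = Comp C k' d"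
  shows "is_iso C u"
proof -
  note p = pushout_homs[OF po] and p' = pushout_homs[OF po']
  obtain a' where a': "a' \<in> hom C (Dom C f') (Dom C f)" "Comp C a' a = Id C (Dom C f)" "Comp C a a' = Id C (Dom C f')"
    using iso_inverse[OF iso(1) a] by blast
  obtain b' where b': "b' \<in> hom C (Cod C f') (Cod C f)" "Comp C b' b = Id C (Cod C f)" "Comp C b b' = Id C (Cod C f')"
    using iso_inverse[OF iso(2) b] by blast
  obtain d' where d': "d' \<in> hom C (Cod C g') (Cod C g)" "Comp C d' d = Id C (Cod C g)" "Comp C d d' = Id C (Cod C g')"
    using iso_inverse[OF iso(3) d] by blast
  \<comment> \<open>A commuting square stays commutative when two opposite invertible sides are
    replaced by their inverses. It is stated for generic sides, to be used once with
    \<open>b\<close> and once with \<open>d\<close>.\<close>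
  have inv_sq: "Comp C y' q' = Comp C q a'"
    if "Comp C y q = Comp C q' a" "y' \<in> hom C z' z" "y \<in> hom C z z'" "Comp C y' y = Id C z"
      "q \<in> hom C (Dom C f) z" "q' \<in> hom C (Dom C f') z'" for y y' q q' z z'
  proof -
    have "q' = Comp C (Comp C q' a) a'"
      using Comp_cancel(1)[OF a'(1) a a'(3) that(6)] by simp
    also have "\<dots> = Comp C (Comp C y q) a'" using that(1) by simp
    also have "\<dots> = Comp C y (Comp C q a')" using Comp_assoc[OF a'(1) that(5,3)] by simp
    finally show ?thesis
      using Comp_cancel(2)[OF that(3,2,4) Comp_hom[OF a'(1) that(5)]] by simp
  qed
  have "Comp C (Comp C h b') f' = Comp C (Comp C k d') g'"
  proof -
    have "Comp C (Comp C h b') f' = Comp C (Comp C h f) a'"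
      using inv_sq[OF sq(1) b'(1) b b'(2) p(1) p'(1)] Comp_assoc[OF p'(1) b'(1) p(3)]
        Comp_assoc[OF a'(1) p(1,3)] by simp
    also have "\<dots> = Comp C (Comp C k d') g'"
      using inv_sq[OF sq(2) d'(1) d d'(2) p(2) p'(2)] Comp_assoc[OF p'(2) d'(1) p(4)]
        Comp_assoc[OF a'(1) p(2,4)] p(5) by simp
    finally show ?thesis .
  qed
  then obtain v where v: "v \<in> hom C (Cod C h') (Cod C h)" "Comp C v h' = Comp C h b'" "Comp C v k' = Comp C k d'"
    using pushout_factor[OF po' Comp_hom[OF b'(1) p(3)] Comp_hom[OF d'(1) p(4)]] by blast
  show ?thesis
  proof (rule isoI[OF u(1) v(1)])
    have "Comp C (Comp C v u) h = h" "Comp C (Comp C v u) k = k"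
      using Comp_assoc[OF p(3) u(1) v(1)] Comp_assoc[OF b p'(3) v(1)] Comp_cancel(1)[OF b b'(1,2) p(3)]
        Comp_assoc[OF p(4) u(1) v(1)] Comp_assoc[OF d p'(4) v(1)] Comp_cancel(1)[OF d d'(1,2) p(4)]
        u v by simp_all
    then show "Comp C v u = Id C (Cod C h)"
      using pushout_endo_eq_Id[OF po] Comp_hom[OF u(1) v(1)] by blast
    have "Comp C (Comp C u v) h' = h'" "Comp C (Comp C u v) k' = k'"
      using Comp_assoc[OF p'(3) v(1) u(1)] Comp_assoc[OF b'(1) p(3) u(1)] Comp_cancel(1)[OF b'(1) b b'(3) p'(3)]
        Comp_assoc[OF p'(4) v(1) u(1)] Comp_assoc[OF d'(1) p(4) u(1)] Comp_cancel(1)[OF d'(1) d d'(3) p'(4)]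
        u v by simp_all
    then show "Comp C u v = Id C (Cod C h')"
      using pushout_endo_eq_Id[OF po'] Comp_hom[OF v(1) u(1)] by blast
  qed
qed

lemma split_mono_Comp:
  assumes "f \<in> hom C x y" "r \<in> hom C y x" "Comp C r f = Id C x"
    and "g \<in> hom C y z" "q \<in> hom C z y" "Comp C q g = Id C y"
  shows "Comp C (Comp C r q) (Comp C g f) = Id C x"
  using Comp_assoc[OF Comp_hom[OF assms(1,4)] assms(5,2)] Comp_cancel(2)[OF assms(4-6,1)] assms(3) by simp

text \<open>Since \<open>r\<close> retracts \<open>f\<close>, the arrow \<open>Comp C g r\<close>
  and the identity of the target of \<open>g\<close> agree on the source of \<open>f\<close>. The
  map they induce out of the pushout is the retraction of \<open>k\<close>.\<close>

lemma pushout_split_mono: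
  assumes po: "is_pushout C f g h k"
    and r: "r \<in> hom C (Cod C f) (Dom C f)" "Comp C r f = Id C (Dom C f)"
  shows "\<exists>q\<in>hom C (Cod C k) (Dom C k). Comp C q k = Id C (Dom C k)"
proof -
  note p = pushout_homs[OF po]
  have "Comp C (Comp C g r) f = Comp C (Id C (Cod C g)) g"
    using Comp_cancel(1)[OF p(1) r p(2)] Comp_Id_left[OF p(2)] by simp
  then show ?thesis
    using pushout_factor[OF po Comp_hom[OF r(1) p(2)] Id_hom] hom_Obj[OF p(2)] hom_Dom_Cod[OF p(4)] by auto
qed

end

section \<open>Modules and their homomorphisms\<close>

lemma module_homs_carrier: "f \<in> module_homs S T \<Longrightarrow> s \<in> carrier S \<Longrightarrow> f s \<in> carrier T"
  by (auto simp: module_homs_def)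

lemma module_homs_pt: "f \<in> module_homs S T \<Longrightarrow> f (pt S) = pt T"
  by (auto simp: module_homs_def)

lemma module_homs_act:
  "f \<in> module_homs S T \<Longrightarrow> s \<in> carrier S \<Longrightarrow> f (act S s m) = act T (f s) m"
  by (auto simp: module_homs_def)

lemma module_homs_eqI:
  "f \<in> module_homs S T \<Longrightarrow> g \<in> module_homs S T \<Longrightarrow> (\<And>s. s \<in> carrier S \<Longrightarrow> f s = g s) \<Longrightarrow> f = g"
  unfolding module_homs_def by (blast intro: PiE_ext)

lemma restrict_module_homsI:
  assumes "pointed_module S"
    and "\<And>s. s \<in> carrier S \<Longrightarrow> f s \<in> carrier T" and "f (pt S) = pt T"
    and "\<And>s m. s \<in> carrier S \<Longrightarrow> f (act S s m) = act T (f s) m"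
  shows "restrict f (carrier S) \<in> module_homs S T"
  using assms pointed_module.pt_carrier[of S] pointed_module.act_carrier[of S]
  by (auto simp: module_homs_def)

lemma module_homs_id: "pointed_module S \<Longrightarrow> restrict id (carrier S) \<in> module_homs S S"
  by (rule restrict_module_homsI) auto

lemma module_homs_compose:
  assumes "pointed_module S" "f \<in> module_homs S T" "g \<in> module_homs T V"
  shows "compose (carrier S) g f \<in> module_homs S V"
  unfolding compose_def
  using assms module_homs_carrier[OF assms(2)] module_homs_carrier[OF assms(3)]
  by (intro restrict_module_homsI)
    (simp_all add: module_homs_pt module_homs_act[OF assms(2)] module_homs_act[OF assms(3)])

lemma fg_modules_pointed: "S \<in> fg_modules \<Longrightarrow> pointed_module S"
  by (simp add: fg_modules_def)

lemma fg_modules_generators: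
  assumes "S \<in> fg_modules"
  obtains G where "finite G" "G \<subseteq> carrier S" "\<And>s. s \<in> carrier S \<Longrightarrow> \<exists>g\<in>G. \<exists>m. s = act S g m"
proof -
  obtain G where G: "finite G" "G \<subseteq> carrier S" "carrier S = (\<Union>s\<in>G. range (act S s))"
    using assms unfolding fg_modules_def finitely_generated_def by force
  have "\<exists>g\<in>G. \<exists>m. s = act S g m" if "s \<in> carrier S" for s
    using that unfolding G(3) by blast
  with G(1,2) show ?thesis by (rule that)
qed

lemma fg_modulesI:
  assumes "pointed_module S" "finite G" "G \<subseteq> carrier S"
    and "\<And>s. s \<in> carrier S \<Longrightarrow> \<exists>g\<in>G. \<exists>m. s = act S g m"
  shows "S \<in> fg_modules"
proof -
  have "carrier S = (\<Union>s\<in>G. range (act S s))"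
    using assms pointed_module.act_carrier[OF assms(1)] by blast
  then show ?thesis
    using assms by (auto simp: fg_modules_def finitely_generated_def)
qed

lemma zero_module_fg:
  "\<lparr>carrier = {undefined}, pt = undefined, act = (\<lambda>_ _. undefined)\<rparr> \<in> fg_modules" (is "?Z \<in> _")
proof -
  have "pointed_module ?Z" by unfold_locales simp_all
  then show ?thesis by (rule fg_modulesI[where G = "{undefined}"]) simp_all
qed

text \<open>A generator in the stable set \<open>A\<close> has its whole orbit in \<open>A\<close>,
  so every element outside \<open>A\<close> comes from a generator outside \<open>A\<close>. The
  base point is added to generate the collapsed part.\<close>

lemma quotient_module_fg:
  assumes T: "T \<in> fg_modules" and "pt T \<in> A"
    and stable: "\<And>s m. s \<in> A \<Longrightarrow> act T s m \<in> A"
  shows "quotient_module T A \<in> fg_modules"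
proof -
  interpret T: pointed_module T using T by (rule fg_modules_pointed)
  obtain G where G: "finite G" "G \<subseteq> carrier T"
    "\<And>s. s \<in> carrier T \<Longrightarrow> \<exists>g\<in>G. \<exists>m. s = act T g m"
    using fg_modules_generators[OF T] by blast
  show ?thesis
  proof (rule fg_modulesI[where G = "insert (pt T) (G - A)"])
    show "pointed_module (quotient_module T A)"
      using assms T.act_carrier T.pt_carrier
      by unfold_locales
        (auto simp: quotient_module_def T.act_one T.act_mult T.act_pt T.act_zero stable)
  next
    fix s assume "s \<in> carrier (quotient_module T A)"
    then consider "s = pt T" | "s \<in> carrier T" "s \<notin> A"
      by (auto simp: quotient_module_def)
    then show "\<exists>g\<in>insert (pt T) (G - A). \<exists>m. s = act (quotient_module T A) g m"
    proof cases
      case 1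
      then show ?thesis
        using assms(2) by (intro bexI[of _ "pt T"]) (auto simp: quotient_module_def)
    next
      case 2
      with G(3) obtain g m where gm: "g \<in> G" "s = act T g m" by blast
      then have "g \<notin> A" using 2 stable by blast
      then show ?thesis
        using gm 2 G(2) by (intro bexI[of _ g] exI[of _ m]) (auto simp: quotient_module_def)
    qed
  qed (use G in \<open>auto simp: quotient_module_def\<close>)
qed

section \<open>Finite colimits of modules\<close>

text \<open>The codomain \<open>'b\<close> is arbitrary because two kinds of families are needed:
  module-valued ones, which are cocones, and \<open>bool\<close>-valued ones, which separate
  elements. Base points are compared with one another, so that no base point of \<open>'b\<close>
  has to be named.\<close>

definition glue_compatible ::
    "'i set \<Rightarrow> ('i \<Rightarrow> ('m, 's) pmod) \<Rightarrow> (('i \<times> 's) \<times> ('i \<times> 's)) set \<Rightarrow> ('i \<Rightarrow> 's \<Rightarrow> 'b) \<Rightarrow> bool" where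
  "glue_compatible I A R \<tau> \<longleftrightarrow> (\<forall>((i, x), (j, y)) \<in> R. \<tau> i x = \<tau> j y) \<and>
     (\<forall>i\<in>I. \<forall>j\<in>I. \<tau> i (pt (A i)) = \<tau> j (pt (A j)))"

text \<open>Two elements are identified by the equivalence relation generated by \<open>R\<close> and the base points
  if and only if no compatible predicate separates them. The action does not enter, so that this
  description of colimits is visibly stable under restriction of scalars.\<close>

lemma glue_compatible_rel: "glue_compatible I A R \<tau> \<Longrightarrow> ((i, x), (j, y)) \<in> R \<Longrightarrow> \<tau> i x = \<tau> j y"
  unfolding glue_compatible_def by blast

lemma glue_compatible_pt:
  "glue_compatible I A R \<tau> \<Longrightarrow> i \<in> I \<Longrightarrow> j \<in> I \<Longrightarrow> \<tau> i (pt (A i)) = \<tau> j (pt (A j))"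
  unfolding glue_compatible_def by blast

lemma glue_compatibleI:
  assumes "\<And>i x j y. ((i, x), (j, y)) \<in> R \<Longrightarrow> \<tau> i x = \<tau> j y"
    and "\<And>i j. i \<in> I \<Longrightarrow> j \<in> I \<Longrightarrow> \<tau> i (pt (A i)) = \<tau> j (pt (A j))"
  shows "glue_compatible I A R \<tau>"
  using assms unfolding glue_compatible_def by blast

definition glued ::
    "'i set \<Rightarrow> ('i \<Rightarrow> ('m, 's) pmod) \<Rightarrow> (('i \<times> 's) \<times> ('i \<times> 's)) set \<Rightarrow> 'i \<Rightarrow> 's \<Rightarrow> 'i \<Rightarrow> 's \<Rightarrow> bool" where
  "glued I A R i x j y \<longleftrightarrow> (\<forall>P :: 'i \<Rightarrow> 's \<Rightarrow> bool. glue_compatible I A R P \<longrightarrow> P i x = P j y)"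

text \<open>Inserting the base point matters only for empty \<open>I\<close>, where the colimit is a
  one-point module. The last clause bounds the identifications from above; compatibility bounds them
  from below.\<close>

definition set_colimit ::
    "'i set \<Rightarrow> ('i \<Rightarrow> ('m, 's) pmod) \<Rightarrow> (('i \<times> 's) \<times> ('i \<times> 's)) set \<Rightarrow> ('m, 's) pmod
      \<Rightarrow> ('i \<Rightarrow> 's \<Rightarrow> 's) \<Rightarrow> bool" where
  "set_colimit I A R L \<iota> \<longleftrightarrow> glue_compatible I A R \<iota> \<and>
     carrier L = insert (pt L) (\<Union>i\<in>I. \<iota> i ` carrier (A i)) \<and>
     (\<forall>i\<in>I. \<forall>x\<in>carrier (A i). \<forall>j\<in>I. \<forall>y\<in>carrier (A j). \<iota> i x = \<iota> j y \<longrightarrow> glued I A R i x j y)"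

text \<open>The universal property in \<open>FG\<close>, freed from the packaging into arrows.
  Pushouts and colimits over posets are both brought to this form, with different families and
  relations; the test modules live on the same type \<open>'s\<close>, as the objects of
  \<open>FG\<close> do.\<close>

definition module_colimit ::
    "'i set \<Rightarrow> ('i \<Rightarrow> ('m::{monoid_mult, mult_zero}, 's) pmod) \<Rightarrow> (('i \<times> 's) \<times> ('i \<times> 's)) set
      \<Rightarrow> ('m, 's) pmod \<Rightarrow> ('i \<Rightarrow> 's \<Rightarrow> 's) \<Rightarrow> bool" where
  "module_colimit I A R L \<iota> \<longleftrightarrow>
     (\<forall>i\<in>I. \<iota> i \<in> module_homs (A i) L) \<and> glue_compatible I A R \<iota> \<and>
     (\<forall>T\<in>(fg_modules :: ('m, 's) pmod set). \<forall>\<tau>. (\<forall>i\<in>I. \<tau> i \<in> module_homs (A i) T) \<longrightarrow> glue_compatible I A R \<tau> \<longrightarrow>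
        (\<exists>!u. u \<in> module_homs L T \<and> (\<forall>i\<in>I. compose (carrier (A i)) u (\<iota> i) = \<tau> i)))"

lemma module_colimit_factor:
  fixes L T :: "('m::{monoid_mult, mult_zero}, 's) pmod"
  assumes "module_colimit I A R L \<iota>" "T \<in> fg_modules"
    and "\<And>i. i \<in> I \<Longrightarrow> \<tau> i \<in> module_homs (A i) T" "glue_compatible I A R \<tau>"
  shows "\<exists>!u. u \<in> module_homs L T \<and> (\<forall>i\<in>I. compose (carrier (A i)) u (\<iota> i) = \<tau> i)"
  using assms unfolding module_colimit_def by blast

lemma module_colimit_homs: "module_colimit I A R L \<iota> \<Longrightarrow> i \<in> I \<Longrightarrow> \<iota> i \<in> module_homs (A i) L"
  unfolding module_colimit_def by (elim conjE) (rule bspec)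

lemma module_colimit_compatible: "module_colimit I A R L \<iota> \<Longrightarrow> glue_compatible I A R \<iota>"
  unfolding module_colimit_def by (elim conjE)

lemma module_colimitI:
  fixes L :: "('m::{monoid_mult, mult_zero}, 's) pmod"
  assumes "\<And>i. i \<in> I \<Longrightarrow> \<iota> i \<in> module_homs (A i) L" and "glue_compatible I A R \<iota>"
    and "\<And>(T :: ('m, 's) pmod) \<tau>. T \<in> fg_modules \<Longrightarrow> \<forall>i\<in>I. \<tau> i \<in> module_homs (A i) T \<Longrightarrow> glue_compatible I A R \<tau> \<Longrightarrow>
        \<exists>!u. u \<in> module_homs L T \<and> (\<forall>i\<in>I. compose (carrier (A i)) u (\<iota> i) = \<tau> i)"
  shows "module_colimit I A R L \<iota>"
  unfolding module_colimit_def using assms by blast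

text \<open>Passes from predicates to maps with arbitrary values by testing with the predicate that
  holds where \<tau> takes the value \<open>\<tau> i x\<close>.\<close>

lemma glued_compatible:
  assumes "glued I A R i x j y" "glue_compatible I A R \<tau>"
  shows "\<tau> i x = \<tau> j y"
proof -
  have "glue_compatible I A R (\<lambda>k z. \<tau> k z = \<tau> i x)"
    using glue_compatible_rel[OF assms(2)] glue_compatible_pt[OF assms(2)]
    by (intro glue_compatibleI) metis+
  then show ?thesis
    using assms(1)[unfolded glued_def, rule_format, of "\<lambda>k z. \<tau> k z = \<tau> i x"] by simp
qed

lemma compose_eq_iff:
  assumes "\<tau> \<in> module_homs S T"
  shows "compose (carrier S) g f = \<tau> \<longleftrightarrow> (\<forall>x\<in>carrier S. g (f x) = \<tau> x)"
proof
  assume "\<forall>x\<in>carrier S. g (f x) = \<tau> x"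
  moreover have "\<tau> \<in> extensional (carrier S)"
    using assms by (auto simp: module_homs_def PiE_def)
  ultimately show "compose (carrier S) g f = \<tau>"
    by (auto simp: compose_def extensional_def fun_eq_iff)
qed (auto simp: compose_def)

text \<open>The factorisation is forced on the images of the \<open>\<iota> i\<close>, which with
  the base point exhaust \<open>L\<close>. It is well defined because elements with the same image
  are \<open>glued\<close>, and a compatible \<tau> cannot distinguish those.\<close>

lemma set_colimit_imp_module_colimit:
  fixes L :: "('m::{monoid_mult, mult_zero}, 's) pmod"
  assumes A: "\<And>i. i \<in> I \<Longrightarrow> pointed_module (A i)" and L: "pointed_module L"
    and \<iota>: "\<And>i. i \<in> I \<Longrightarrow> \<iota> i \<in> module_homs (A i) L"
    and sc: "set_colimit I A R L \<iota>"
  shows "module_colimit I A R L \<iota>"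
proof -
  interpret L: pointed_module L by (rule L)
  have comp: "glue_compatible I A R \<iota>"
    and carr: "carrier L = insert (pt L) (\<Union>i\<in>I. \<iota> i ` carrier (A i))"
    and ker: "\<And>i x j y. i \<in> I \<Longrightarrow> x \<in> carrier (A i) \<Longrightarrow> j \<in> I \<Longrightarrow> y \<in> carrier (A j) \<Longrightarrow>
      \<iota> i x = \<iota> j y \<Longrightarrow> glued I A R i x j y"
    using sc unfolding set_colimit_def by blast+
  have "\<exists>!u. u \<in> module_homs L T \<and> (\<forall>i\<in>I. compose (carrier (A i)) u (\<iota> i) = \<tau> i)"
    if T: "T \<in> fg_modules" and \<tau>: "\<forall>i\<in>I. \<tau> i \<in> module_homs (A i) T"
      and \<tau>c: "glue_compatible I A R \<tau>" for T :: "('m, 's) pmod" and \<tau>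
  proof -
    interpret T: pointed_module T using T by (rule fg_modules_pointed)
    \<comment> \<open>The value is read off from any preimage under the \<open>\<iota> i\<close>.
      The default \<open>pt T\<close> is the right value at the base point when \<open>I\<close> is
      empty and nothing has a preimage.\<close>
    define u where "u z = (if \<exists>i\<in>I. \<exists>x\<in>carrier (A i). z = \<iota> i x
        then SOME t. \<exists>i\<in>I. \<exists>x\<in>carrier (A i). z = \<iota> i x \<and> t = \<tau> i x else pt T)" for z
    have u_\<iota>: "u (\<iota> i x) = \<tau> i x" if "i \<in> I" "x \<in> carrier (A i)" for i x
    proof -
      have "\<exists>j\<in>I. \<exists>y\<in>carrier (A j). \<iota> i x = \<iota> j y \<and> u (\<iota> i x) = \<tau> j y"
        unfolding u_def using that
          someI_ex[of "\<lambda>t. \<exists>j\<in>I. \<exists>y\<in>carrier (A j). \<iota> i x = \<iota> j y \<and> t = \<tau> j y"] by auto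
      then show ?thesis
        using that ker glued_compatible[OF _ \<tau>c] by metis
    qed
    have u_pt: "u (pt L) = pt T"
    proof (cases "I = {}")
      case False
      then obtain i where i: "i \<in> I" by blast
      then have "pt (A i) \<in> carrier (A i)" "\<iota> i (pt (A i)) = pt L"
        using A \<iota> by (auto intro: pointed_module.pt_carrier simp: module_homs_pt)
      with i u_\<iota> \<tau> show ?thesis
        by (metis module_homs_pt)
    qed (simp add: u_def)
    have "restrict u (carrier L) \<in> module_homs L T"
    proof (rule restrict_module_homsI[OF L])
      fix s m assume s: "s \<in> carrier L"
      then consider "s = pt L" | i x where "i \<in> I" "x \<in> carrier (A i)" "s = \<iota> i x"
        unfolding carr by auto
      then have "u s \<in> carrier T \<and> u (act L s m) = act T (u s) m"
      proof cases
        case 1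
        then show ?thesis
          by (simp_all add: u_pt T.pt_carrier T.act_pt L.act_pt)
      next
        case 2
        then have "act L s m = \<iota> i (act (A i) x m)" "act (A i) x m \<in> carrier (A i)"
          using A pointed_module.act_carrier[of "A i"] by (simp_all add: module_homs_act[OF \<iota>])
        with 2 \<tau> show ?thesis
          by (auto simp: u_\<iota> module_homs_act intro: module_homs_carrier)
      qed
      then show "u s \<in> carrier T" "u (act L s m) = act T (u s) m" by blast+
    qed (rule u_pt)
    moreover have "compose (carrier (A i)) (restrict u (carrier L)) (\<iota> i) = \<tau> i" if "i \<in> I" for i
      using that \<tau> by (subst compose_eq_iff) (auto simp: u_\<iota> dest: \<iota> module_homs_carrier)
    moreover have "v = w" if "v \<in> module_homs L T" "w \<in> module_homs L T"
      and v: "\<forall>i\<in>I. compose (carrier (A i)) v (\<iota> i) = \<tau> i"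
      and w: "\<forall>i\<in>I. compose (carrier (A i)) w (\<iota> i) = \<tau> i" for v w
    proof (rule module_homs_eqI[OF that(1,2)])
      fix s assume "s \<in> carrier L"
      then consider "s = pt L" | i x where "i \<in> I" "x \<in> carrier (A i)" "s = \<iota> i x"
        unfolding carr by auto
      then show "v s = w s"
      proof cases
        case 2
        then show ?thesis using v w \<tau> compose_eq_iff by metis
      qed (use that in \<open>simp add: module_homs_pt\<close>)
    qed
    ultimately show ?thesis by blast
  qed
  then show ?thesis
    using module_colimitI[OF \<iota> comp] by simp
qed

text \<open>The disjoint union \<open>W\<close> modulo the generated equivalence \<open>E\<close>,
  transported into \<open>'u\<close>. Stability of \<open>R\<close> under the action makes
  \<open>E\<close> a congruence, so the quotient is a module; the images of generators of the
  \<open>A i\<close> generate it.\<close>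

lemma set_colimit_exists:
  includes cardinal_syntax
  fixes A :: "'i \<Rightarrow> ('m::{monoid_mult, mult_zero}, 'u) pmod"
  assumes fin: "finite I" and inf: "infinite (UNIV :: 'u set)"
    and A: "\<And>i. i \<in> I \<Longrightarrow> A i \<in> fg_modules"
    and stable: "\<And>i x j y m. ((i, x), (j, y)) \<in> R \<Longrightarrow> ((i, act (A i) x m), (j, act (A j) y m)) \<in> R"
    and R: "R \<subseteq> Sigma I (\<lambda>i. carrier (A i)) \<times> Sigma I (\<lambda>i. carrier (A i))"
  shows "\<exists>L\<in>fg_modules. \<exists>\<iota>. (\<forall>i\<in>I. \<iota> i \<in> module_homs (A i) L) \<and> set_colimit I A R L \<iota>"
proof (cases "I = {}")
  case True
  define L :: "('m, 'u) pmod" where "L = \<lparr>carrier = {undefined}, pt = undefined, act = (\<lambda>_ _. undefined)\<rparr>"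
  have "L \<in> fg_modules" unfolding L_def by (rule zero_module_fg)
  moreover have "set_colimit I A R L (\<lambda>i x. undefined)"
    using True by (simp add: set_colimit_def glue_compatibleI L_def)
  ultimately show ?thesis using True by blast
next
  case False
  then obtain i0 where i0: "i0 \<in> I" by blast
  have mod: "pointed_module (A i)" if "i \<in> I" for i
    using A that by (simp add: fg_modules_pointed)
  define W where "W = Sigma I (\<lambda>i. carrier (A i))"
  define E where "E a b \<longleftrightarrow> glued I A R (fst a) (snd a) (fst b) (snd b)" for a b
  have E_refl: "E a a" and E_sym: "E a b \<Longrightarrow> E b a" and E_trans: "E a b \<Longrightarrow> E b c \<Longrightarrow> E a c" for a b c
    unfolding E_def glued_def by auto
  \<comment> \<open>If \<open>P\<close> is compatible, then so is \<open>P\<close> precomposed with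
    the action of \<open>m\<close>, because \<open>R\<close> is stable and base points are fixed.
    Testing with this shifted predicate gives the claim.\<close>
  have E_act: "E (i, act (A i) x m) (j, act (A j) y m)"
    if "E (i, x) (j, y)" for i x j y m
    unfolding E_def glued_def fst_conv snd_conv
  proof (intro allI impI)
    fix P assume P: "glue_compatible I A R P"
    have "glue_compatible I A R (\<lambda>k z. P k (act (A k) z m))"
    proof (rule glue_compatibleI)
      fix k l assume kl: "k \<in> I" "l \<in> I"
      then have "act (A k) (pt (A k)) m = pt (A k)" "act (A l) (pt (A l)) m = pt (A l)"
        using mod pointed_module.act_pt by blast+
      then show "P k (act (A k) (pt (A k)) m) = P l (act (A l) (pt (A l)) m)"
        using glue_compatible_pt[OF P kl] by metis
    qed (rule glue_compatible_rel[OF P stable])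
    with that show "P i (act (A i) x m) = P j (act (A j) y m)"
      using glued_compatible[of I A R i x j y "\<lambda>k z. P k (act (A k) z m)"] by (simp add: E_def)
  qed
  \<comment> \<open>Cardinal arithmetic for the injection \<open>e\<close>: a finite nonempty set
    times an infinite set is no larger than the infinite set.\<close>
  have "|I| \<le>o |UNIV :: 'u set|"
    by (rule ordLess_imp_ordLeq[OF finite_ordLess_infinite[OF card_of_Well_order card_of_Well_order]])
      (simp_all add: fin inf Field_card_of)
  then have "|I \<times> (UNIV :: 'u set)| \<le>o |UNIV :: 'u set|"
    using card_of_Times_infinite_simps(3)[OF inf False] ordIso_imp_ordLeq by blast
  then obtain e :: "'i \<times> 'u \<Rightarrow> 'u" where e: "inj_on e (I \<times> UNIV)"
    unfolding card_of_ordLeq[symmetric] by blast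
  \<comment> \<open>The code of a class is the image under \<open>e\<close> of a chosen member in
    \<open>W\<close>. Equivalent elements define the same predicate \<open>E a\<close>, hence the
    same choice and the same code.\<close>
  define c where "c a = e (SOME b. b \<in> W \<and> E a b)" for a
  have some: "(SOME b. b \<in> W \<and> E a b) \<in> W" "E a (SOME b. b \<in> W \<and> E a b)" if "a \<in> W" for a
    using someI[of "\<lambda>b. b \<in> W \<and> E a b" a] that E_refl by auto
  have c_iff: "c a = c b \<longleftrightarrow> E a b" if "a \<in> W" "b \<in> W" for a b
  proof
    assume "c a = c b"
    then have "(SOME b. b \<in> W \<and> E a b) = (SOME d. d \<in> W \<and> E b d)"
      unfolding c_def using e some[OF that(1)] some[OF that(2)]
      by (auto simp: W_def dest!: inj_onD)
    then show "E a b"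
      using some(2)[OF that(1)] some(2)[OF that(2)] E_sym E_trans by metis
  next
    assume "E a b"
    then have "E a = E b" using E_sym E_trans by blast
    then show "c a = c b" unfolding c_def by simp
  qed
  define rep where "rep s = (SOME a. a \<in> W \<and> c a = s)" for s
  \<comment> \<open>The action goes through a chosen representative; \<open>act_c\<close> below
    shows independence of the choice. Off the carrier the value must be the base point, as
    \<open>act_outside\<close> prescribes.\<close>
  define L where "L = \<lparr>carrier = c ` W, pt = c (i0, pt (A i0)),
    act = (\<lambda>s m. if s \<in> c ` W then c (fst (rep s), act (A (fst (rep s))) (snd (rep s)) m)
                 else c (i0, pt (A i0)))\<rparr>"
  have W_iff: "(i, x) \<in> W \<longleftrightarrow> i \<in> I \<and> x \<in> carrier (A i)" for i x
    by (auto simp: W_def)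
  have act_W: "(i, act (A i) x m) \<in> W" if "(i, x) \<in> W" for i x m
    using that mod pointed_module.act_carrier[of "A i"] by (auto simp: W_iff)
  have pt_W: "(i, pt (A i)) \<in> W" if "i \<in> I" for i
    using that mod by (simp add: W_iff pointed_module.pt_carrier)
  have act_c: "act L (c (i, x)) m = c (i, act (A i) x m)" if w: "(i, x) \<in> W" for i x m
  proof -
    obtain j y where jy: "rep (c (i, x)) = (j, y)" by (metis surj_pair)
    have "rep (c (i, x)) \<in> W \<and> c (rep (c (i, x))) = c (i, x)"
      unfolding rep_def using w by (rule_tac someI_ex) blast
    then have jyW: "(j, y) \<in> W" "c (j, y) = c (i, x)" by (simp_all add: jy)
    then have "E (j, y) (i, x)" using c_iff w by blast
    then have "c (j, act (A j) y m) = c (i, act (A i) x m)"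
      using c_iff act_W E_act w jyW by blast
    then show ?thesis using w by (auto simp: L_def jy)
  qed
  have c_pt: "c (i, pt (A i)) = pt L" if "i \<in> I" for i
  proof -
    have "E (i, pt (A i)) (i0, pt (A i0))"
      unfolding E_def glued_def fst_conv snd_conv
      using glue_compatible_pt[OF _ that i0] by blast
    then show ?thesis using c_iff pt_W that i0 by (simp add: L_def)
  qed
  have Lmod: "pointed_module L"
  proof
    show "pt L \<in> carrier L" using pt_W i0 by (simp add: L_def)
    show "act L (pt L) m = pt L" for m
      using act_c[OF pt_W[OF i0]] c_pt[OF i0] pointed_module.act_pt[OF mod[OF i0]] by simp
    show "act L s m = pt L" if "s \<notin> carrier L" for s m
      using that by (simp add: L_def)
    fix s m m' assume "s \<in> carrier L"
    then obtain i x where s: "s = c (i, x)" "(i, x) \<in> W" by (auto simp: L_def)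
    then interpret Ai: pointed_module "A i" using mod by (simp add: W_iff)
    have x: "x \<in> carrier (A i)" "i \<in> I" using s by (auto simp: W_iff)
    show "act L s m \<in> carrier L" using s act_W by (auto simp: act_c) (simp add: L_def)
    show "act L s 1 = s" using s x by (simp add: act_c Ai.act_one)
    show "act L s 0 = pt L" using s x by (simp add: act_c Ai.act_zero c_pt)
    show "act L s (m * m') = act L (act L s m) m'"
      using s x act_W by (simp add: act_c Ai.act_mult)
  qed
  define \<iota> where "\<iota> i = restrict (\<lambda>x. c (i, x)) (carrier (A i))" for i
  have \<iota>: "\<iota> i \<in> module_homs (A i) L" if "i \<in> I" for i
    unfolding \<iota>_def using that c_pt act_c
    by (intro restrict_module_homsI mod) (auto simp: W_iff, auto simp: L_def W_iff)
  have "\<exists>G. finite G \<and> G \<subseteq> carrier (A i) \<and> (\<forall>s\<in>carrier (A i). \<exists>g\<in>G. \<exists>m. s = act (A i) g m)"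
    if "i \<in> I" for i
    using fg_modules_generators[OF A[OF that]] by metis
  then obtain G where G: "\<And>i. i \<in> I \<Longrightarrow> finite (G i)" "\<And>i. i \<in> I \<Longrightarrow> G i \<subseteq> carrier (A i)"
    "\<And>i s. i \<in> I \<Longrightarrow> s \<in> carrier (A i) \<Longrightarrow> \<exists>g\<in>G i. \<exists>m. s = act (A i) g m"
    by metis
  have "L \<in> fg_modules"
  proof (rule fg_modulesI[where G = "c ` Sigma I G", OF Lmod])
    show "finite (c ` Sigma I G)" using fin G(1) by auto
    show "c ` Sigma I G \<subseteq> carrier L" using G(2) by (fastforce simp: L_def W_def)
  next
    fix s assume "s \<in> carrier L"
    then obtain i x where s: "s = c (i, x)" "i \<in> I" "x \<in> carrier (A i)" by (auto simp: L_def W_def)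
    then obtain g m where "g \<in> G i" "x = act (A i) g m" using G(3) by blast
    then show "\<exists>g\<in>c ` Sigma I G. \<exists>m. s = act L g m"
      using s G(2) by (intro bexI[of _ "c (i, g)"] exI[of _ m]) (auto simp: act_c W_iff subset_iff)
  qed
  moreover have "set_colimit I A R L \<iota>"
    unfolding set_colimit_def
  proof (intro conjI ballI impI)
    show "glue_compatible I A R \<iota>"
    proof (rule glue_compatibleI)
      fix i x j y assume r: "((i, x), (j, y)) \<in> R"
      then have "(i, x) \<in> W" "(j, y) \<in> W" using R by (auto simp: W_def)
      moreover have "E (i, x) (j, y)"
        using glue_compatible_rel[OF _ r] unfolding E_def glued_def by auto
      ultimately show "\<iota> i x = \<iota> j y" using c_iff by (simp add: \<iota>_def W_iff)
    next
      fix i j assume "i \<in> I" "j \<in> I"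
      then show "\<iota> i (pt (A i)) = \<iota> j (pt (A j))"
        using module_homs_pt[OF \<iota>] by metis
    qed
    show "carrier L = insert (pt L) (\<Union>i\<in>I. \<iota> i ` carrier (A i))"
      using pt_W i0 by (force simp: L_def \<iota>_def W_def image_iff)
  next
    fix i x j y
    assume "i \<in> I" "x \<in> carrier (A i)" "j \<in> I" "y \<in> carrier (A j)" "\<iota> i x = \<iota> j y"
    then have "E (i, x) (j, y)" using c_iff by (simp add: \<iota>_def W_iff)
    then show "glued I A R i x j y" by (simp add: E_def)
  qed
  ultimately show ?thesis using \<iota> by blast
qed

text \<open>Compare \<open>L\<close> with the constructed colimit \<open>K\<close>, which has the
  universal property as well. The induced maps \<open>u\<close> and \<open>v\<close> respect the
  structure maps, so surjectivity is pulled back along \<open>v \<circ> u = id\<close> and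
  identifications in \<open>L\<close> are pushed to \<open>K\<close> by \<open>u\<close>.\<close>

lemma module_colimit_imp_set_colimit:
  fixes A :: "'i \<Rightarrow> ('m::{monoid_mult, mult_zero}, 'u) pmod"
  assumes fin: "finite I" and inf: "infinite (UNIV :: 'u set)"
    and A: "\<And>i. i \<in> I \<Longrightarrow> A i \<in> fg_modules"
    and stable: "\<And>i x j y m. ((i, x), (j, y)) \<in> R \<Longrightarrow> ((i, act (A i) x m), (j, act (A j) y m)) \<in> R"
    and R: "R \<subseteq> Sigma I (\<lambda>i. carrier (A i)) \<times> Sigma I (\<lambda>i. carrier (A i))"
    and L: "L \<in> fg_modules" and mc: "module_colimit I A R L \<iota>"
  shows "set_colimit I A R L \<iota>"
proof -
  have mod: "pointed_module (A i)" if "i \<in> I" for i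
    using A that by (simp add: fg_modules_pointed)
  obtain K \<kappa> where K: "K \<in> fg_modules" and \<kappa>: "\<And>i. i \<in> I \<Longrightarrow> \<kappa> i \<in> module_homs (A i) K"
    and sc: "set_colimit I A R K \<kappa>"
    using set_colimit_exists[OF fin inf A stable R] by metis
  have mcK: "module_colimit I A R K \<kappa>"
    using set_colimit_imp_module_colimit[OF mod fg_modules_pointed[OF K] \<kappa> sc] by blast
  have \<iota>: "\<And>i. i \<in> I \<Longrightarrow> \<iota> i \<in> module_homs (A i) L"
    and comp: "glue_compatible I A R \<iota>"
    using module_colimit_homs[OF mc] module_colimit_compatible[OF mc] by simp_all
  obtain u where u: "u \<in> module_homs L K" "\<And>i. i \<in> I \<Longrightarrow> compose (carrier (A i)) u (\<iota> i) = \<kappa> i"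
    using module_colimit_factor[OF mc K \<kappa> module_colimit_compatible[OF mcK]] by blast
  obtain v where v: "v \<in> module_homs K L" "\<And>i. i \<in> I \<Longrightarrow> compose (carrier (A i)) v (\<kappa> i) = \<iota> i"
    using module_colimit_factor[OF mcK L \<iota> comp] by blast
  have u_\<iota>: "u (\<iota> i x) = \<kappa> i x" and v_\<kappa>: "v (\<kappa> i x) = \<iota> i x" if "i \<in> I" "x \<in> carrier (A i)" for i x
    using that u(2) v(2) \<iota> \<kappa> compose_eq_iff by metis+
  \<comment> \<open>Both this composite and the identity factor \<iota> through itself, so
    uniqueness for \<open>L\<close> applies.\<close>
  have "compose (carrier L) v u = restrict id (carrier L)"
  proof -
    have "\<exists>!w. w \<in> module_homs L L \<and> (\<forall>i\<in>I. compose (carrier (A i)) w (\<iota> i) = \<iota> i)"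
      by (rule module_colimit_factor[OF mc L \<iota> comp])
    moreover have "compose (carrier L) v u \<in> module_homs L L"
      using u v fg_modules_pointed[OF L] by (blast intro: module_homs_compose)
    moreover have "restrict id (carrier L) \<in> module_homs L L"
      using fg_modules_pointed[OF L] by (rule module_homs_id)
    moreover have "\<forall>i\<in>I. compose (carrier (A i)) (compose (carrier L) v u) (\<iota> i) = \<iota> i"
      "\<forall>i\<in>I. compose (carrier (A i)) (restrict id (carrier L)) (\<iota> i) = \<iota> i"
      using module_homs_carrier[OF \<iota>] by (simp_all add: compose_eq_iff[OF \<iota>] compose_eq u_\<iota> v_\<kappa>)
    ultimately show ?thesis by blast
  qed
  then have vu: "v (u s) = s" if "s \<in> carrier L" for s
    using that unfolding compose_def by (metis restrict_apply' id_apply)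
  show ?thesis
    unfolding set_colimit_def
  proof (intro conjI ballI impI comp)
    \<comment> \<open>An element \<open>s\<close> equals \<open>v (u s)\<close>, and
      \<open>u s\<close> is the base point of \<open>K\<close> or some \<open>\<kappa> i x\<close>,
      which \<open>v\<close> sends to \<open>\<iota> i x\<close>.\<close>
    have "carrier L \<subseteq> insert (pt L) (\<Union>i\<in>I. \<iota> i ` carrier (A i))"
    proof
      fix s assume s: "s \<in> carrier L"
      then have "u s \<in> carrier K" using u by (blast intro: module_homs_carrier)
      then consider "u s = pt K" | i x where "i \<in> I" "x \<in> carrier (A i)" "u s = \<kappa> i x"
        using sc unfolding set_colimit_def by auto
      then show "s \<in> insert (pt L) (\<Union>i\<in>I. \<iota> i ` carrier (A i))"
        using vu[OF s] v_\<kappa> module_homs_pt[OF v(1)] by cases auto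
    qed
    then show "carrier L = insert (pt L) (\<Union>i\<in>I. \<iota> i ` carrier (A i))"
      using \<iota> pointed_module.pt_carrier[OF fg_modules_pointed[OF L]]
      by (auto dest: module_homs_carrier)
  next
    fix i x j y
    assume *: "i \<in> I" "x \<in> carrier (A i)" "j \<in> I" "y \<in> carrier (A j)" "\<iota> i x = \<iota> j y"
    then have "\<kappa> i x = \<kappa> j y" using u_\<iota> by metis
    then show "glued I A R i x j y" using * sc unfolding set_colimit_def by blast
  qed
qed

section \<open>The Waldhausen category of finitely generated modules\<close>

lemma FG_simps [simp]:
  "Obj (FG m u) = fg_modules" "Dom (FG m u) = src" "Cod (FG m u) = tgt"
  "Zero (FG m u) = \<lparr>carrier = {undefined}, pt = undefined, act = (\<lambda>_ _. undefined)\<rparr>"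
  "Id (FG m u) S = \<lparr>src = S, fn = restrict id (carrier S), tgt = S\<rparr>"
  "Comp (FG m u) g f = \<lparr>src = src f, fn = compose (carrier (src f)) (fn g) (fn f), tgt = tgt g\<rparr>"
  by (simp_all add: FG_def Let_def)

lemma FG_Arr_iff: "f \<in> Arr (FG m u) \<longleftrightarrow>
    src f \<in> fg_modules \<and> tgt f \<in> fg_modules \<and> fn f \<in> module_homs (src f) (tgt f)"
  by (simp add: FG_def Let_def)

lemma FG_hom_iff: "f \<in> hom (FG m u) S T \<longleftrightarrow>
    src f = S \<and> tgt f = T \<and> S \<in> fg_modules \<and> T \<in> fg_modules \<and> fn f \<in> module_homs S T"
  by (auto simp: hom_def FG_Arr_iff)

text \<open>The image of a homomorphism contains the base point and is stable under the action, so
  \<open>quotient_module_fg\<close> provides finite generation of the quotient.\<close>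

lemma FG_Cof_iff: "f \<in> Cof (FG m u) \<longleftrightarrow> f \<in> Arr (FG m u) \<and>
    (\<exists>r \<in> module_homs (tgt f) (src f). \<forall>s \<in> carrier (src f). r (fn f s) = s)"
proof
  assume f: "f \<in> Arr (FG m u) \<and> (\<exists>r \<in> module_homs (tgt f) (src f). \<forall>s \<in> carrier (src f). r (fn f s) = s)"
  then have "src f \<in> fg_modules" "tgt f \<in> fg_modules" and h: "fn f \<in> module_homs (src f) (tgt f)"
    by (simp_all add: FG_Arr_iff)
  then interpret S: pointed_module "src f" by (simp add: fg_modules_pointed)
  have "quotient_module (tgt f) (fn f ` carrier (src f)) \<in> fg_modules"
  proof (rule quotient_module_fg[OF \<open>tgt f \<in> fg_modules\<close>])
    show "pt (tgt f) \<in> fn f ` carrier (src f)"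
      using module_homs_pt[OF h] S.pt_carrier by force
    show "act (tgt f) s a \<in> fn f ` carrier (src f)" if "s \<in> fn f ` carrier (src f)" for s a
      using that S.act_carrier by (auto simp flip: module_homs_act[OF h])
  qed
  with f show "f \<in> Cof (FG m u)" by (simp add: FG_def Let_def)
qed (simp add: FG_def Let_def)

text \<open>Brings the definition into the language of \<open>is_iso\<close>, where the axioms on
  weak equivalences hold in any category.\<close>

lemma FG_Weq_eq: "Weq (FG m u) = {f. is_iso (FG m u) f}"
  unfolding is_iso_def hom_def by (auto simp: FG_def Let_def)

lemma marrow_eq_iff: "f = g \<longleftrightarrow> src f = src g \<and> fn f = fn g \<and> tgt f = tgt (g :: ('m, 's) marrow)"
  by (cases f; cases g) simp

lemma FG_category: "category (FG m u)"
proof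
  fix f x y assume f: "f \<in> hom (FG m u) x y"
  then have "fn f \<in> carrier x \<rightarrow>\<^sub>E carrier y" by (simp add: FG_hom_iff module_homs_def)
  then have "compose (carrier x) (fn f) (restrict id (carrier x)) = fn f"
    "compose (carrier x) (restrict id (carrier y)) (fn f) = fn f"
    by (auto simp: compose_def fun_eq_iff)
  with f show "Comp (FG m u) f (Id (FG m u) x) = f" "Comp (FG m u) (Id (FG m u) y) f = f"
    by (auto simp: FG_hom_iff marrow_eq_iff)
next
  fix f g h w x y z
  assume "f \<in> hom (FG m u) w x" "g \<in> hom (FG m u) x y" "h \<in> hom (FG m u) y z"
  then show "Comp (FG m u) h (Comp (FG m u) g f) = Comp (FG m u) (Comp (FG m u) h g) f"
    by (auto simp: FG_hom_iff compose_def fun_eq_iff intro: module_homs_carrier)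
qed (auto simp: FG_Arr_iff FG_hom_iff intro: fg_modules_pointed module_homs_id module_homs_compose)

lemma FG_Comp_eq_iff:
  assumes "f \<in> hom (FG m u) S T" "g \<in> hom (FG m u) T V" "h \<in> hom (FG m u) S V"
  shows "Comp (FG m u) g f = h \<longleftrightarrow> compose (carrier S) (fn g) (fn f) = fn h"
  using assms by (auto simp: FG_hom_iff marrow_eq_iff)

lemma FG_Comp_eq_Comp_iff:
  assumes "f \<in> hom (FG m u) S T" "g \<in> hom (FG m u) T V"
    and "h \<in> hom (FG m u) S T'" "k \<in> hom (FG m u) T' V"
  shows "Comp (FG m u) g f = Comp (FG m u) k h \<longleftrightarrow> (\<forall>s\<in>carrier S. fn g (fn f s) = fn k (fn h s))"
  using assms by (auto simp: FG_hom_iff marrow_eq_iff compose_def fun_eq_iff restrict_def)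

text \<open>Between fixed objects, an arrow is determined by its \<open>fn\<close>, and every
  homomorphism occurs as one. This moves unique factorisations between arrows and functions.\<close>

lemma FG_ex1_hom:
  assumes "L \<in> fg_modules" "T \<in> fg_modules"
  shows "(\<exists>!v. v \<in> hom (FG m u) L T \<and> Q (fn v)) \<longleftrightarrow> (\<exists>!v. v \<in> module_homs L T \<and> Q v)"
proof -
  have "v \<in> hom (FG m u) L T \<and> Q (fn v) \<longleftrightarrow> (\<exists>w. v = \<lparr>src = L, fn = w, tgt = T\<rparr> \<and> w \<in> module_homs L T \<and> Q w)" for v
    using assms by (auto simp: FG_hom_iff marrow_eq_iff)
  then show ?thesis by auto
qed

section \<open>Pushouts and finite colimits in the category of modules\<close>

text \<open>\<open>False\<close> stands for the target of \<open>f\<close> and \<open>True\<close>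
  for that of \<open>g\<close>. The common source is not a member of the family; it enters only
  through \<open>span_rel\<close>.\<close>

definition span_family :: "('m, 's) marrow \<Rightarrow> ('m, 's) marrow \<Rightarrow> bool \<Rightarrow> ('m, 's) pmod" where
  "span_family f g b = (if b then tgt g else tgt f)"

definition span_rel :: "('m, 's) marrow \<Rightarrow> ('m, 's) marrow \<Rightarrow> ((bool \<times> 's) \<times> (bool \<times> 's)) set" where
  "span_rel f g = {((False, fn f a), (True, fn g a)) | a. a \<in> carrier (src f)}"

lemma span_compatible_iff:
  assumes "\<tau> False \<in> module_homs (tgt f) T" "\<tau> True \<in> module_homs (tgt g) T"
  shows "glue_compatible UNIV (span_family f g) (span_rel f g) \<tau> \<longleftrightarrow>
    (\<forall>a\<in>carrier (src f). \<tau> False (fn f a) = \<tau> True (fn g a))"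
proof
  assume *: "glue_compatible UNIV (span_family f g) (span_rel f g) \<tau>"
  have "((False, fn f a), (True, fn g a)) \<in> span_rel f g" if "a \<in> carrier (src f)" for a
    using that by (auto simp: span_rel_def)
  then show "\<forall>a\<in>carrier (src f). \<tau> False (fn f a) = \<tau> True (fn g a)"
    using glue_compatible_rel[OF *] by blast
next
  assume *: "\<forall>a\<in>carrier (src f). \<tau> False (fn f a) = \<tau> True (fn g a)"
  show "glue_compatible UNIV (span_family f g) (span_rel f g) \<tau>"
  proof (rule glue_compatibleI)
    have "\<tau> b (pt (span_family f g b)) = pt T" for b
      using module_homs_pt[OF assms(1)] module_homs_pt[OF assms(2)]
      by (cases b) (simp_all add: span_family_def)
    then show "\<tau> i (pt (span_family f g i)) = \<tau> j (pt (span_family f g j))" for i j by simp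
  qed (use * in \<open>auto simp: span_rel_def\<close>)
qed

text \<open>Equivariance of \<open>f\<close> and \<open>g\<close>, in the shape in which the
  quotient construction needs it to inherit an action.\<close>

lemma span_rel_stable:
  assumes "f \<in> Arr (FG m u)" "g \<in> Arr (FG m u)" "src f = src g"
    and "((i, x), (j, y)) \<in> span_rel f g"
  shows "((i, act (span_family f g i) x a), (j, act (span_family f g j) y a)) \<in> span_rel f g"
proof -
  obtain s where s: "s \<in> carrier (src f)" "i = False" "x = fn f s" "j = True" "y = fn g s"
    using assms(4) unfolding span_rel_def by auto
  have "act (src f) s a \<in> carrier (src f)"
    using s(1) assms(1) by (simp add: FG_Arr_iff fg_modules_pointed pointed_module.act_carrier)
  moreover have "act (tgt f) (fn f s) a = fn f (act (src f) s a)"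
    "act (tgt g) (fn g s) a = fn g (act (src f) s a)"
    using s assms(1-3) module_homs_act[of "fn f" "src f" "tgt f" s a]
      module_homs_act[of "fn g" "src g" "tgt g" s a] by (simp_all add: FG_Arr_iff)
  ultimately show ?thesis
    using s unfolding span_rel_def by (auto simp: span_family_def)
qed

lemma span_rel_subset:
  assumes "f \<in> Arr (FG m u)" "g \<in> Arr (FG m u)" "src f = src g"
  shows "span_rel f g \<subseteq> Sigma UNIV (\<lambda>b. carrier (span_family f g b)) \<times> Sigma UNIV (\<lambda>b. carrier (span_family f g b))"
  using assms module_homs_carrier[of "fn f" "src f" "tgt f"] module_homs_carrier[of "fn g" "src g" "tgt g"]
  by (auto simp: span_rel_def span_family_def FG_Arr_iff)

lemma span_family_fg:
  "f \<in> Arr (FG m u) \<Longrightarrow> g \<in> Arr (FG m u) \<Longrightarrow> span_family f g b \<in> fg_modules"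
  by (simp add: span_family_def FG_Arr_iff)

text \<open>Commutativity of a square says that its two legs are compatible with
  \<open>span_rel\<close>, and \<open>FG_ex1_hom\<close> matches the factorisations. The criterion
  on pointed sets thereby becomes available for pushouts.\<close>

lemma FG_is_pushout_iff:
  fixes f g h k :: "('m::{monoid_mult, mult_zero}, 'u) marrow"
  shows "is_pushout (FG m u) f g h k \<longleftrightarrow>
    f \<in> Arr (FG m u) \<and> g \<in> Arr (FG m u) \<and> src f = src g \<and>
    h \<in> hom (FG m u) (tgt f) (tgt h) \<and> k \<in> hom (FG m u) (tgt g) (tgt h) \<and>
    module_colimit UNIV (span_family f g) (span_rel f g) (tgt h) (\<lambda>b. if b then fn k else fn h)"
    (is "?P \<longleftrightarrow> ?Q")
proof (cases "f \<in> Arr (FG m u) \<and> g \<in> Arr (FG m u) \<and> src f = src g \<and>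
    h \<in> hom (FG m u) (tgt f) (tgt h) \<and> k \<in> hom (FG m u) (tgt g) (tgt h)")
  case False
  moreover have False if ?P
  proof -
    obtain P where "h \<in> hom (FG m u) (tgt f) P" "k \<in> hom (FG m u) (tgt g) P"
      "f \<in> Arr (FG m u)" "g \<in> Arr (FG m u)" "src f = src g"
      using \<open>?P\<close> unfolding is_pushout_def by auto
    then show False using False by (auto simp: FG_hom_iff)
  qed
  ultimately show ?thesis by blast
next
  case True
  let ?C = "FG m u" and ?\<iota> = "\<lambda>b. if b then fn k else fn h" and ?V = "tgt h"
  have f: "f \<in> hom ?C (src f) (tgt f)" and g: "g \<in> hom ?C (src f) (tgt g)"
    and h: "h \<in> hom ?C (tgt f) ?V" and k: "k \<in> hom ?C (tgt g) ?V" and P: "?V \<in> fg_modules"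
    using True by (auto simp: hom_def FG_Arr_iff)
  have sq: "Comp ?C h' f = Comp ?C k' g \<longleftrightarrow>
      glue_compatible UNIV (span_family f g) (span_rel f g) (\<lambda>b. if b then fn k' else fn h')"
    if h': "h' \<in> hom ?C (tgt f) T" and k': "k' \<in> hom ?C (tgt g) T" for h' k' T
    using h' k' unfolding FG_Comp_eq_Comp_iff[OF f h' g k']
    by (subst span_compatible_iff[of _ f T g]) (auto simp: FG_hom_iff)
  have factor: "(\<exists>!v. v \<in> hom ?C ?V T \<and> Comp ?C v h = h' \<and> Comp ?C v k = k') \<longleftrightarrow>
      (\<exists>!v. v \<in> module_homs ?V T \<and> (\<forall>b\<in>UNIV.
         compose (carrier (span_family f g b)) v (?\<iota> b) = (if b then fn k' else fn h')))"
    if h': "h' \<in> hom ?C (tgt f) T" and k': "k' \<in> hom ?C (tgt g) T" for h' k' T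
  proof -
    have T: "T \<in> fg_modules" using h' by (simp add: FG_hom_iff)
    have "v \<in> hom ?C ?V T \<and> Comp ?C v h = h' \<and> Comp ?C v k = k' \<longleftrightarrow> v \<in> hom ?C ?V T \<and>
      (\<forall>b\<in>UNIV. compose (carrier (span_family f g b)) (fn v) (?\<iota> b) = (if b then fn k' else fn h'))" for v
      using FG_Comp_eq_iff[OF h _ h', of v] FG_Comp_eq_iff[OF k _ k', of v]
      by (auto simp: UNIV_bool span_family_def simp del: FG_simps)
    then show ?thesis
      using FG_ex1_hom[OF P T, of m u "\<lambda>w. \<forall>b\<in>UNIV.
        compose (carrier (span_family f g b)) w (?\<iota> b) = (if b then fn k' else fn h')"]
      by (simp del: FG_simps)
  qed
  show ?thesis
  proof
    assume ?P
    then obtain P' where "h \<in> hom ?C (tgt f) P'" and com: "Comp ?C h f = Comp ?C k g"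
      and univ: "\<And>T h' k'. h' \<in> hom ?C (tgt f) T \<Longrightarrow> k' \<in> hom ?C (tgt g) T \<Longrightarrow>
        Comp ?C h' f = Comp ?C k' g \<Longrightarrow> \<exists>!v. v \<in> hom ?C P' T \<and> Comp ?C v h = h' \<and> Comp ?C v k = k'"
      unfolding is_pushout_def by (auto simp del: FG_simps(6))
    then have P': "P' = ?V" by (simp add: FG_hom_iff)
    have "module_colimit UNIV (span_family f g) (span_rel f g) ?V ?\<iota>"
    proof (rule module_colimitI)
      show "?\<iota> b \<in> module_homs (span_family f g b) ?V" for b
        using h k by (auto simp: FG_hom_iff span_family_def)
      show "glue_compatible UNIV (span_family f g) (span_rel f g) ?\<iota>"
        using sq[OF h k] com by blast
      fix T :: "('m, 'u) pmod" and \<tau>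
      assume T: "T \<in> fg_modules" and \<tau>: "\<forall>b\<in>UNIV. \<tau> b \<in> module_homs (span_family f g b) T"
        and c: "glue_compatible UNIV (span_family f g) (span_rel f g) \<tau>"
      define h' k' where h'_def: "h' = \<lparr>src = tgt f, fn = \<tau> False, tgt = T\<rparr>"
        and k'_def: "k' = \<lparr>src = tgt g, fn = \<tau> True, tgt = T\<rparr>"
      have h': "h' \<in> hom ?C (tgt f) T" and k': "k' \<in> hom ?C (tgt g) T"
        using T \<tau> True by (auto simp: FG_hom_iff h'_def k'_def span_family_def UNIV_bool FG_Arr_iff)
      have \<tau>_eq: "\<tau> = (\<lambda>b. if b then fn k' else fn h')"
        by (auto simp: h'_def k'_def fun_eq_iff)
      have "\<exists>!v. v \<in> hom ?C ?V T \<and> Comp ?C v h = h' \<and> Comp ?C v k = k'"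
        using univ[OF h' k'] sq[OF h' k'] c unfolding P' \<tau>_eq by blast
      then show "\<exists>!v. v \<in> module_homs ?V T \<and>
          (\<forall>b\<in>UNIV. compose (carrier (span_family f g b)) v (?\<iota> b) = \<tau> b)"
        unfolding factor[OF h' k'] \<tau>_eq .
    qed
    with True show ?Q by blast
  next
    assume ?Q
    then have mc: "module_colimit UNIV (span_family f g) (span_rel f g) ?V ?\<iota>" by blast
    have "\<exists>!v. v \<in> hom ?C ?V T \<and> Comp ?C v h = h' \<and> Comp ?C v k = k'"
      if h': "h' \<in> hom ?C (tgt f) T" and k': "k' \<in> hom ?C (tgt g) T"
        and eq: "Comp ?C h' f = Comp ?C k' g" for T h' k'
      unfolding factor[OF h' k']
    proof (rule module_colimit_factor[OF mc])
      show "T \<in> fg_modules" using h' by (simp add: FG_hom_iff)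
      show "(if b then fn k' else fn h') \<in> module_homs (span_family f g b) T" for b
        using h' k' by (auto simp: FG_hom_iff span_family_def)
    qed (use sq[OF h' k'] eq in blast)
    moreover have "Comp ?C h f = Comp ?C k g"
      using sq[OF h k] module_colimit_compatible[OF mc] by blast
    ultimately show ?P
      using True h k unfolding is_pushout_def FG_simps(2,3)
      by (intro conjI exI[of _ ?V] ballI allI impI) (simp_all del: FG_simps)
  qed
qed

text \<open>Meant for the family \<open>src (X p p)\<close> of vertices. The relation is only a
  generating set; \<open>glued\<close> forms the equivalence it generates.\<close>

definition diagram_rel :: "'j set \<Rightarrow> ('j \<Rightarrow> 'j \<Rightarrow> bool) \<Rightarrow> ('j \<Rightarrow> 'j \<Rightarrow> ('m, 's) marrow)
    \<Rightarrow> (('j \<times> 's) \<times> ('j \<times> 's)) set" where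
  "diagram_rel J le X = {((p, x), (q, fn (X p q) x)) | p q x.
     p \<in> J \<and> q \<in> J \<and> le p q \<and> x \<in> carrier (src (X p p))}"

lemma FG_is_cocone_iff:
  assumes X: "diagram (FG m u) J le X" and T: "T \<in> fg_modules"
    and \<tau>: "\<And>p. p \<in> J \<Longrightarrow> \<tau> p \<in> hom (FG m u) (src (X p p)) T"
  shows "is_cocone (FG m u) J le X T \<tau> \<longleftrightarrow>
    glue_compatible J (\<lambda>p. src (X p p)) (diagram_rel J le X) (\<lambda>p. fn (\<tau> p))"
proof -
  have homs: "fn (\<tau> p) \<in> module_homs (src (X p p)) T" if "p \<in> J" for p
    using \<tau>[OF that] by (simp add: FG_hom_iff)
  have "Comp (FG m u) (\<tau> q) (X p q) = \<tau> p \<longleftrightarrow>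
      (\<forall>x\<in>carrier (src (X p p)). fn (\<tau> q) (fn (X p q) x) = fn (\<tau> p) x)"
    if "p \<in> J" "q \<in> J" "le p q" for p q
  proof -
    have "X p q \<in> hom (FG m u) (src (X p p)) (src (X q q))"
      using X that by (simp add: diagram_def vertex_def)
    then show ?thesis
      using FG_Comp_eq_iff[OF _ \<tau>[OF \<open>q \<in> J\<close>] \<tau>[OF \<open>p \<in> J\<close>]] compose_eq_iff[OF homs[OF \<open>p \<in> J\<close>]] by blast
  qed
  then have "is_cocone (FG m u) J le X T \<tau> \<longleftrightarrow> (\<forall>p\<in>J. \<forall>q\<in>J. le p q \<longrightarrow>
      (\<forall>x\<in>carrier (src (X p p)). fn (\<tau> q) (fn (X p q) x) = fn (\<tau> p) x))"
    using T \<tau> by (simp add: is_cocone_def vertex_def del: FG_simps(6))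
  also have "\<dots> \<longleftrightarrow> glue_compatible J (\<lambda>p. src (X p p)) (diagram_rel J le X) (\<lambda>p. fn (\<tau> p))"
    (is "?P \<longleftrightarrow> ?Q")
  proof
    assume ?P
    then show ?Q
      using module_homs_pt[OF homs] by (intro glue_compatibleI) (auto simp: diagram_rel_def)
  next
    assume ?Q
    have "fn (\<tau> p) x = fn (\<tau> q) (fn (X p q) x)"
      if "p \<in> J" "q \<in> J" "le p q" "x \<in> carrier (src (X p p))" for p q x
      using that by (intro glue_compatible_rel[OF \<open>?Q\<close>]) (auto simp: diagram_rel_def)
    then show ?P by simp
  qed
  finally show ?thesis .
qed

text \<open>The same dictionary as for pushouts, now with all vertices of the diagram as indices and
  cocones in place of commuting squares.\<close>

lemma FG_is_colimit_iff:
  fixes X :: "'j \<Rightarrow> 'j \<Rightarrow> ('m::{monoid_mult, mult_zero}, 'u) marrow"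
  assumes X: "diagram (FG m u) J le X"
  shows "is_colimit (FG m u) J le X L \<iota> \<longleftrightarrow>
    L \<in> fg_modules \<and> (\<forall>p\<in>J. \<iota> p \<in> hom (FG m u) (src (X p p)) L) \<and>
    module_colimit J (\<lambda>p. src (X p p)) (diagram_rel J le X) L (\<lambda>p. fn (\<iota> p))"
    (is "?P \<longleftrightarrow> ?Q")
proof (cases "L \<in> fg_modules \<and> (\<forall>p\<in>J. \<iota> p \<in> hom (FG m u) (src (X p p)) L)")
  case False
  then show ?thesis by (auto simp: is_colimit_def is_cocone_def vertex_def simp del: FG_simps(6))
next
  case True
  let ?C = "FG m u" and ?A = "\<lambda>p. src (X p p)" and ?R = "diagram_rel J le X"
  have L: "L \<in> fg_modules" and \<iota>: "\<And>p. p \<in> J \<Longrightarrow> \<iota> p \<in> hom ?C (?A p) L" using True by auto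
  have vertex_fg: "?A p \<in> fg_modules" if "p \<in> J" for p
    using X that by (simp add: diagram_def vertex_def)
  have factor: "(\<exists>!v. v \<in> hom ?C L T \<and> (\<forall>p\<in>J. Comp ?C v (\<iota> p) = \<tau> p)) \<longleftrightarrow>
      (\<exists>!v. v \<in> module_homs L T \<and> (\<forall>p\<in>J. compose (carrier (?A p)) v (fn (\<iota> p)) = fn (\<tau> p)))"
    if T: "T \<in> fg_modules" and \<tau>: "\<And>p. p \<in> J \<Longrightarrow> \<tau> p \<in> hom ?C (?A p) T" for T \<tau>
  proof -
    have "v \<in> hom ?C L T \<and> (\<forall>p\<in>J. Comp ?C v (\<iota> p) = \<tau> p) \<longleftrightarrow> v \<in> hom ?C L T \<and>
      (\<forall>p\<in>J. compose (carrier (?A p)) (fn v) (fn (\<iota> p)) = fn (\<tau> p))" for v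
      using FG_Comp_eq_iff[OF \<iota> _ \<tau>] by blast
    then show ?thesis
      using FG_ex1_hom[OF L T, of m u "\<lambda>w. \<forall>p\<in>J. compose (carrier (?A p)) w (fn (\<iota> p)) = fn (\<tau> p)"]
      by (simp del: FG_simps)
  qed
  show ?thesis
  proof
    assume P: ?P
    have "module_colimit J ?A ?R L (\<lambda>p. fn (\<iota> p))"
    proof (rule module_colimitI)
      show "fn (\<iota> p) \<in> module_homs (?A p) L" if "p \<in> J" for p
        using \<iota>[OF that] by (simp add: FG_hom_iff)
      show "glue_compatible J ?A ?R (\<lambda>p. fn (\<iota> p))"
        using P FG_is_cocone_iff[OF X L \<iota>] unfolding is_colimit_def by blast
      fix T :: "('m, 'u) pmod" and \<tau>
      assume T: "T \<in> fg_modules" and \<tau>: "\<forall>p\<in>J. \<tau> p \<in> module_homs (?A p) T"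
        and c: "glue_compatible J ?A ?R \<tau>"
      define \<tau>' where "\<tau>' p = \<lparr>src = ?A p, fn = \<tau> p, tgt = T\<rparr>" for p
      have \<tau>': "\<tau>' p \<in> hom ?C (?A p) T" if "p \<in> J" for p
        using that T \<tau> vertex_fg by (simp add: \<tau>'_def FG_hom_iff)
      have fn_\<tau>': "fn (\<tau>' p) = \<tau> p" for p by (simp add: \<tau>'_def)
      have "is_cocone ?C J le X T \<tau>'"
        using FG_is_cocone_iff[OF X T \<tau>'] c by (simp add: fn_\<tau>')
      then have "\<exists>!v. v \<in> hom ?C L T \<and> (\<forall>p\<in>J. Comp ?C v (\<iota> p) = \<tau>' p)"
        using P unfolding is_colimit_def by blast
      then show "\<exists>!v. v \<in> module_homs L T \<and> (\<forall>p\<in>J. compose (carrier (?A p)) v (fn (\<iota> p)) = \<tau> p)"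
        using factor[OF T \<tau>'] by (simp add: fn_\<tau>')
    qed
    with True show ?Q by blast
  next
    assume ?Q
    then have mc: "module_colimit J ?A ?R L (\<lambda>p. fn (\<iota> p))" by blast
    have "\<exists>!v. v \<in> hom ?C L T \<and> (\<forall>p\<in>J. Comp ?C v (\<iota> p) = \<tau> p)"
      if cc: "is_cocone ?C J le X T \<tau>" for T \<tau>
    proof -
      have T: "T \<in> fg_modules" and \<tau>: "\<And>p. p \<in> J \<Longrightarrow> \<tau> p \<in> hom ?C (?A p) T"
        using cc by (auto simp: is_cocone_def vertex_def simp del: FG_simps(6))
      have "\<exists>!v. v \<in> module_homs L T \<and> (\<forall>p\<in>J. compose (carrier (?A p)) v (fn (\<iota> p)) = fn (\<tau> p))"
      proof (rule module_colimit_factor[OF mc T])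
        show "fn (\<tau> p) \<in> module_homs (?A p) T" if "p \<in> J" for p
          using \<tau>[OF that] by (simp add: FG_hom_iff)
        show "glue_compatible J ?A ?R (\<lambda>p. fn (\<tau> p))"
          using cc FG_is_cocone_iff[OF X T \<tau>] by blast
      qed
      then show ?thesis using factor[OF T \<tau>] by (simp del: FG_simps)
    qed
    moreover have "is_cocone ?C J le X L \<iota>"
      using FG_is_cocone_iff[OF X L \<iota>] module_colimit_compatible[OF mc] by blast
    ultimately show ?P unfolding is_colimit_def by blast
  qed
qed

lemma diagram_rel_stable:
  assumes X: "diagram (FG m u) J le X" and r: "((i, x), (j, y)) \<in> diagram_rel J le X"
  shows "((i, act (src (X i i)) x a), (j, act (src (X j j)) y a)) \<in> diagram_rel J le X"
proof -
  have ij: "i \<in> J" "j \<in> J" "le i j" "x \<in> carrier (src (X i i))" "y = fn (X i j) x"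
    using r unfolding diagram_rel_def by auto
  then have "X i j \<in> hom (FG m u) (src (X i i)) (src (X j j))" "src (X i i) \<in> fg_modules"
    using X by (simp_all add: diagram_def vertex_def)
  then have "fn (X i j) (act (src (X i i)) x a) = act (src (X j j)) y a"
    "act (src (X i i)) x a \<in> carrier (src (X i i))"
    using ij by (simp_all add: FG_hom_iff module_homs_act pointed_module.act_carrier fg_modules_pointed)
  then show ?thesis
    using ij unfolding diagram_rel_def by force
qed

lemma diagram_rel_subset:
  assumes X: "diagram (FG m u) J le X"
  shows "diagram_rel J le X \<subseteq> Sigma J (\<lambda>p. carrier (src (X p p))) \<times> Sigma J (\<lambda>p. carrier (src (X p p)))"
proof -
  have "fn (X p q) x \<in> carrier (src (X q q))"
    if "p \<in> J" "q \<in> J" "le p q" "x \<in> carrier (src (X p p))" for p q x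
    using that X module_homs_carrier[of "fn (X p q)" "src (X p p)" "src (X q q)"]
    by (simp add: diagram_def vertex_def FG_hom_iff)
  then show ?thesis by (auto simp: diagram_rel_def)
qed

text \<open>Retractions become arrows of \<open>FG\<close>, so that the general facts on composition
  and cobase change of split monomorphisms apply.\<close>

lemma FG_Cof_iff_retraction: "f \<in> Cof (FG m u) \<longleftrightarrow> f \<in> Arr (FG m u) \<and>
    (\<exists>r\<in>hom (FG m u) (tgt f) (src f). Comp (FG m u) r f = Id (FG m u) (src f))"
proof (cases "f \<in> Arr (FG m u)")
  case True
  then have f: "f \<in> hom (FG m u) (src f) (tgt f)" "src f \<in> fg_modules" "tgt f \<in> fg_modules"
    by (auto simp: FG_hom_iff FG_Arr_iff)
  have id: "restrict id (carrier (src f)) \<in> module_homs (src f) (src f)"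
    using f by (simp add: module_homs_id fg_modules_pointed)
  have "Comp (FG m u) r f = Id (FG m u) (src f) \<longleftrightarrow> (\<forall>s\<in>carrier (src f). fn r (fn f s) = s)"
    if "r \<in> hom (FG m u) (tgt f) (src f)" for r
    using FG_Comp_eq_iff[OF f(1) that, of "Id (FG m u) (src f)"] compose_eq_iff[OF id, of "fn r" "fn f"] id f
    by (simp add: FG_hom_iff)
  moreover have "r \<in> module_homs (tgt f) (src f) \<longleftrightarrow> \<lparr>src = tgt f, fn = r, tgt = src f\<rparr> \<in> hom (FG m u) (tgt f) (src f)" for r
    using f by (simp add: FG_hom_iff)
  ultimately show ?thesis
    using True unfolding FG_Cof_iff by (metis FG_hom_iff marrow.select_convs(2))
qed (simp add: FG_Cof_iff)

lemma FG_CofI: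
  assumes "f \<in> hom (FG m u) S T" "r \<in> hom (FG m u) T S" "Comp (FG m u) r f = Id (FG m u) S"
  shows "f \<in> Cof (FG m u)"
  using assms unfolding FG_Cof_iff_retraction by (auto simp: hom_def simp del: FG_simps(5,6))

lemma FG_pushout_exists:
  fixes f g :: "('m::{monoid_mult, mult_zero}, 'u) marrow"
  assumes inf: "infinite (UNIV :: 'u set)"
    and f: "f \<in> Arr (FG m u)" and g: "g \<in> Arr (FG m u)" and fg: "src f = src g"
  shows "\<exists>h k. is_pushout (FG m u) f g h k"
proof -
  note fam = span_family_fg[OF f g]
  obtain P \<iota> where P: "P \<in> fg_modules" and \<iota>: "\<And>b. \<iota> b \<in> module_homs (span_family f g b) P"
    and sc: "set_colimit UNIV (span_family f g) (span_rel f g) P \<iota>"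
    using set_colimit_exists[OF finite inf fam span_rel_stable[OF f g fg] span_rel_subset[OF f g fg]] by auto
  let ?h = "\<lparr>src = tgt f, fn = \<iota> False, tgt = P\<rparr>" and ?k = "\<lparr>src = tgt g, fn = \<iota> True, tgt = P\<rparr>"
  have "module_colimit UNIV (span_family f g) (span_rel f g) P \<iota>"
    by (rule set_colimit_imp_module_colimit) (use fam P \<iota> sc in \<open>auto intro: fg_modules_pointed\<close>)
  moreover have "(\<lambda>b. if b then fn ?k else fn ?h) = \<iota>" by (auto simp: fun_eq_iff)
  moreover have "?h \<in> hom (FG m u) (tgt f) P" "?k \<in> hom (FG m u) (tgt g) P"
    using f g P \<iota>[of False] \<iota>[of True] by (auto simp: FG_hom_iff FG_Arr_iff span_family_def)
  ultimately have "is_pushout (FG m u) f g ?h ?k"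
    unfolding FG_is_pushout_iff using f g fg by simp
  then show ?thesis by blast
qed

text \<open>Once cofibrations are split monomorphisms and weak equivalences isomorphisms, cobase
  change is \<open>pushout_split_mono\<close> and gluing is \<open>pushout_iso\<close>. The infinite
  universe is what makes pushouts exist.\<close>

lemma FG_waldhausen:
  assumes inf: "infinite (UNIV :: 'u set)"
  shows "waldhausen_category (FG (m :: 'm::{monoid_mult, mult_zero} itself) (u :: 'u itself))"
proof -
  interpret category "FG m u" by (rule FG_category)
  let ?Z = "\<lparr>carrier = {undefined}, pt = undefined, act = (\<lambda>_ _. undefined)\<rparr> :: ('m, 'u) pmod"
  have Z: "?Z \<in> fg_modules" by (rule zero_module_fg)
  \<comment> \<open>Preservation of base points and extensionality leave a single homomorphism out
    of, and likewise into, the one-element module.\<close>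
  have from_Z: "module_homs ?Z S = {restrict (\<lambda>_. pt S) {undefined}}" if "S \<in> fg_modules" for S :: "('m, 'u) pmod"
  proof -
    interpret S: pointed_module S using that by (rule fg_modules_pointed)
    show ?thesis by (auto simp: module_homs_def S.pt_carrier S.act_pt fun_eq_iff PiE_def extensional_def)
  qed
  have to_Z: "module_homs S ?Z = {restrict (\<lambda>_. undefined) (carrier S)}" if "S \<in> fg_modules" for S :: "('m, 'u) pmod"
  proof -
    interpret S: pointed_module S using that by (rule fg_modules_pointed)
    show ?thesis by (auto simp: module_homs_def S.pt_carrier S.act_carrier fun_eq_iff PiE_def extensional_def)
  qed
  show ?thesis
  proof
    show "Zero (FG m u) \<in> Obj (FG m u)" using Z by simp
    fix x assume "x \<in> Obj (FG m u)"
    then have x: "x \<in> fg_modules" by simp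
    show "\<exists>!f. f \<in> hom (FG m u) (Zero (FG m u)) x"
      using FG_ex1_hom[OF Z x, of m u "\<lambda>_. True"] unfolding from_Z[OF x] by simp
    show "\<exists>!f. f \<in> hom (FG m u) x (Zero (FG m u))"
      using FG_ex1_hom[OF x Z, of m u "\<lambda>_. True"] unfolding to_Z[OF x] by simp
  next
    show "Cof (FG m u) \<subseteq> Arr (FG m u)" using FG_Cof_iff by blast
    show "Weq (FG m u) \<subseteq> Arr (FG m u)" unfolding FG_Weq_eq is_iso_def by blast
  next
    fix f assume "is_iso (FG m u) f"
    then show "f \<in> Weq (FG m u)" "f \<in> Cof (FG m u)"
      by (auto simp: FG_Weq_eq FG_Cof_iff_retraction is_iso_def simp del: FG_simps(5,6))
  next
    fix f g assume f: "f \<in> Cof (FG m u)" and g: "g \<in> Cof (FG m u)" and "Cod (FG m u) f = Dom (FG m u) g"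
    then have homs: "f \<in> hom (FG m u) (src f) (src g)" "g \<in> hom (FG m u) (src g) (tgt g)" and tf: "tgt f = src g"
      by (auto simp: FG_Cof_iff hom_def)
    obtain r q where r: "r \<in> hom (FG m u) (src g) (src f)" "Comp (FG m u) r f = Id (FG m u) (src f)"
      and q: "q \<in> hom (FG m u) (tgt g) (src g)" "Comp (FG m u) q g = Id (FG m u) (src g)"
      using f g tf unfolding FG_Cof_iff_retraction by (auto simp del: FG_simps)
    show "Comp (FG m u) g f \<in> Cof (FG m u)"
      by (rule FG_CofI[OF Comp_hom[OF homs] Comp_hom[OF q(1) r(1)] split_mono_Comp[OF homs(1) r homs(2) q]])
  next
    fix f g assume "f \<in> Weq (FG m u)" "g \<in> Weq (FG m u)" and eq: "Cod (FG m u) f = Dom (FG m u) g"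
    then have f: "is_iso (FG m u) f" and g: "is_iso (FG m u) g"
      unfolding FG_Weq_eq by simp_all
    then have "f \<in> hom (FG m u) (src f) (src g)" "g \<in> hom (FG m u) (src g) (tgt g)"
      using eq by (simp_all add: is_iso_def hom_def)
    then show "Comp (FG m u) g f \<in> Weq (FG m u)"
      unfolding FG_Weq_eq mem_Collect_eq by (rule iso_Comp[OF f g])
  next
    fix f x assume "f \<in> hom (FG m u) (Zero (FG m u)) x"
    then have f: "f \<in> Arr (FG m u)" "src f = ?Z" "x = tgt f" "x \<in> fg_modules" by (auto simp: FG_hom_iff FG_Arr_iff)
    \<comment> \<open>The retraction is the constant map to the only element of the zero
      module.\<close>
    then show "f \<in> Cof (FG m u)"
      unfolding FG_Cof_iff using to_Z[of x] module_homs_carrier[of "fn f" ?Z x]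
      by (auto simp: FG_Arr_iff)
  next
    fix f g assume "f \<in> Cof (FG m u)" "g \<in> Arr (FG m u)" "Dom (FG m u) f = Dom (FG m u) g"
    then show "\<exists>h k. is_pushout (FG m u) f g h k"
      by (intro FG_pushout_exists[OF inf]) (simp_all add: FG_Cof_iff)
  next
    fix f g h k assume f: "f \<in> Cof (FG m u)" and po: "is_pushout (FG m u) f g h k"
    obtain r where r: "r \<in> hom (FG m u) (tgt f) (src f)" "Comp (FG m u) r f = Id (FG m u) (src f)"
      using f unfolding FG_Cof_iff_retraction by blast
    have "k \<in> Arr (FG m u)" using pushout_homs(4)[OF po] by (simp add: hom_def)
    moreover have "\<exists>q\<in>hom (FG m u) (tgt k) (src k). Comp (FG m u) q k = Id (FG m u) (src k)"
      using pushout_split_mono[OF po, of r] r by (simp del: FG_simps(5,6))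
    ultimately show "k \<in> Cof (FG m u)"
      unfolding FG_Cof_iff_retraction by blast
  next
    fix f f' g h k g' h' k' a b d v
    assume "is_pushout (FG m u) f g h k" "is_pushout (FG m u) f' g' h' k'"
      "a \<in> Weq (FG m u)" "b \<in> Weq (FG m u)" "d \<in> Weq (FG m u)"
      "a \<in> hom (FG m u) (Dom (FG m u) f) (Dom (FG m u) f')" "b \<in> hom (FG m u) (Cod (FG m u) f) (Cod (FG m u) f')"
      "d \<in> hom (FG m u) (Cod (FG m u) g) (Cod (FG m u) g')"
      "Comp (FG m u) b f = Comp (FG m u) f' a" "Comp (FG m u) d g = Comp (FG m u) g' a"
      "v \<in> hom (FG m u) (Cod (FG m u) h) (Cod (FG m u) h')"
      "Comp (FG m u) v h = Comp (FG m u) h' b" "Comp (FG m u) v k = Comp (FG m u) k' d"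
    then show "v \<in> Weq (FG m u)"
      unfolding FG_Weq_eq mem_Collect_eq by (rule pushout_iso)
  qed
qed

section \<open>Restriction of scalars\<close>

lemma restrict_scalars_simps [simp]:
  "carrier (restrict_scalars \<phi> S) = carrier S" "pt (restrict_scalars \<phi> S) = pt S"
  "act (restrict_scalars \<phi> S) s m = act S s (\<phi> m)"
  by (simp_all add: restrict_scalars_def)

lemma restrict_scalars_arrow_simps [simp]:
  "src (restrict_scalars_arrow \<phi> f) = restrict_scalars \<phi> (src f)"
  "tgt (restrict_scalars_arrow \<phi> f) = restrict_scalars \<phi> (tgt f)"
  "fn (restrict_scalars_arrow \<phi> f) = fn f"
  by (simp_all add: restrict_scalars_arrow_def)

lemma restrict_scalars_module:
  assumes "pointed_monoid_hom \<phi>" "pointed_module S"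
  shows "pointed_module (restrict_scalars \<phi> S)"
proof -
  interpret S: pointed_module S by (rule assms)
  show ?thesis
    using assms(1) unfolding pointed_monoid_hom_def
    by unfold_locales (simp_all add: S.pt_carrier S.act_carrier S.act_one S.act_mult S.act_pt S.act_zero S.act_outside)
qed

lemma restrict_scalars_homs:
  "f \<in> module_homs S T \<Longrightarrow> f \<in> module_homs (restrict_scalars \<phi> S) (restrict_scalars \<phi> T)"
  by (simp add: module_homs_def)

lemma restrict_scalars_set_colimit:
  "set_colimit I (\<lambda>i. restrict_scalars \<phi> (A i)) R (restrict_scalars \<phi> L) \<iota> \<longleftrightarrow> set_colimit I A R L \<iota>"
  by (simp add: set_colimit_def glued_def glue_compatible_def)

text \<open>Generators multiply in a tower: write \<open>s\<close> as \<open>g\<close> acted on by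
  \<open>n\<close>, and \<open>n\<close> as \<open>h * \<phi> m\<close> with \<open>h\<close> from a
  finite generating set \<open>H\<close> of \<open>N\<close> over \<open>M\<close>. Then
  \<open>act S g h\<close> generates \<open>s\<close> over \<open>M\<close>.\<close>

lemma restrict_scalars_fg:
  fixes \<phi> :: "'m::{monoid_mult, mult_zero} \<Rightarrow> 'n::{monoid_mult, mult_zero}"
  assumes hom: "pointed_monoid_hom \<phi>"
    and fg: "finitely_generated (restrict_scalars \<phi> (regular_module :: ('n, 'n) pmod))"
    and S: "S \<in> fg_modules"
  shows "restrict_scalars \<phi> S \<in> fg_modules"
proof -
  interpret S: pointed_module S using S by (rule fg_modules_pointed)
  obtain H :: "'n set" where H: "finite H" "UNIV = (\<Union>h\<in>H. range (\<lambda>m. h * \<phi> m))"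
    using fg unfolding finitely_generated_def by (auto simp: regular_module_def restrict_scalars_def)
  obtain G where G: "finite G" "G \<subseteq> carrier S" "\<And>s. s \<in> carrier S \<Longrightarrow> \<exists>g\<in>G. \<exists>n. s = act S g n"
    using fg_modules_generators[OF S] by blast
  show ?thesis
  proof (rule fg_modulesI[where G = "(\<lambda>(g, h). act S g h) ` (G \<times> H)"])
    show "pointed_module (restrict_scalars \<phi> S)"
      by (rule restrict_scalars_module[OF hom S.pointed_module_axioms])
    show "(\<lambda>(g, h). act S g h) ` (G \<times> H) \<subseteq> carrier (restrict_scalars \<phi> S)"
      using G(2) S.act_carrier by auto
  next
    fix s assume "s \<in> carrier (restrict_scalars \<phi> S)"
    then obtain g n where g: "g \<in> G" "s = act S g n" using G(3)[of s] by auto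
    obtain h m where h: "h \<in> H" "n = h * \<phi> m" using H(2) by blast
    have "s = act S (act S g h) (\<phi> m)"
      using g h G(2) S.act_mult by auto
    then show "\<exists>t\<in>(\<lambda>(g, h). act S g h) ` (G \<times> H). \<exists>m. s = act (restrict_scalars \<phi> S) t m"
      using g(1) h(1) by (intro bexI[of _ "act S g h"] exI[of _ m]) auto
  qed (use G(1) H(1) in simp)
qed

text \<open>There are more test modules over \<open>M\<close> than restricted ones. The detour
  through \<open>set_colimit\<close> avoids them: it follows from universality over
  \<open>N\<close>, is unchanged by restriction, and implies universality over
  \<open>M\<close>.\<close>

lemma restrict_scalars_module_colimit:
  fixes \<phi> :: "'m::{monoid_mult, mult_zero} \<Rightarrow> 'n::{monoid_mult, mult_zero}"
    and A :: "'i \<Rightarrow> ('n, 'u) pmod"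
  assumes hom: "pointed_monoid_hom \<phi>" and fin: "finite I" and inf: "infinite (UNIV :: 'u set)"
    and A: "\<And>i. i \<in> I \<Longrightarrow> A i \<in> fg_modules"
    and stable: "\<And>i x j y m. ((i, x), (j, y)) \<in> R \<Longrightarrow> ((i, act (A i) x m), (j, act (A j) y m)) \<in> R"
    and R: "R \<subseteq> Sigma I (\<lambda>i. carrier (A i)) \<times> Sigma I (\<lambda>i. carrier (A i))"
    and L: "L \<in> fg_modules" and mc: "module_colimit I A R L \<iota>"
  shows "module_colimit I (\<lambda>i. restrict_scalars \<phi> (A i)) R (restrict_scalars \<phi> L) \<iota>"
proof (rule set_colimit_imp_module_colimit)
  show "set_colimit I (\<lambda>i. restrict_scalars \<phi> (A i)) R (restrict_scalars \<phi> L) \<iota>"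
    unfolding restrict_scalars_set_colimit
    by (rule module_colimit_imp_set_colimit[OF fin inf A stable R L mc])
  show "\<iota> i \<in> module_homs (restrict_scalars \<phi> (A i)) (restrict_scalars \<phi> L)" if "i \<in> I" for i
    by (rule restrict_scalars_homs[OF module_colimit_homs[OF mc that]])
qed (use A L in \<open>auto intro: restrict_scalars_module[OF hom] fg_modules_pointed\<close>)

locale finite_extension =
  fixes \<phi> :: "'m::{monoid_mult, mult_zero} \<Rightarrow> 'n::{monoid_mult, mult_zero}" and u :: "'u itself"
  assumes hom: "pointed_monoid_hom \<phi>"
    and fg: "finitely_generated (restrict_scalars \<phi> (regular_module :: ('n, 'n) pmod))"
    and infinite_universe: "infinite (UNIV :: 'u set)"
begin

abbreviation "N_mod \<equiv> FG TYPE('n) u"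
abbreviation "M_mod \<equiv> FG TYPE('m) u"

lemma res_hom: "f \<in> hom N_mod S T \<Longrightarrow>
    restrict_scalars_arrow \<phi> f \<in> hom M_mod (restrict_scalars \<phi> S) (restrict_scalars \<phi> T)"
  using restrict_scalars_fg[OF hom fg] by (auto simp: FG_hom_iff restrict_scalars_homs)

lemma res_Arr: "f \<in> Arr N_mod \<Longrightarrow> restrict_scalars_arrow \<phi> f \<in> Arr M_mod"
  using restrict_scalars_fg[OF hom fg] by (auto simp: FG_Arr_iff restrict_scalars_homs)

lemma res_Comp: "restrict_scalars_arrow \<phi> (Comp N_mod g f) =
    Comp M_mod (restrict_scalars_arrow \<phi> g) (restrict_scalars_arrow \<phi> f)"
  by (simp add: marrow_eq_iff)

lemma res_Id: "restrict_scalars_arrow \<phi> (Id N_mod S) = Id M_mod (restrict_scalars \<phi> S)"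
  by (simp add: marrow_eq_iff)

lemma res_pushout:
  fixes f g h k :: "('n, 'u) marrow"
  assumes "is_pushout N_mod f g h k"
  shows "is_pushout M_mod (restrict_scalars_arrow \<phi> f) (restrict_scalars_arrow \<phi> g)
    (restrict_scalars_arrow \<phi> h) (restrict_scalars_arrow \<phi> k)"
proof -
  let ?r = "restrict_scalars_arrow \<phi> :: ('n, 'u) marrow \<Rightarrow> ('m, 'u) marrow"
  have f: "f \<in> Arr N_mod" and g: "g \<in> Arr N_mod" and fg': "src f = src g"
    and h: "h \<in> hom N_mod (tgt f) (tgt h)" and k: "k \<in> hom N_mod (tgt g) (tgt h)"
    and mc: "module_colimit UNIV (span_family f g) (span_rel f g) (tgt h) (\<lambda>b. if b then fn k else fn h)"
    using assms unfolding FG_is_pushout_iff by blast+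
  have "span_family (?r f) (?r g) = (\<lambda>b. restrict_scalars \<phi> (span_family f g b))"
    "span_rel (?r f) (?r g) = span_rel f g"
    by (auto simp: span_family_def span_rel_def fun_eq_iff)
  moreover have "tgt h \<in> fg_modules" using h by (simp add: FG_hom_iff)
  ultimately have "module_colimit UNIV (span_family (?r f) (?r g)) (span_rel (?r f) (?r g))
      (restrict_scalars \<phi> (tgt h)) (\<lambda>b. if b then fn k else fn h)"
    using restrict_scalars_module_colimit[OF hom finite infinite_universe span_family_fg[OF f g]
      span_rel_stable[OF f g fg'] span_rel_subset[OF f g fg'] _ mc] by simp
  then show ?thesis
    unfolding FG_is_pushout_iff restrict_scalars_arrow_simps
    using res_Arr[OF f] res_Arr[OF g] fg' res_hom[OF h] res_hom[OF k] by simp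
qed

lemma res_diagram:
  fixes X :: "'j \<Rightarrow> 'j \<Rightarrow> ('n, 'u) marrow"
  assumes "diagram N_mod J le X"
  shows "diagram M_mod J le (\<lambda>p q. restrict_scalars_arrow \<phi> (X p q))"
proof -
  have "X p q \<in> hom N_mod (src (X p p)) (src (X q q))"
    if "p \<in> J" "q \<in> J" "le p q" for p q
    using assms that by (simp add: diagram_def vertex_def)
  moreover have "src (X p p) \<in> fg_modules" "X p p = Id N_mod (src (X p p))" if "p \<in> J" for p
    using assms that by (auto simp: diagram_def vertex_def)
  moreover have "X p q = Comp N_mod (X r q) (X p r)" if "p \<in> J" "q \<in> J" "r \<in> J" "le p r" "le r q" for p q r
    using assms that unfolding diagram_def by blast
  ultimately show ?thesis
    unfolding diagram_def vertex_def FG_simps(1,2) restrict_scalars_arrow_simps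
    using restrict_scalars_fg[OF hom fg] res_hom res_Id res_Comp by metis
qed

text \<open>\<open>diagram_rel\<close> refers only to carriers and underlying functions, so it is
  literally the same relation before and after restriction.\<close>

lemma res_colimit:
  fixes X :: "'j \<Rightarrow> 'j \<Rightarrow> ('n, 'u) marrow"
  assumes fin: "finite J" and X: "diagram N_mod J le X" and col: "is_colimit N_mod J le X L \<iota>"
  shows "is_colimit M_mod J le (\<lambda>p q. restrict_scalars_arrow \<phi> (X p q)) (restrict_scalars \<phi> L)
    (\<lambda>p. restrict_scalars_arrow \<phi> (\<iota> p))"
proof -
  have L: "L \<in> fg_modules" and \<iota>: "\<And>p. p \<in> J \<Longrightarrow> \<iota> p \<in> hom N_mod (src (X p p)) L"
    and mc: "module_colimit J (\<lambda>p. src (X p p)) (diagram_rel J le X) L (\<lambda>p. fn (\<iota> p))"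
    using col unfolding FG_is_colimit_iff[OF X] by blast+
  have "src (X p p) \<in> fg_modules" if "p \<in> J" for p
    using X that by (simp add: diagram_def vertex_def)
  then have "module_colimit J (\<lambda>p. restrict_scalars \<phi> (src (X p p))) (diagram_rel J le X)
      (restrict_scalars \<phi> L) (\<lambda>p. fn (\<iota> p))"
    by (rule restrict_scalars_module_colimit[OF hom fin infinite_universe _
        diagram_rel_stable[OF X] diagram_rel_subset[OF X] L mc])
  moreover have "diagram_rel J le (\<lambda>p q. restrict_scalars_arrow \<phi> (X p q)) = diagram_rel J le X"
    by (simp add: diagram_rel_def)
  ultimately show ?thesis
    unfolding FG_is_colimit_iff[OF res_diagram[OF X]]
    using restrict_scalars_fg[OF hom fg L] res_hom[OF \<iota>] by simp
qed

text \<open>Retractions and inverses restrict together with the arrows, which settles cofibrations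
  and weak equivalences.\<close>

lemma res_exact: "exact_functor N_mod M_mod (restrict_scalars \<phi>) (restrict_scalars_arrow \<phi>)"
proof -
  interpret N: waldhausen_category N_mod by (rule FG_waldhausen[OF infinite_universe])
  interpret M: waldhausen_category M_mod by (rule FG_waldhausen[OF infinite_universe])
  show ?thesis
  proof
    show "restrict_scalars \<phi> (Zero N_mod) = Zero M_mod"
      by (simp add: restrict_scalars_def)
  next
    fix f assume "f \<in> Cof N_mod"
    then show "restrict_scalars_arrow \<phi> f \<in> Cof M_mod"
      unfolding FG_Cof_iff using res_Arr restrict_scalars_homs[of _ "tgt f" "src f" \<phi>] by auto
  next
    fix f assume "f \<in> Weq N_mod"
    then show "restrict_scalars_arrow \<phi> f \<in> Weq M_mod"
      unfolding FG_Weq_eq is_iso_def mem_Collect_eq FG_simps(2,3) restrict_scalars_arrow_simps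
      using res_Arr res_hom res_Id res_Comp by metis
  next
    fix x assume "x \<in> Obj N_mod"
    then show "restrict_scalars \<phi> x \<in> Obj M_mod"
      using restrict_scalars_fg[OF hom fg] by simp
  qed (rule res_hom res_Id res_Comp res_pushout; assumption?)+
qed

end

section \<open>Zero arrows and simple colimits\<close>

lemma diagram_Obj: "diagram C J le X \<Longrightarrow> p \<in> J \<Longrightarrow> vertex C X p \<in> Obj C"
  by (simp add: diagram_def)

lemma diagram_Id: "diagram C J le X \<Longrightarrow> p \<in> J \<Longrightarrow> X p p = Id C (vertex C X p)"
  by (simp add: diagram_def)

lemma diagram_hom:
  "diagram C J le X \<Longrightarrow> p \<in> J \<Longrightarrow> q \<in> J \<Longrightarrow> le p q \<Longrightarrow> X p q \<in> hom C (vertex C X p) (vertex C X q)"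
  by (simp add: diagram_def)

lemma diagram_Comp:
  "diagram C J le X \<Longrightarrow> p \<in> J \<Longrightarrow> q \<in> J \<Longrightarrow> r \<in> J \<Longrightarrow> le p q \<Longrightarrow> le q r \<Longrightarrow>
    Comp C (X q r) (X p q) = X p r"
  unfolding diagram_def by metis

lemma diagram_subset: "diagram C J le X \<Longrightarrow> K \<subseteq> J \<Longrightarrow> diagram C K le X"
  unfolding diagram_def by (meson subsetD)

lemma cocone_Obj: "is_cocone C J le X T \<tau> \<Longrightarrow> T \<in> Obj C"
  by (simp add: is_cocone_def)

lemma cocone_hom: "is_cocone C J le X T \<tau> \<Longrightarrow> p \<in> J \<Longrightarrow> \<tau> p \<in> hom C (vertex C X p) T"
  by (simp add: is_cocone_def)

lemma cocone_Comp:
  "is_cocone C J le X T \<tau> \<Longrightarrow> p \<in> J \<Longrightarrow> q \<in> J \<Longrightarrow> le p q \<Longrightarrow> Comp C (\<tau> q) (X p q) = \<tau> p"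
  by (simp add: is_cocone_def)

lemma coconeI:
  assumes "T \<in> Obj C" "\<And>p. p \<in> J \<Longrightarrow> \<tau> p \<in> hom C (vertex C X p) T"
    and "\<And>p q. p \<in> J \<Longrightarrow> q \<in> J \<Longrightarrow> le p q \<Longrightarrow> Comp C (\<tau> q) (X p q) = \<tau> p"
  shows "is_cocone C J le X T \<tau>"
  using assms by (simp add: is_cocone_def)

lemma colimit_cocone: "is_colimit C J le X L \<iota> \<Longrightarrow> is_cocone C J le X L \<iota>"
  by (simp add: is_colimit_def)

lemma colimit_factor:
  "is_colimit C J le X L \<iota> \<Longrightarrow> is_cocone C J le X T \<tau> \<Longrightarrow>
    \<exists>!u. u \<in> hom C L T \<and> (\<forall>p\<in>J. Comp C u (\<iota> p) = \<tau> p)"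
  unfolding is_colimit_def by blast

lemma colimitI:
  assumes "is_cocone C J le X L \<iota>"
    and "\<And>T \<tau>. is_cocone C J le X T \<tau> \<Longrightarrow> \<exists>!u. u \<in> hom C L T \<and> (\<forall>p\<in>J. Comp C u (\<iota> p) = \<tau> p)"
  shows "is_colimit C J le X L \<iota>"
  using assms unfolding is_colimit_def by blast

lemma is_colimit_cong:
  assumes "\<And>p q. p \<in> J \<Longrightarrow> q \<in> J \<Longrightarrow> le p q \<Longrightarrow> X p q = Y p q" and "\<And>p. p \<in> J \<Longrightarrow> le p p"
  shows "is_colimit C J le X L \<iota> = is_colimit C J le Y L \<iota>"
proof -
  have "is_cocone C J le X T \<tau> = is_cocone C J le Y T \<tau>" for T \<tau>
    unfolding is_cocone_def vertex_def using assms by auto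
  then show ?thesis unfolding is_colimit_def by simp
qed

text \<open>\<open>e\<close> is an isomorphism of index orders with inverse \<open>d\<close>;
  cocones on the relabelled diagram are carried back along \<open>d\<close>.\<close>

lemma is_colimit_reindex:
  assumes col: "is_colimit C J le X L \<iota>"
    and e: "\<And>p. p \<in> J' \<Longrightarrow> e p \<in> J" "\<And>p q. p \<in> J' \<Longrightarrow> q \<in> J' \<Longrightarrow> le' p q \<longleftrightarrow> le (e p) (e q)"
    and d: "\<And>p. p \<in> J \<Longrightarrow> d p \<in> J'" "\<And>p. p \<in> J \<Longrightarrow> e (d p) = p" "\<And>p. p \<in> J' \<Longrightarrow> d (e p) = p"
  shows "is_colimit C J' le' (\<lambda>p q. X (e p) (e q)) L (\<lambda>p. \<iota> (e p))"
proof (rule colimitI)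
  show "is_cocone C J' le' (\<lambda>p q. X (e p) (e q)) L (\<lambda>p. \<iota> (e p))"
    using colimit_cocone[OF col] e by (simp add: is_cocone_def vertex_def)
  fix T \<tau> assume \<tau>: "is_cocone C J' le' (\<lambda>p q. X (e p) (e q)) T \<tau>"
  have "is_cocone C J le X T (\<lambda>p. \<tau> (d p))"
  proof (rule coconeI)
    show "T \<in> Obj C" by (rule cocone_Obj[OF \<tau>])
    show "\<tau> (d p) \<in> hom C (vertex C X p) T" if "p \<in> J" for p
    proof -
      have "\<tau> (d p) \<in> hom C (Dom C (X (e (d p)) (e (d p)))) T"
        using cocone_hom[OF \<tau> d(1)[OF that]] by (simp add: vertex_def)
      then show ?thesis using d(2)[OF that] by (simp add: vertex_def)
    qed
    show "Comp C (\<tau> (d q)) (X p q) = \<tau> (d p)" if "p \<in> J" "q \<in> J" "le p q" for p q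
    proof -
      have "le' (d p) (d q)" using e(2)[OF d(1) d(1)] d(2) that by simp
      then have "Comp C (\<tau> (d q)) (X (e (d p)) (e (d q))) = \<tau> (d p)"
        using cocone_Comp[OF \<tau> d(1) d(1)] that by simp
      then show ?thesis using d(2) that by simp
    qed
  qed
  then have "\<exists>!u. u \<in> hom C L T \<and> (\<forall>p\<in>J. Comp C u (\<iota> p) = \<tau> (d p))"
    by (rule colimit_factor[OF col])
  moreover have "(\<forall>p\<in>J. Comp C u (\<iota> p) = \<tau> (d p)) \<longleftrightarrow> (\<forall>p\<in>J'. Comp C u (\<iota> (e p)) = \<tau> p)" for u
    using e(1) d by metis
  ultimately show "\<exists>!u. u \<in> hom C L T \<and> (\<forall>p\<in>J'. Comp C u (\<iota> (e p)) = \<tau> p)" by simp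
qed

context waldhausen_category
begin

lemma from_Zero_unique: "f \<in> hom C (Zero C) x \<Longrightarrow> g \<in> hom C (Zero C) x \<Longrightarrow> f = g"
  using Zero_initial hom_Obj by blast

lemma to_Zero_unique: "f \<in> hom C x (Zero C) \<Longrightarrow> g \<in> hom C x (Zero C) \<Longrightarrow> f = g"
  using Zero_terminal hom_Obj by blast

lemma zero_arrow_factors:
  assumes "x \<in> Obj C" "y \<in> Obj C"
  obtains i p where "i \<in> hom C (Zero C) y" "p \<in> hom C x (Zero C)" "zero_arrow C x y = Comp C i p"
  using theI'[OF Zero_initial[OF assms(2)]] theI'[OF Zero_terminal[OF assms(1)]]
  unfolding zero_arrow_def by blast

lemma zero_arrow_hom: "x \<in> Obj C \<Longrightarrow> y \<in> Obj C \<Longrightarrow> zero_arrow C x y \<in> hom C x y"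
  by (metis zero_arrow_factors Comp_hom)

text \<open>Each side factors through \<open>Zero C\<close>, and arrows out of or into
  \<open>Zero C\<close> are unique, so the factors on the two sides coincide.\<close>

lemma zero_arrow_Comp:
  assumes "f \<in> hom C x y"
  shows "z \<in> Obj C \<Longrightarrow> Comp C f (zero_arrow C z x) = zero_arrow C z y"
    and "z \<in> Obj C \<Longrightarrow> Comp C (zero_arrow C y z) f = zero_arrow C x z"
proof -
  have xy: "x \<in> Obj C" "y \<in> Obj C" using hom_Obj[OF assms] by blast+
  assume z: "z \<in> Obj C"
  obtain i p where i: "i \<in> hom C (Zero C) x" "p \<in> hom C z (Zero C)" "zero_arrow C z x = Comp C i p"
    using zero_arrow_factors[OF z xy(1)] .
  obtain i' p' where i': "i' \<in> hom C (Zero C) y" "p' \<in> hom C z (Zero C)" "zero_arrow C z y = Comp C i' p'"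
    using zero_arrow_factors[OF z xy(2)] .
  have "Comp C f i = i'" "p = p'"
    using from_Zero_unique[OF Comp_hom[OF i(1) assms] i'(1)] to_Zero_unique[OF i(2) i'(2)] by simp_all
  then show "Comp C f (zero_arrow C z x) = zero_arrow C z y"
    using Comp_assoc[OF i(2,1) assms] i i' by simp
  obtain j q where j: "j \<in> hom C (Zero C) z" "q \<in> hom C y (Zero C)" "zero_arrow C y z = Comp C j q"
    using zero_arrow_factors[OF xy(2) z] .
  obtain j' q' where j': "j' \<in> hom C (Zero C) z" "q' \<in> hom C x (Zero C)" "zero_arrow C x z = Comp C j' q'"
    using zero_arrow_factors[OF xy(1) z] .
  have "Comp C q f = q'" "j = j'"
    using to_Zero_unique[OF Comp_hom[OF assms j(2)] j'(2)] from_Zero_unique[OF j(1) j'(1)] by simp_all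
  then show "Comp C (zero_arrow C y z) f = zero_arrow C x z"
    using Comp_assoc[OF assms j(2,1)] j j' by simp
qed

lemma zero_arrow_eq:
  shows "f \<in> hom C (Zero C) x \<Longrightarrow> f = zero_arrow C (Zero C) x"
    and "g \<in> hom C x (Zero C) \<Longrightarrow> g = zero_arrow C x (Zero C)"
  by (meson from_Zero_unique to_Zero_unique zero_arrow_hom hom_Obj Zero_Obj)+

lemma Id_Zero: "Id C (Zero C) \<in> hom C (Zero C) (Zero C)"
  by (rule Id_hom[OF Zero_Obj])

lemma zero_arrow_Zero: "zero_arrow C (Zero C) (Zero C) = Id C (Zero C)"
  using zero_arrow_eq(1)[OF Id_Zero] by simp

lemma Comp_Id_Zero: "Comp C (Id C (Zero C)) (Id C (Zero C)) = Id C (Zero C)"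
  using Comp_Id_left[OF Id_Zero] .

lemma Id_iso: "x \<in> Obj C \<Longrightarrow> is_iso C (Id C x)"
  by (rule isoI[OF Id_hom Id_hom]) (auto intro: Comp_Id_left[OF Id_hom])

lemma Id_Cof: "x \<in> Obj C \<Longrightarrow> Id C x \<in> Cof C"
  by (rule iso_Cof[OF Id_iso])

lemma Id_Weq: "x \<in> Obj C \<Longrightarrow> Id C x \<in> Weq C"
  by (rule iso_Weq[OF Id_iso])

lemma Dom_Id: "x \<in> Obj C \<Longrightarrow> Dom C (Id C x) = x"
  using Id_hom by (auto simp: hom_def)

lemma Dom_Id_Zero: "Dom C (Id C (Zero C)) = Zero C"
  by (rule Dom_Id[OF Zero_Obj])

text \<open>Any arrow out of \<open>Zero C\<close> is the unique one, so every cocone factors. This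
  includes empty \<open>J\<close>, where the statement is that \<open>Zero C\<close> is
  initial.\<close>

lemma is_colimit_zero:
  assumes "\<And>p q. p \<in> J \<Longrightarrow> q \<in> J \<Longrightarrow> le p q \<Longrightarrow> X p q = Id C (Zero C)" and "\<And>p. p \<in> J \<Longrightarrow> le p p"
  shows "is_colimit C J le X (Zero C) (\<lambda>_. Id C (Zero C))"
proof -
  have "is_colimit C J le (\<lambda>_ _. Id C (Zero C)) (Zero C) (\<lambda>_. Id C (Zero C))"
    unfolding is_colimit_def is_cocone_def vertex_def Dom_Id_Zero
  proof (intro conjI allI impI ballI)
    fix T \<tau>
    assume T: "T \<in> Obj C \<and> (\<forall>p\<in>J. \<tau> p \<in> hom C (Zero C) T) \<and>
      (\<forall>p\<in>J. \<forall>q\<in>J. le p q \<longrightarrow> Comp C (\<tau> q) (Id C (Zero C)) = \<tau> p)"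
    then obtain u where u: "u \<in> hom C (Zero C) T" using Zero_initial by blast
    have "Comp C v (Id C (Zero C)) = \<tau> p" if "v \<in> hom C (Zero C) T" "p \<in> J" for v p
      using from_Zero_unique[OF Comp_hom[OF Id_Zero that(1)]] T that(2) by blast
    then show "\<exists>!u. u \<in> hom C (Zero C) T \<and> (\<forall>p\<in>J. Comp C u (Id C (Zero C)) = \<tau> p)"
      using u from_Zero_unique by blast
  qed (simp_all add: Zero_Obj Id_Zero Comp_Id_Zero)
  then show ?thesis
    using is_colimit_cong[of J le X "\<lambda>_ _. Id C (Zero C)" C] assms by simp
qed

text \<open>The condition of a cofibration cube at a single \<open>U\<close> below which everything
  is zero: latching object and latching map are \<open>Zero C\<close> and its identity. It serves
  zero cubes and zero faces alike.\<close>

lemma zero_cofibration_cubeI: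
  assumes "\<And>V. V \<subset> U \<Longrightarrow> Y V U = Id C (Zero C)" "Y U U = Id C (Zero C)"
    and "\<And>V W. W \<subset> U \<Longrightarrow> V \<subseteq> W \<Longrightarrow> Y V W = Id C (Zero C)"
  shows "\<exists>L \<iota>. \<exists>u \<in> Cof C. is_colimit C {V. V \<subset> U} (\<subseteq>) Y L \<iota> \<and> u \<in> hom C L (vertex C Y U) \<and>
     (\<forall>V. V \<subset> U \<longrightarrow> Comp C u (\<iota> V) = Y V U)"
proof (intro exI bexI conjI allI impI)
  show "is_colimit C {V. V \<subset> U} (\<subseteq>) Y (Zero C) (\<lambda>_. Id C (Zero C))"
    by (rule is_colimit_zero) (use assms(3) in auto)
  show "Id C (Zero C) \<in> Cof C" by (rule Id_Cof[OF Zero_Obj])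
  show "Id C (Zero C) \<in> hom C (Zero C) (vertex C Y U)"
    unfolding vertex_def assms(2) Dom_Id_Zero by (rule Id_Zero)
  show "Comp C (Id C (Zero C)) (Id C (Zero C)) = Y V U" if "V \<subset> U" for V
    unfolding assms(1)[OF that] by (rule Comp_Id_Zero)
qed

lemma cofibration_cube_zero: "cofibration_cube C n (\<lambda>_ _. Id C (Zero C))"
  unfolding cofibration_cube_def by (intro allI impI zero_cofibration_cubeI) simp_all

text \<open>Direction \<open>0\<close> is the new one; preimages under \<open>Suc\<close> shift the other directions down.\<close>

lemma cofibration_cube_degenerate:
  assumes Z: "diagram C {V. V \<subseteq> {..<n}} (\<subseteq>) Z" and cube: "cofibration_cube C n Z"
  shows "cofibration_cube C (Suc n) (\<lambda>V W. Z (Suc -` V) (Suc -` W))"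
  unfolding cofibration_cube_def
proof (intro allI impI)
  fix U assume U: "U \<subseteq> {..<Suc n}"
  let ?Y = "\<lambda>V W. Z (Suc -` V) (Suc -` W)"
  have T: "Suc -` V \<subseteq> {..<n}" if "V \<subseteq> U" for V using that U by auto
  have vertex: "vertex C ?Y V = vertex C Z (Suc -` V)" for V by (simp add: vertex_def)
  show "\<exists>L \<iota>. \<exists>u\<in>Cof C. is_colimit C {V. V \<subset> U} (\<subseteq>) ?Y L \<iota> \<and> u \<in> hom C L (vertex C ?Y U) \<and>
      (\<forall>V. V \<subset> U \<longrightarrow> Comp C u (\<iota> V) = ?Y V U)"
  proof (cases "0 \<in> U")
    case False
    have U_eq: "V = Suc ` (Suc -` V)" if "V \<subseteq> U" for V
    proof (rule set_eqI)
      show "x \<in> V \<longleftrightarrow> x \<in> Suc ` (Suc -` V)" for x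
        using that False by (cases x) auto
    qed
    have strict: "Suc -` V \<subset> Suc -` U" if "V \<subset> U" for V
    proof
      show "Suc -` V \<subseteq> Suc -` U" using that by blast
      show "Suc -` V \<noteq> Suc -` U"
      proof
        assume "Suc -` V = Suc -` U"
        then have "V = U" using U_eq[of V] U_eq[of U] that by auto
        with that show False by blast
      qed
    qed
    obtain L \<iota> u where u: "u \<in> Cof C" "is_colimit C {V. V \<subset> Suc -` U} (\<subseteq>) Z L \<iota>"
      "u \<in> hom C L (vertex C Z (Suc -` U))" "\<And>V. V \<subset> Suc -` U \<Longrightarrow> Comp C u (\<iota> V) = Z V (Suc -` U)"
      using cube T[OF order_refl] unfolding cofibration_cube_def by metis
    have "is_colimit C {V. V \<subset> U} (\<subseteq>) ?Y L (\<lambda>V. \<iota> (Suc -` V))"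
    proof (rule is_colimit_reindex[OF u(2), where d = "(`) Suc"])
      show "V \<subseteq> W \<longleftrightarrow> Suc -` V \<subseteq> Suc -` W" if "V \<in> {V. V \<subset> U}" "W \<in> {V. V \<subset> U}" for V W
        using that U_eq[of V] U_eq[of W] by (metis mem_Collect_eq psubset_imp_subset image_mono vimage_mono)
      show "Suc ` V \<in> {V. V \<subset> U}" if "V \<in> {V. V \<subset> Suc -` U}" for V
        using that U_eq[of U] by (metis (no_types, lifting) mem_Collect_eq order_refl inj_Suc inj_image_mem_iff
            image_mono psubset_eq inj_vimage_image_eq)
    qed (use strict U_eq in \<open>auto simp: inj_vimage_image_eq\<close>)
    then show ?thesis
      using u strict vertex by (intro exI[of _ L] exI[of _ "\<lambda>V. \<iota> (Suc -` V)"] bexI[of _ u]) auto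
  next
    \<comment> \<open>The cube is constant in direction \<open>0\<close>: the edges from
      \<open>V - {0}\<close> to \<open>V\<close> are identities. A cocone is therefore determined by
      its component at \<open>U - {0}\<close>, whose vertex is the one at \<open>U\<close>, and the
      latching map is an identity.\<close>
    case True
    have U': "Suc -` U \<subseteq> {..<n}" using T by blast
    then have obj: "vertex C Z (Suc -` U) \<in> Obj C" and id: "Z (Suc -` U) (Suc -` U) = Id C (vertex C Z (Suc -` U))"
      using diagram_Obj[OF Z] diagram_Id[OF Z] by simp_all
    have arr: "Z (Suc -` V) (Suc -` U) \<in> hom C (vertex C Z (Suc -` V)) (vertex C Z (Suc -` U))" if "V \<subseteq> U" for V
      using diagram_hom[OF Z] T[OF that] U' vimage_mono[OF that, of Suc] by simp
    have strip: "Suc -` (V - {0}) = Suc -` V" for V by auto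
    have "is_colimit C {V. V \<subset> U} (\<subseteq>) ?Y (vertex C Z (Suc -` U)) (\<lambda>V. Z (Suc -` V) (Suc -` U))"
    proof (rule colimitI)
      have "Comp C (Z (Suc -` W) (Suc -` U)) (Z (Suc -` V) (Suc -` W)) = Z (Suc -` V) (Suc -` U)"
        if "V \<subset> U" "W \<subset> U" "V \<subseteq> W" for V W
      proof -
        have "Suc -` V \<subseteq> {..<n}" "Suc -` W \<subseteq> {..<n}" "Suc -` V \<subseteq> Suc -` W" "Suc -` W \<subseteq> Suc -` U"
          using that T by auto
        then show ?thesis using diagram_Comp[OF Z] U' by simp
      qed
      then show "is_cocone C {V. V \<subset> U} (\<subseteq>) ?Y (vertex C Z (Suc -` U)) (\<lambda>V. Z (Suc -` V) (Suc -` U))"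
        using obj arr by (intro coconeI) (auto simp: vertex)
      fix T' \<tau> assume \<tau>: "is_cocone C {V. V \<subset> U} (\<subseteq>) ?Y T' \<tau>"
      let ?W = "U - {0}"
      have W: "?W \<subset> U" using True by blast
      have \<tau>_hom: "\<tau> V \<in> hom C (vertex C Z (Suc -` V)) T'" if "V \<subset> U" for V
        using cocone_hom[OF \<tau>, of V] that by (simp add: vertex)
      have \<tau>W: "\<tau> ?W \<in> hom C (vertex C Z (Suc -` U)) T'" using \<tau>_hom[OF W] by (simp only: strip)
      have factor: "Comp C (\<tau> ?W) (Z (Suc -` V) (Suc -` U)) = \<tau> V" if V: "V \<subset> U" for V
      proof -
        have V0: "V - {0} \<subset> U" using V by blast
        have "Comp C (\<tau> ?W) (Z (Suc -` V) (Suc -` U)) = Comp C (\<tau> ?W) (?Y (V - {0}) ?W)"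
          by (simp only: strip)
        also have "\<dots> = \<tau> (V - {0})"
          using cocone_Comp[OF \<tau>, of "V - {0}" ?W] V0 W V by (simp add: Diff_mono psubset_imp_subset)
        also have "\<dots> = Comp C (\<tau> V) (?Y (V - {0}) V)"
          using cocone_Comp[OF \<tau>, of "V - {0}" V] V0 V by simp
        also have "?Y (V - {0}) V = Id C (vertex C Z (Suc -` V))"
          using diagram_Id[OF Z] T[of V] V unfolding strip by blast
        also have "Comp C (\<tau> V) \<dots> = \<tau> V" by (rule Comp_Id_right[OF \<tau>_hom[OF V]])
        finally show ?thesis .
      qed
      have unique: "v = \<tau> ?W" if "v \<in> hom C (vertex C Z (Suc -` U)) T'"
        "\<forall>V\<in>{V. V \<subset> U}. Comp C v (Z (Suc -` V) (Suc -` U)) = \<tau> V" for v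
      proof -
        have "Comp C v (Z (Suc -` ?W) (Suc -` U)) = \<tau> ?W" using that(2) W by blast
        then have "Comp C v (Z (Suc -` U) (Suc -` U)) = \<tau> ?W" by (simp only: strip)
        then show ?thesis using Comp_Id_right[OF that(1)] id by simp
      qed
      show "\<exists>!v. v \<in> hom C (vertex C Z (Suc -` U)) T' \<and>
          (\<forall>V\<in>{V. V \<subset> U}. Comp C v (Z (Suc -` V) (Suc -` U)) = \<tau> V)"
        using \<tau>W factor by (intro ex1I[of _ "\<tau> ?W"]) (auto intro: unique)
    qed
    moreover have "Comp C (Id C (vertex C Z (Suc -` U))) (Z (Suc -` V) (Suc -` U)) = ?Y V U" if "V \<subset> U" for V
      using Comp_Id_left[OF arr] that by blast
    ultimately show ?thesis
      using Id_Cof[OF obj] Id_hom[OF obj]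
      by (intro exI[of _ "vertex C Z (Suc -` U)"] exI[of _ "\<lambda>V. Z (Suc -` V) (Suc -` U)"]
          bexI[of _ "Id C (vertex C Z (Suc -` U))"] conjI allI impI) (simp_all add: vertex)
  qed
qed

text \<open>Subsets without \<open>0\<close> carry the zero object and put no condition on a cocone.
  Those with \<open>0\<close> correspond to subsets of \<open>Suc -\<close>
  U\<open>, so for\<close>U\<open>containing\<close>0\<open>the latching map is that of the old cube at\<close>Suc
  -\<open>U\<close>.\<close>

lemma cofibration_cube_from_zero:
  assumes Z: "diagram C {V. V \<subseteq> {..<n}} (\<subseteq>) Z" and cube: "cofibration_cube C n Z"
    and Y_live: "\<And>V W. 0 \<in> V \<Longrightarrow> 0 \<in> W \<Longrightarrow> Y V W = Z (Suc -` V) (Suc -` W)"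
    and Y_zero: "\<And>V W. 0 \<notin> V \<Longrightarrow> 0 \<notin> W \<Longrightarrow> Y V W = Id C (Zero C)"
    and Y_mixed: "\<And>V W. 0 \<notin> V \<Longrightarrow> 0 \<in> W \<Longrightarrow> Y V W = zero_arrow C (Zero C) (vertex C Z (Suc -` W))"
  shows "cofibration_cube C (Suc n) Y"
  unfolding cofibration_cube_def
proof (intro allI impI)
  fix U assume U: "U \<subseteq> {..<Suc n}"
  have T: "Suc -` V \<subseteq> {..<n}" if "V \<subseteq> U" for V using that U by auto
  show "\<exists>L \<iota>. \<exists>u\<in>Cof C. is_colimit C {V. V \<subset> U} (\<subseteq>) Y L \<iota> \<and> u \<in> hom C L (vertex C Y U) \<and>
      (\<forall>V. V \<subset> U \<longrightarrow> Comp C u (\<iota> V) = Y V U)"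
  proof (cases "0 \<in> U")
    case False
    then show ?thesis by (intro zero_cofibration_cubeI) (auto intro!: Y_zero)
  next
    case True
    obtain L \<iota> u where u: "u \<in> Cof C" "is_colimit C {V. V \<subset> Suc -` U} (\<subseteq>) Z L \<iota>"
      "u \<in> hom C L (vertex C Z (Suc -` U))" "\<And>V. V \<subset> Suc -` U \<Longrightarrow> Comp C u (\<iota> V) = Z V (Suc -` U)"
      using cube T[OF order_refl] unfolding cofibration_cube_def by metis
    have L: "L \<in> Obj C" and U_obj: "vertex C Z (Suc -` U) \<in> Obj C" using hom_Obj[OF u(3)] by blast+
    \<comment> \<open>The old colimit cocone on the live face, extended by the only possible arrows
      from the zero face.\<close>
    define \<kappa> where "\<kappa> V = (if 0 \<in> V then \<iota> (Suc -` V) else zero_arrow C (Zero C) L)" for V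
    have vertex: "vertex C Y V = (if 0 \<in> V then vertex C Z (Suc -` V) else Zero C)" for V
      using Y_live[of V V] Y_zero[of V V] by (simp add: vertex_def Dom_Id_Zero)
    have V_eq: "V = insert 0 (Suc ` (Suc -` V))" if "0 \<in> V" for V
    proof (rule set_eqI)
      show "x \<in> V \<longleftrightarrow> x \<in> insert 0 (Suc ` (Suc -` V))" for x
        using that by (cases x) auto
    qed
    have strict: "Suc -` V \<subset> Suc -` U" if V: "V \<subset> U" "0 \<in> V" for V
    proof
      show "Suc -` V \<subseteq> Suc -` U" using V(1) by blast
      show "Suc -` V \<noteq> Suc -` U"
      proof
        assume "Suc -` V = Suc -` U"
        then have "V = U" using V_eq[OF V(2)] V_eq[OF True] by simp
        with V show False by blast
      qed
    qed
    have T_insert: "Suc -` insert 0 (Suc ` V) = V" for V by auto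
    have insert_strict: "insert 0 (Suc ` V) \<subset> U" if "V \<subset> Suc -` U" for V
      using that True T_insert[of V] by blast
    have \<iota>: "\<iota> V \<in> hom C (vertex C Z V) L" if "V \<subset> Suc -` U" for V
      using cocone_hom[OF colimit_cocone[OF u(2)]] that by blast
    have Y_from_zero: "Y V W \<in> hom C (Zero C) (vertex C Y W)" if "0 \<notin> V" "W \<subseteq> U" for V W
    proof (cases "0 \<in> W")
      case True
      have "vertex C Z (Suc -` W) \<in> Obj C" using diagram_Obj[OF Z] T[OF that(2)] by simp
      then show ?thesis using Y_mixed[OF that(1) True] True vertex zero_arrow_hom[OF Zero_Obj] by simp
    qed (simp add: Y_zero that vertex Id_Zero)
    have \<kappa>_hom: "\<kappa> V \<in> hom C (vertex C Y V) L" if "V \<subset> U" for V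
      using \<iota>[OF strict[OF that]] zero_arrow_hom[OF Zero_Obj L] by (simp add: \<kappa>_def vertex)
    have "is_colimit C {V. V \<subset> U} (\<subseteq>) Y L \<kappa>"
    proof (rule colimitI)
      have "Comp C (\<kappa> W) (Y V W) = \<kappa> V" if V: "V \<subset> U" and W: "W \<subset> U" and VW: "V \<subseteq> W" for V W
      proof (cases "0 \<in> V")
        case True
        with VW have "0 \<in> W" by blast
        then show ?thesis
          using True cocone_Comp[OF colimit_cocone[OF u(2)], of "Suc -` V" "Suc -` W"]
            strict[OF V] strict[OF W] vimage_mono[OF VW, of Suc] by (simp add: \<kappa>_def Y_live)
      next
        case False
        then have "\<kappa> V \<in> hom C (Zero C) L" using \<kappa>_hom[OF V] by (simp add: vertex)
        then show ?thesis
          using from_Zero_unique Comp_hom[OF Y_from_zero[OF False] \<kappa>_hom[OF W]] W by blast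
      qed
      then show "is_cocone C {V. V \<subset> U} (\<subseteq>) Y L \<kappa>"
        using L \<kappa>_hom by (intro coconeI) auto
      fix T' \<tau> assume \<tau>: "is_cocone C {V. V \<subset> U} (\<subseteq>) Y T' \<tau>"
      have T': "T' \<in> Obj C" and \<tau>_hom: "\<And>V. V \<subset> U \<Longrightarrow> \<tau> V \<in> hom C (vertex C Y V) T'"
        and \<tau>_comp: "\<And>V W. W \<subset> U \<Longrightarrow> V \<subseteq> W \<Longrightarrow> Comp C (\<tau> W) (Y V W) = \<tau> V"
        using cocone_Obj[OF \<tau>] cocone_hom[OF \<tau>] cocone_Comp[OF \<tau>] by auto
      let ?\<tau> = "\<lambda>V. \<tau> (insert 0 (Suc ` V))"
      have "is_cocone C {V. V \<subset> Suc -` U} (\<subseteq>) Z T' ?\<tau>"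
      proof (rule coconeI)
        show "?\<tau> V \<in> hom C (vertex C Z V) T'" if "V \<in> {V. V \<subset> Suc -` U}" for V
          using \<tau>_hom[OF insert_strict[of V]] that by (simp add: vertex T_insert)
        show "Comp C (?\<tau> W) (Z V W) = ?\<tau> V" if "V \<in> {V. V \<subset> Suc -` U}" "W \<in> {V. V \<subset> Suc -` U}" "V \<subseteq> W" for V W
          using \<tau>_comp[OF insert_strict[of W], of "insert 0 (Suc ` V)"] that Y_live[of "insert 0 (Suc ` V)" "insert 0 (Suc ` W)"]
          by (simp add: T_insert image_mono subset_insertI2)
      qed (rule T')
      then have "\<exists>!v. v \<in> hom C L T' \<and> (\<forall>V\<in>{V. V \<subset> Suc -` U}. Comp C v (\<iota> V) = ?\<tau> V)"
        by (rule colimit_factor[OF u(2)])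
      moreover have "v \<in> hom C L T' \<and> (\<forall>V\<in>{V. V \<subset> Suc -` U}. Comp C v (\<iota> V) = ?\<tau> V) \<longleftrightarrow>
          v \<in> hom C L T' \<and> (\<forall>V\<in>{V. V \<subset> U}. Comp C v (\<kappa> V) = \<tau> V)" for v
      proof (rule conj_cong[OF refl], intro iffI ballI)
        fix V assume v: "v \<in> hom C L T'" and *: "\<forall>V\<in>{V. V \<subset> Suc -` U}. Comp C v (\<iota> V) = ?\<tau> V"
          and "V \<in> {V. V \<subset> U}"
        then have V: "V \<subset> U" by simp
        show "Comp C v (\<kappa> V) = \<tau> V"
        proof (cases "0 \<in> V")
          case True
          then show ?thesis using * strict[OF V True] V_eq[OF True] by (simp add: \<kappa>_def)
        next
          case False
          then show ?thesis
            using from_Zero_unique Comp_hom[OF \<kappa>_hom[OF V] v] \<tau>_hom[OF V] by (simp add: vertex)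
        qed
      next
        fix V assume *: "\<forall>V\<in>{V. V \<subset> U}. Comp C v (\<kappa> V) = \<tau> V" and "V \<in> {V. V \<subset> Suc -` U}"
        then have "Comp C v (\<kappa> (insert 0 (Suc ` V))) = ?\<tau> V" using insert_strict by blast
        then show "Comp C v (\<iota> V) = ?\<tau> V" by (simp add: \<kappa>_def T_insert)
      qed
      ultimately show "\<exists>!v. v \<in> hom C L T' \<and> (\<forall>V\<in>{V. V \<subset> U}. Comp C v (\<kappa> V) = \<tau> V)" by simp
    qed
    moreover have uU: "u \<in> hom C L (vertex C Y U)" using u(3) True by (simp add: vertex)
    moreover have "Comp C u (\<kappa> V) = Y V U" if V: "V \<subset> U" for V
    proof (cases "0 \<in> V")
      case True
      then show ?thesis using u(4)[OF strict[OF V True]] \<open>0 \<in> U\<close> by (simp add: \<kappa>_def Y_live)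
    next
      case False
      then show ?thesis
        using from_Zero_unique[OF _ Y_from_zero[OF False order_refl]] Comp_hom[OF \<kappa>_hom[OF V] uU] by (simp add: vertex)
    qed
    ultimately show ?thesis
      using u(1) by (intro exI[of _ L] exI[of _ \<kappa>] bexI[of _ u] conjI allI impI) simp_all
  qed
qed

end

section \<open>Simplices of the K-theory spectrum\<close>

lemma index_le_refl [simp]: "index_le x x"
  by (simp add: index_le_def list.rel_refl)

lemma indices_update:
  "(s, p) \<in> indices n k \<Longrightarrow> a \<le> b \<Longrightarrow> b \<le> k \<Longrightarrow> (s, p[c := (a, b)]) \<in> indices n k"
  using set_update_subset_insert[of p c "(a, b)"] by (auto simp: indices_def)

lemma indices_nth:
  "(s, p) \<in> indices n k \<Longrightarrow> c < n \<Longrightarrow> p ! c = (i, j) \<Longrightarrow> i \<le> j \<and> j \<le> k"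
  using nth_mem[of c p] by (auto simp: indices_def)

lemma index_le_update:
  assumes "a \<le> a'" "b \<le> b'"
  shows "index_le (s, p[c := (a, b)]) (s, p[c := (a', b')])"
  using assms by (simp add: index_le_def list_all2_update_cong list.rel_refl)

lemma length_corner [simp]: "length (corner p q V) = length p"
  by (simp add: corner_def)

lemma nth_corner [simp]: "c < length p \<Longrightarrow> corner p q V ! c = (if c \<in> V then q ! c else p ! c)"
  by (simp add: corner_def)

lemma corner_in_indices:
  assumes "(s, p) \<in> indices n k" "(s, q) \<in> indices n k"
  shows "(s, corner p q V) \<in> indices n k"
proof -
  have "length p = length q" using assms by (simp add: indices_def)
  then have sub: "set (corner p q V) \<subseteq> set p \<union> set q" by (auto simp: corner_def)
  have "\<forall>x\<in>set p \<union> set q. case x of (i, j) \<Rightarrow> i \<le> j \<and> j \<le> k"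
    using assms by (simp add: indices_def ball_Un)
  then have "\<forall>x\<in>set (corner p q V). case x of (i, j) \<Rightarrow> i \<le> j \<and> j \<le> k"
    using sub by blast
  then show ?thesis using assms by (simp add: indices_def)
qed

lemma corner_le:
  assumes "index_le (s, p) (s, q)" "V \<subseteq> W"
  shows "index_le (s, corner p q V) (s, corner p q W)"
  using assms by (auto simp: index_le_def list_all2_conv_all_nth)

text \<open>Splits off direction \<open>0\<close>, where the structure map inserts its new
  coordinate; the preimage under \<open>Suc\<close> matches the convention of the cube
  lemmas.\<close>

lemma corner_Cons: "corner (a # p) (b # q) V = (if 0 \<in> V then b else a) # corner p q (Suc -` V)"
  unfolding corner_def by (simp add: upt_conv_Cons map_Suc_upt[symmetric] del: upt_Suc)

lemma corner_map:
  "length p = length q \<Longrightarrow> map f (corner p q V) = corner (map f p) (map f q) V"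
  by (simp add: list_eq_iff_nth_eq)

lemma corner_empty: "corner p q {} = p"
  by (simp add: list_eq_iff_nth_eq)

lemma corner_update: "c < length p \<Longrightarrow> corner p (p[c := a]) {c} = p[c := a]"
  by (simp add: list_eq_iff_nth_eq nth_list_update)

lemma index_restrict_cong:
  assumes "\<And>x y. x \<in> indices n k \<Longrightarrow> y \<in> indices n k \<Longrightarrow> index_le x y \<Longrightarrow> X x y = Y x y"
  shows "index_restrict n k X = index_restrict n k Y"
  using assms by (auto simp: index_restrict_def fun_eq_iff)

lemma index_restrict_apply [simp]:
  "x \<in> indices n k \<Longrightarrow> y \<in> indices n k \<Longrightarrow> index_le x y \<Longrightarrow> index_restrict n k X x y = X x y"
  by (simp add: index_restrict_def)

lemma index_restrict_idem [simp]: "index_restrict n k (index_restrict n k X) = index_restrict n k X"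
  by (rule index_restrict_cong) simp

text \<open>The conditions on a simplex without the normalisation off the index poset; they only depend
  on the values there, so that \<open>index_restrict\<close> can be ignored in checking them.\<close>

definition wS_diagram :: "('o, 'a) wcat \<Rightarrow> nat \<Rightarrow> nat \<Rightarrow> (index \<Rightarrow> index \<Rightarrow> 'a) \<Rightarrow> bool" where
  "wS_diagram C n k X \<longleftrightarrow>
     diagram C (indices n k) index_le X \<and>
     (\<forall>(s, p) \<in> indices n k. (\<exists>(i, j) \<in> set p. i = j) \<longrightarrow> vertex C X (s, p) = Zero C) \<and>
     (\<forall>s p q. (s, p) \<in> indices n k \<longrightarrow> (s, q) \<in> indices n k \<longrightarrow> index_le (s, p) (s, q) \<longrightarrow>
        map fst p = map fst q \<longrightarrow>
        cofibration_cube C n (\<lambda>V W. X (s, corner p q V) (s, corner p q W))) \<and>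
     (\<forall>s p c i j l. (s, p) \<in> indices n k \<longrightarrow> c < n \<longrightarrow> p ! c = (i, j) \<longrightarrow> j \<le> l \<longrightarrow> l \<le> k \<longrightarrow>
        is_pushout C
          (X (s, p) (s, p[c := (i, l)])) (X (s, p) (s, p[c := (j, j)]))
          (X (s, p[c := (i, l)]) (s, p[c := (j, l)])) (X (s, p[c := (j, j)]) (s, p[c := (j, l)]))) \<and>
     (\<forall>s t p. (s, p) \<in> indices n k \<longrightarrow> (t, p) \<in> indices n k \<longrightarrow> s \<le> t \<longrightarrow>
        X (s, p) (t, p) \<in> Weq C)"

lemma wS_simplices_iff: "X \<in> wS_simplices C n k \<longleftrightarrow> index_restrict n k X = X \<and> wS_diagram C n k X"
  by (simp add: wS_simplices_def wS_diagram_def)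

lemma wS_diagramI:
  assumes "diagram C (indices n k) index_le X"
    and "\<And>s p i. (s, p) \<in> indices n k \<Longrightarrow> (i, i) \<in> set p \<Longrightarrow> vertex C X (s, p) = Zero C"
    and "\<And>s p q. (s, p) \<in> indices n k \<Longrightarrow> (s, q) \<in> indices n k \<Longrightarrow> index_le (s, p) (s, q) \<Longrightarrow>
        map fst p = map fst q \<Longrightarrow> cofibration_cube C n (\<lambda>V W. X (s, corner p q V) (s, corner p q W))"
    and "\<And>s p c i j l. (s, p) \<in> indices n k \<Longrightarrow> c < n \<Longrightarrow> p ! c = (i, j) \<Longrightarrow> j \<le> l \<Longrightarrow> l \<le> k \<Longrightarrow>
        is_pushout C
          (X (s, p) (s, p[c := (i, l)])) (X (s, p) (s, p[c := (j, j)]))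
          (X (s, p[c := (i, l)]) (s, p[c := (j, l)])) (X (s, p[c := (j, j)]) (s, p[c := (j, l)]))"
    and "\<And>s t p. (s, p) \<in> indices n k \<Longrightarrow> (t, p) \<in> indices n k \<Longrightarrow> s \<le> t \<Longrightarrow> X (s, p) (t, p) \<in> Weq C"
  shows "wS_diagram C n k X"
  unfolding wS_diagram_def using assms by (intro conjI) auto

context
  fixes C :: "('o, 'a) wcat" and n k :: nat and X :: "index \<Rightarrow> index \<Rightarrow> 'a"
  assumes X: "wS_diagram C n k X"
begin

lemma wS_diagram: "diagram C (indices n k) index_le X"
  using X by (simp add: wS_diagram_def)

lemma wS_zero: "(s, p) \<in> indices n k \<Longrightarrow> (i, i) \<in> set p \<Longrightarrow> vertex C X (s, p) = Zero C"
  using X unfolding wS_diagram_def by fastforce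

lemma wS_cube:
  "(s, p) \<in> indices n k \<Longrightarrow> (s, q) \<in> indices n k \<Longrightarrow> index_le (s, p) (s, q) \<Longrightarrow>
    map fst p = map fst q \<Longrightarrow> cofibration_cube C n (\<lambda>V W. X (s, corner p q V) (s, corner p q W))"
  using X by (simp add: wS_diagram_def)

lemma wS_pushout:
  "(s, p) \<in> indices n k \<Longrightarrow> c < n \<Longrightarrow> p ! c = (i, j) \<Longrightarrow> j \<le> l \<Longrightarrow> l \<le> k \<Longrightarrow>
    is_pushout C
      (X (s, p) (s, p[c := (i, l)])) (X (s, p) (s, p[c := (j, j)]))
      (X (s, p[c := (i, l)]) (s, p[c := (j, l)])) (X (s, p[c := (j, j)]) (s, p[c := (j, l)]))"
  using X by (simp add: wS_diagram_def)

lemma wS_Weq: "(s, p) \<in> indices n k \<Longrightarrow> (t, p) \<in> indices n k \<Longrightarrow> s \<le> t \<Longrightarrow> X (s, p) (t, p) \<in> Weq C"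
  using X by (simp add: wS_diagram_def)

lemma wS_cube_diagram:
  assumes "(s, p) \<in> indices n k" "(s, q) \<in> indices n k" "index_le (s, p) (s, q)"
  shows "diagram C {V. V \<subseteq> {..<n}} (\<subseteq>) (\<lambda>V W. X (s, corner p q V) (s, corner p q W))"
  using corner_in_indices[OF assms(1,2)] corner_le[OF assms(3)]
    diagram_Obj[OF wS_diagram] diagram_Id[OF wS_diagram] diagram_hom[OF wS_diagram] diagram_Comp[OF wS_diagram]
  unfolding diagram_def vertex_def by auto

end

lemma diagram_cong:
  assumes "diagram C J le X" and "\<And>p q. p \<in> J \<Longrightarrow> q \<in> J \<Longrightarrow> le p q \<Longrightarrow> X p q = Y p q"
    and "\<And>p. p \<in> J \<Longrightarrow> le p p" and "\<And>p q r. le p q \<Longrightarrow> le q r \<Longrightarrow> le p r"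
  shows "diagram C J le Y"
proof -
  have vertex: "vertex C Y p = vertex C X p" if "p \<in> J" for p
    using assms(2)[OF that that assms(3)[OF that]] by (simp add: vertex_def)
  show ?thesis
    unfolding diagram_def
  proof (intro conjI ballI impI)
    fix p assume p: "p \<in> J"
    show "vertex C Y p \<in> Obj C" "Y p p = Id C (vertex C Y p)"
      using diagram_Obj[OF assms(1) p] diagram_Id[OF assms(1) p] assms(2)[OF p p assms(3)[OF p]]
      by (simp_all add: vertex[OF p])
    fix q assume q: "q \<in> J" and pq: "le p q"
    show "Y p q \<in> hom C (vertex C Y p) (vertex C Y q)"
      using diagram_hom[OF assms(1) p q pq] assms(2)[OF p q pq] by (simp add: vertex p q)
    fix r assume r: "r \<in> J" and qr: "le q r"
    show "Y p r = Comp C (Y q r) (Y p q)"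
      using diagram_Comp[OF assms(1) p q r pq qr] assms(2)[OF p q pq] assms(2)[OF q r qr]
        assms(2)[OF p r assms(4)[OF pq qr]] by simp
  qed
qed

lemma index_le_trans: "index_le x y \<Longrightarrow> index_le y z \<Longrightarrow> index_le x z"
  unfolding index_le_def list_all2_conv_all_nth by fastforce

text \<open>The four edges of the cofibre sequence square. The inequality \<open>i \<le> j\<close>
  comes from membership in \<open>indices\<close>.\<close>

lemma index_le_components:
  assumes "(s, p) \<in> indices n k" "c < n" "p ! c = (i, j)" "j \<le> l"
  shows "index_le (s, p) (s, p[c := (i, l)])" "index_le (s, p) (s, p[c := (j, j)])"
    "index_le (s, p[c := (i, l)]) (s, p[c := (j, l)])" "index_le (s, p[c := (j, j)]) (s, p[c := (j, l)])"
proof -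
  have p: "p = p[c := (i, j)]" using assms(3) by (metis list_update_id)
  have ij: "i \<le> j" using indices_nth[OF assms(1-3)] by blast
  show "index_le (s, p) (s, p[c := (i, l)])" "index_le (s, p) (s, p[c := (j, j)])"
    using index_le_update[of i i j l s p c] index_le_update[of i j j j s p c] ij assms(4) p by simp_all
  show "index_le (s, p[c := (i, l)]) (s, p[c := (j, l)])" "index_le (s, p[c := (j, j)]) (s, p[c := (j, l)])"
    using ij assms(4) by (simp_all add: index_le_update)
qed

lemma cofibration_cube_cong:
  assumes "cofibration_cube C n Y" and "\<And>V W. V \<subseteq> W \<Longrightarrow> Y V W = Y' V W"
  shows "cofibration_cube C n Y'"
proof -
  have "is_colimit C {V. V \<subset> U} (\<subseteq>) Y' L \<iota> = is_colimit C {V. V \<subset> U} (\<subseteq>) Y L \<iota>" for U L \<iota>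
    by (rule is_colimit_cong) (use assms(2) in auto)
  moreover have "vertex C Y' U = vertex C Y U" for U by (simp add: vertex_def assms(2))
  moreover have "Y' V U = Y V U" if "V \<subset> U" for V U using assms(2) that by auto
  ultimately show ?thesis
    using assms(1) unfolding cofibration_cube_def by (simp cong: conj_cong)
qed

lemma wS_diagram_cong:
  assumes X: "wS_diagram C n k X"
    and eq: "\<And>x y. x \<in> indices n k \<Longrightarrow> y \<in> indices n k \<Longrightarrow> index_le x y \<Longrightarrow> X x y = Y x y"
  shows "wS_diagram C n k Y"
proof (rule wS_diagramI)
  show "diagram C (indices n k) index_le Y"
    by (rule diagram_cong[OF wS_diagram[OF X] eq]) (auto intro: index_le_trans)
  show "vertex C Y (s, p) = Zero C" if "(s, p) \<in> indices n k" "(i, i) \<in> set p" for s p i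
    using wS_zero[OF X that] eq[OF that(1) that(1)] by (simp add: vertex_def)
  show "cofibration_cube C n (\<lambda>V W. Y (s, corner p q V) (s, corner p q W))"
    if "(s, p) \<in> indices n k" "(s, q) \<in> indices n k" "index_le (s, p) (s, q)" "map fst p = map fst q" for s p q
    by (rule cofibration_cube_cong[OF wS_cube[OF X that]])
      (intro eq corner_in_indices corner_le that; assumption)
  show "is_pushout C
      (Y (s, p) (s, p[c := (i, l)])) (Y (s, p) (s, p[c := (j, j)]))
      (Y (s, p[c := (i, l)]) (s, p[c := (j, l)])) (Y (s, p[c := (j, j)]) (s, p[c := (j, l)]))"
    if "(s, p) \<in> indices n k" "c < n" "p ! c = (i, j)" "j \<le> l" "l \<le> k" for s p c i j l
    using wS_pushout[OF X that] index_le_components[OF that(1-4)] indices_update[OF that(1)]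
      indices_nth[OF that(1-3)] that by (simp add: eq)
  show "Y (s, p) (t, p) \<in> Weq C" if "(s, p) \<in> indices n k" "(t, p) \<in> indices n k" "s \<le> t" for s t p
  proof -
    have "index_le (s, p) (t, p)" using that(3) by (simp add: index_le_def list.rel_refl)
    then show ?thesis using wS_Weq[OF X that] eq[OF that(1,2)] by simp
  qed
qed

lemma index_restrict_in_wS_simplices: "wS_diagram C n k X \<Longrightarrow> index_restrict n k X \<in> wS_simplices C n k"
  by (auto simp: wS_simplices_iff elim: wS_diagram_cong)

section \<open>Simplicial operators on diagrams\<close>

lemma simplex_op_le: "simplex_op l k \<theta> \<Longrightarrow> i \<le> l \<Longrightarrow> \<theta> i \<le> k"
  by (auto simp: simplex_op_def)

lemma simplex_op_mono: "simplex_op l k \<theta> \<Longrightarrow> i \<le> j \<Longrightarrow> j \<le> l \<Longrightarrow> \<theta> i \<le> \<theta> j"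
  by (auto simp: simplex_op_def monotone_on_def)

lemma reindex_Pair: "reindex \<theta> (s, p) = (\<theta> s, map (map_prod \<theta> \<theta>) p)"
  by (simp add: reindex_def)

lemma reindex_in_indices:
  assumes \<theta>: "simplex_op l k \<theta>" and x: "x \<in> indices n l"
  shows "reindex \<theta> x \<in> indices n k"
proof -
  obtain s p where sp: "x = (s, p)" "s \<le> l" "length p = n" by (cases x) (use x in \<open>auto simp: indices_def\<close>)
  have "\<theta> i \<le> \<theta> j \<and> \<theta> j \<le> k" if "(i, j) \<in> set p" for i j
  proof -
    have "i \<le> j" "j \<le> l" using x that by (auto simp: sp indices_def)
    then show ?thesis using simplex_op_mono[OF \<theta>] simplex_op_le[OF \<theta>] by blast
  qed
  then show ?thesis
    using simplex_op_le[OF \<theta> sp(2)] sp by (auto simp: reindex_Pair indices_def)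
qed

lemma reindex_le:
  assumes \<theta>: "simplex_op l k \<theta>" and xy: "x \<in> indices n l" "y \<in> indices n l" "index_le x y"
  shows "index_le (reindex \<theta> x) (reindex \<theta> y)"
proof -
  have "snd (snd y ! c) \<le> l \<and> fst (snd y ! c) \<le> l" if "c < length (snd y)" for c
    using xy(2) that indices_nth[of "fst y" "snd y" n l c "fst (snd y ! c)" "snd (snd y ! c)"]
    by (auto simp: indices_def)
  moreover have "fst y \<le> l" using xy(2) by (auto simp: indices_def)
  ultimately show ?thesis
    using xy(3) by (auto simp: index_le_def reindex_def list_all2_conv_all_nth intro!: simplex_op_mono[OF \<theta>])
qed

lemma reindex_comp: "reindex (\<theta> \<circ> \<eta>) x = reindex \<theta> (reindex \<eta> x)"
  by (simp add: reindex_def prod.map_comp o_def)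

lemma reindex_id: "reindex id x = x"
  by (simp add: reindex_def prod.map_id0)

lemma reindex_cong: "x \<in> indices n l \<Longrightarrow> (\<And>i. i \<le> l \<Longrightarrow> \<theta> i = \<theta>' i) \<Longrightarrow> reindex \<theta> x = reindex \<theta>' x"
  by (fastforce simp: indices_def reindex_def)

text \<open>A monotone \<theta> maps the index posets monotonically, sends degenerate coordinates
  \<open>(i, i)\<close> to degenerate ones, and commutes with corners and coordinate updates. Each
  condition is thus an instance of the same condition for \<open>X\<close>.\<close>

lemma wS_diagram_reindex:
  assumes \<theta>: "simplex_op l k \<theta>" and X: "wS_diagram C n k X"
  shows "wS_diagram C n l (\<lambda>x y. X (reindex \<theta> x) (reindex \<theta> y))"
proof (rule wS_diagramI)
  let ?Y = "\<lambda>x y. X (reindex \<theta> x) (reindex \<theta> y)"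
  note ind = reindex_in_indices[OF \<theta>] and le = reindex_le[OF \<theta>]
  have vertex: "vertex C ?Y x = vertex C X (reindex \<theta> x)" for x by (simp add: vertex_def)
  have ind_Pair: "(\<theta> s, map (map_prod \<theta> \<theta>) p) \<in> indices n k" if "(s, p) \<in> indices n l" for s p
    using ind[OF that] by (simp add: reindex_Pair)
  note D = wS_diagram[OF X]
  show "diagram C (indices n l) index_le ?Y"
    unfolding diagram_def vertex
    using ind le diagram_Obj[OF D] diagram_Id[OF D] diagram_hom[OF D] diagram_Comp[OF D] by simp
  show "vertex C ?Y (s, p) = Zero C" if "(s, p) \<in> indices n l" "(i, i) \<in> set p" for s p i
  proof -
    have "(\<theta> i, \<theta> i) \<in> set (map (map_prod \<theta> \<theta>) p)" using that(2) by force
    then show ?thesis using wS_zero[OF X ind_Pair[OF that(1)]] unfolding vertex reindex_Pair by blast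
  qed
  show "cofibration_cube C n (\<lambda>V W. ?Y (s, corner p q V) (s, corner p q W))"
    if pq: "(s, p) \<in> indices n l" "(s, q) \<in> indices n l" "index_le (s, p) (s, q)" "map fst p = map fst q" for s p q
  proof -
    have "map fst (map (map_prod \<theta> \<theta>) p) = map \<theta> (map fst p)" for p :: "(nat \<times> nat) list" by simp
    then have "map fst (map (map_prod \<theta> \<theta>) p) = map fst (map (map_prod \<theta> \<theta>) q)" using pq(4) by metis
    moreover have "length p = length q" using pq by (simp add: indices_def)
    ultimately show ?thesis
      using wS_cube[OF X ind_Pair[OF pq(1)] ind_Pair[OF pq(2)]] le[OF pq(1-3)]
      by (simp add: reindex_Pair corner_map)
  qed
  show "is_pushout C
      (?Y (s, p) (s, p[c := (i, j')])) (?Y (s, p) (s, p[c := (j, j)]))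
      (?Y (s, p[c := (i, j')]) (s, p[c := (j, j')])) (?Y (s, p[c := (j, j)]) (s, p[c := (j, j')]))"
    if "(s, p) \<in> indices n l" "c < n" "p ! c = (i, j)" "j \<le> j'" "j' \<le> l" for s p c i j j'
  proof -
    have "length p = n" using that by (simp add: indices_def)
    then show ?thesis
      using wS_pushout[OF X ind_Pair[OF that(1)] that(2), of "\<theta> i" "\<theta> j" "\<theta> j'"] that
        simplex_op_mono[OF \<theta> that(4,5)] simplex_op_le[OF \<theta> that(5)]
      by (simp add: reindex_Pair map_update)
  qed
  show "?Y (s, p) (t, p) \<in> Weq C" if "(s, p) \<in> indices n l" "(t, p) \<in> indices n l" "s \<le> t" for s t p
  proof -
    have "\<theta> s \<le> \<theta> t" using that by (intro simplex_op_mono[OF \<theta>]) (auto simp: indices_def)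
    then show ?thesis using wS_Weq[OF X ind_Pair[OF that(1)] ind_Pair[OF that(2)]] by (simp add: reindex_Pair)
  qed
qed

section \<open>The structure maps: trivial pushouts and the diagram of a suspended simplex\<close>

context category
begin

lemma pushout_Id_right:
  assumes f: "f \<in> hom C x y"
  shows "is_pushout C f (Id C x) (Id C y) f"
proof -
  have id: "Id C x \<in> hom C x x" "Id C y \<in> hom C y y" using hom_Obj[OF f] Id_hom by blast+
  have Id: "Dom C (Id C x) = x" "Cod C (Id C x) = x" "Id C x \<in> Arr C" and fD: "Dom C f = x" "Cod C f = y" "f \<in> Arr C"
    using id f by (simp_all add: hom_def)
  show ?thesis
    unfolding is_pushout_def Id fD
  proof (intro conjI exI[of _ y] allI ballI impI)
    show "Comp C (Id C y) f = Comp C f (Id C x)" by (simp add: Comp_Id_left[OF f] Comp_Id_right[OF f])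
    fix T h k assume h: "h \<in> hom C y T" and k: "k \<in> hom C x T" and eq: "Comp C h f = Comp C k (Id C x)"
    show "\<exists>!u. u \<in> hom C y T \<and> Comp C u (Id C y) = h \<and> Comp C u f = k"
    proof (rule ex1I[of _ h])
      show "h \<in> hom C y T \<and> Comp C h (Id C y) = h \<and> Comp C h f = k"
        using h eq Comp_Id_right[OF k] Comp_Id_right[OF h] by simp
      show "u = h" if "u \<in> hom C y T \<and> Comp C u (Id C y) = h \<and> Comp C u f = k" for u
        using that Comp_Id_right[of u y T] by simp
    qed
  qed (use f id Id(3) fD(3) in simp_all)
qed

lemma pushout_Id_left:
  assumes g: "g \<in> hom C x y"
  shows "is_pushout C (Id C x) g g (Id C y)"
proof -
  have id: "Id C x \<in> hom C x x" "Id C y \<in> hom C y y" using hom_Obj[OF g] Id_hom by blast+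
  have Id: "Dom C (Id C x) = x" "Cod C (Id C x) = x" "Id C x \<in> Arr C" and gD: "Dom C g = x" "Cod C g = y" "g \<in> Arr C"
    using id g by (simp_all add: hom_def)
  show ?thesis
    unfolding is_pushout_def Id gD
  proof (intro conjI exI[of _ y] allI ballI impI)
    show "Comp C g (Id C x) = Comp C (Id C y) g" by (simp add: Comp_Id_left[OF g] Comp_Id_right[OF g])
    fix T h k assume h: "h \<in> hom C x T" and k: "k \<in> hom C y T" and eq: "Comp C h (Id C x) = Comp C k g"
    show "\<exists>!u. u \<in> hom C y T \<and> Comp C u g = h \<and> Comp C u (Id C y) = k"
    proof (rule ex1I[of _ k])
      show "k \<in> hom C y T \<and> Comp C k g = h \<and> Comp C k (Id C y) = k"
        using k eq Comp_Id_right[OF h] Comp_Id_right[OF k] by simp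
      show "u = k" if "u \<in> hom C y T \<and> Comp C u g = h \<and> Comp C u (Id C y) = k" for u
        using that Comp_Id_right[of u y T] by simp
    qed
  qed (use g id Id(3) gD(3) in simp_all)
qed

end

text \<open>A global counterpart of the local binding in \<open>K_bond\<close>: \<sigma> carries the
  first coordinate, an arrow of \<open>[k]\<close>, to the nondegenerate arrow of
  \<open>[1]\<close>.\<close>

definition bond_live :: "(nat \<Rightarrow> nat) \<Rightarrow> index \<Rightarrow> bool" where
  "bond_live \<sigma> x \<longleftrightarrow> \<sigma> (fst (hd (snd x))) = 0 \<and> \<sigma> (snd (hd (snd x))) = 1"

definition bond_vertex :: "('o, 'a) wcat \<Rightarrow> (nat \<Rightarrow> nat) \<Rightarrow> (index \<Rightarrow> index \<Rightarrow> 'a) \<Rightarrow> index \<Rightarrow> 'o" where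
  "bond_vertex C \<sigma> X x = (if bond_live \<sigma> x then vertex C X (fst x, tl (snd x)) else Zero C)"

definition bond_diagram :: "('o, 'a) wcat \<Rightarrow> (nat \<Rightarrow> nat) \<Rightarrow> (index \<Rightarrow> index \<Rightarrow> 'a) \<Rightarrow> index \<Rightarrow> index \<Rightarrow> 'a" where
  "bond_diagram C \<sigma> X x y =
    (if bond_live \<sigma> x \<and> bond_live \<sigma> y then X (fst x, tl (snd x)) (fst y, tl (snd y))
     else zero_arrow C (bond_vertex C \<sigma> X x) (bond_vertex C \<sigma> X y))"

lemma K_bond_eq: "K_bond C n k \<sigma> X = index_restrict (Suc n) k (bond_diagram C \<sigma> X)"
  unfolding K_bond_def Let_def
  by (rule index_restrict_cong) (simp add: bond_live_def bond_vertex_def bond_diagram_def)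

lemma bond_live_Cons [simp]: "bond_live \<sigma> (s, (i, j) # p) \<longleftrightarrow> \<sigma> i = 0 \<and> \<sigma> j = 1"
  by (simp add: bond_live_def)

lemma indices_Cons_iff: "(s, (i, j) # p) \<in> indices (Suc n) k \<longleftrightarrow> i \<le> j \<and> j \<le> k \<and> (s, p) \<in> indices n k"
  by (auto simp: indices_def)

lemma index_le_Cons_iff:
  "index_le (s, (i, j) # p) (t, (i', j') # q) \<longleftrightarrow> i \<le> i' \<and> j \<le> j' \<and> index_le (s, p) (t, q)"
  by (auto simp: index_le_def)

lemma indices_SucE:
  assumes "x \<in> indices (Suc n) k"
  obtains s i j p where "x = (s, (i, j) # p)" "i \<le> j" "j \<le> k" "(s, p) \<in> indices n k"
proof -
  obtain s q where q: "x = (s, q)" by (cases x)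
  then obtain a p where "q = a # p" using assms by (cases q) (auto simp: indices_def)
  then show ?thesis
    using that assms q by (cases a) (auto simp: indices_Cons_iff)
qed

context waldhausen_category
begin

lemma wS_diagram_zero: "wS_diagram C n k (\<lambda>_ _. Id C (Zero C))"
  by (rule wS_diagramI)
    (auto simp: diagram_def vertex_def Dom_Id_Zero Zero_Obj Id_Zero Comp_Id_Zero cofibration_cube_zero
      pushout_Id_right[OF Id_Zero] Id_Weq)

lemma bond_vertex_Obj:
  assumes X: "wS_diagram C n k X" and x: "x \<in> indices (Suc n) k"
  shows "bond_vertex C \<sigma> X x \<in> Obj C"
  using x diagram_Obj[OF wS_diagram[OF X]] Zero_Obj by (elim indices_SucE) (simp add: bond_vertex_def)

lemma bond_diagram_hom:
  assumes X: "wS_diagram C n k X" and xy: "x \<in> indices (Suc n) k" "y \<in> indices (Suc n) k" "index_le x y"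
  shows "bond_diagram C \<sigma> X x y \<in> hom C (bond_vertex C \<sigma> X x) (bond_vertex C \<sigma> X y)"
proof (cases "bond_live \<sigma> x \<and> bond_live \<sigma> y")
  case True
  then show ?thesis
    using xy diagram_hom[OF wS_diagram[OF X]]
    by (elim indices_SucE) (simp add: bond_diagram_def bond_vertex_def index_le_Cons_iff)
next
  case False
  then show ?thesis
    using zero_arrow_hom bond_vertex_Obj[OF X] xy by (auto simp: bond_diagram_def)
qed

lemma vertex_bond_diagram:
  assumes X: "wS_diagram C n k X" and x: "x \<in> indices (Suc n) k"
  shows "vertex C (bond_diagram C \<sigma> X) x = bond_vertex C \<sigma> X x"
  using bond_diagram_hom[OF X x x] by (simp add: vertex_def hom_def)

text \<open>Monotonicity of \<sigma> squeezes the two values at \<open>y\<close> between those at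
  \<open>x\<close> and \<open>z\<close>. Hence an arrow between live indices never factors through
  an index whose vertex was replaced by zero.\<close>

lemma bond_live_convex:
  assumes \<sigma>: "simplex_op k 1 \<sigma>" and "x \<in> indices (Suc n) k" "y \<in> indices (Suc n) k" "z \<in> indices (Suc n) k"
    and "index_le x y" "index_le y z" "bond_live \<sigma> x" "bond_live \<sigma> z"
  shows "bond_live \<sigma> y"
proof -
  obtain s i j p where x: "x = (s, (i, j) # p)" "i \<le> j" "j \<le> k" using assms(2) by (elim indices_SucE)
  obtain t i' j' q where y: "y = (t, (i', j') # q)" "i' \<le> j'" "j' \<le> k" using assms(3) by (elim indices_SucE)
  obtain r i'' j'' w where z: "z = (r, (i'', j'') # w)" "i'' \<le> j''" "j'' \<le> k" using assms(4) by (elim indices_SucE)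
  have "\<sigma> i' \<le> \<sigma> i''" "\<sigma> j \<le> \<sigma> j'" "\<sigma> j' \<le> 1"
    using assms(5,6) x y z simplex_op_mono[OF \<sigma>] simplex_op_le[OF \<sigma>] by (auto simp: index_le_Cons_iff)
  then show ?thesis using assms(7,8) x y z by simp
qed

lemma bond_diagram_diagram:
  assumes \<sigma>: "simplex_op k 1 \<sigma>" and X: "wS_diagram C n k X"
  shows "diagram C (indices (Suc n) k) index_le (bond_diagram C \<sigma> X)"
proof -
  let ?B = "bond_diagram C \<sigma> X"
  have Id: "?B x x = Id C (bond_vertex C \<sigma> X x)" if "x \<in> indices (Suc n) k" for x
    using that diagram_Id[OF wS_diagram[OF X]]
    by (elim indices_SucE) (simp add: bond_diagram_def bond_vertex_def zero_arrow_Zero)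
  have Comp: "?B x z = Comp C (?B y z) (?B x y)"
    if xyz: "x \<in> indices (Suc n) k" "y \<in> indices (Suc n) k" "z \<in> indices (Suc n) k"
      and le: "index_le x y" "index_le y z" for x y z
  proof (cases "bond_live \<sigma> x \<and> bond_live \<sigma> z")
    case True
    then have live: "bond_live \<sigma> x" "bond_live \<sigma> y" "bond_live \<sigma> z"
      using bond_live_convex[OF \<sigma> xyz le] by blast+
    have "index_le (fst x, tl (snd x)) (fst y, tl (snd y))" "index_le (fst y, tl (snd y)) (fst z, tl (snd z))"
      "(fst x, tl (snd x)) \<in> indices n k" "(fst y, tl (snd y)) \<in> indices n k" "(fst z, tl (snd z)) \<in> indices n k"
      using xyz le by (auto elim!: indices_SucE simp: index_le_Cons_iff)
    then show ?thesis
      using live diagram_Comp[OF wS_diagram[OF X]] by (simp add: bond_diagram_def)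
  next
    \<comment> \<open>One factor of the composite is already a zero arrow: the second if
      \<open>x\<close> is live, since then \<open>z\<close> is not, and the first otherwise.\<close>
    case False
    then have xz: "?B x z = zero_arrow C (bond_vertex C \<sigma> X x) (bond_vertex C \<sigma> X z)"
      by (auto simp: bond_diagram_def)
    show ?thesis
    proof (cases "bond_live \<sigma> x")
      case True
      with False have "?B y z = zero_arrow C (bond_vertex C \<sigma> X y) (bond_vertex C \<sigma> X z)"
        by (auto simp: bond_diagram_def)
      then show ?thesis
        using zero_arrow_Comp(2)[OF bond_diagram_hom[OF X xyz(1,2) le(1)] bond_vertex_Obj[OF X xyz(3)]] xz by simp
    next
      case False
      then have "?B x y = zero_arrow C (bond_vertex C \<sigma> X x) (bond_vertex C \<sigma> X y)"
        by (auto simp: bond_diagram_def)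
      then show ?thesis
        using zero_arrow_Comp(1)[OF bond_diagram_hom[OF X xyz(2,3) le(2)] bond_vertex_Obj[OF X xyz(1)]] xz by simp
    qed
  qed
  show ?thesis
    unfolding diagram_def using Id bond_vertex_Obj[OF X] bond_diagram_hom[OF X]
    by (intro conjI ballI impI Comp; simp add: vertex_bond_diagram[OF X])
qed

text \<open>In the new direction the edge is \<open>(i, j)\<close> to \<open>(i, j')\<close>, with
  the same \<open>i\<close> because first indices agree. Being live can then change only through the
  second index, and only from false to true.\<close>

lemma bond_diagram_cube:
  assumes \<sigma>: "simplex_op k 1 \<sigma>" and X: "wS_diagram C n k X"
    and p: "(s, p) \<in> indices (Suc n) k" and q: "(s, q) \<in> indices (Suc n) k"
    and le: "index_le (s, p) (s, q)" and fst_eq: "map fst p = map fst q"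
  shows "cofibration_cube C (Suc n) (\<lambda>V W. bond_diagram C \<sigma> X (s, corner p q V) (s, corner p q W))"
proof -
  obtain i j p' where p': "p = (i, j) # p'" "(s, p') \<in> indices n k" "j \<le> k"
    using p by (elim indices_SucE) simp
  obtain j' q' where q': "q = (i, j') # q'" "(s, q') \<in> indices n k" "j' \<le> k"
    using q fst_eq p' by (elim indices_SucE) simp
  let ?Z = "\<lambda>V W. X (s, corner p' q' V) (s, corner p' q' W)"
  have le': "index_le (s, p') (s, q')" "j \<le> j'" and fst': "map fst p' = map fst q'"
    using le fst_eq p' q' by (simp_all add: index_le_Cons_iff)
  have Z: "diagram C {V. V \<subseteq> {..<n}} (\<subseteq>) ?Z" "cofibration_cube C n ?Z"
    using wS_cube_diagram[OF X p'(2) q'(2) le'(1)] wS_cube[OF X p'(2) q'(2) le'(1) fst'] by blast+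
  have live: "bond_live \<sigma> (s, corner p q V) \<longleftrightarrow> \<sigma> i = 0 \<and> \<sigma> (if 0 \<in> V then j' else j) = 1" for V
    by (simp add: p' q' corner_Cons)
  have tl: "tl (corner p q V) = corner p' q' (Suc -` V)" for V
    by (simp add: p' q' corner_Cons)
  have vertex_Z: "vertex C X (s, corner p' q' V) = vertex C ?Z V" for V by (simp add: vertex_def)
  have "\<sigma> j \<le> \<sigma> j'" "\<sigma> j' \<le> 1"
    using simplex_op_mono[OF \<sigma> le'(2) q'(3)] simplex_op_le[OF \<sigma> q'(3)] by simp_all
  \<comment> \<open>Respectively: both faces in direction \<open>0\<close> live, only the upper face
    live, and no face live.\<close>
  then consider "\<sigma> i = 0" "\<sigma> j = 1" "\<sigma> j' = 1" | "\<sigma> i = 0" "\<sigma> j \<noteq> 1" "\<sigma> j' = 1" | "\<sigma> i \<noteq> 0 \<or> \<sigma> j \<noteq> 1 \<and> \<sigma> j' \<noteq> 1"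
    by linarith
  then show ?thesis
  proof cases
    case 1
    then have "(\<lambda>V W. bond_diagram C \<sigma> X (s, corner p q V) (s, corner p q W)) = (\<lambda>V W. ?Z (Suc -` V) (Suc -` W))"
      by (simp add: fun_eq_iff bond_diagram_def live tl)
    then show ?thesis using cofibration_cube_degenerate[OF Z] by simp
  next
    case 2
    show ?thesis
      by (rule cofibration_cube_from_zero[OF Z])
        (use 2 in \<open>simp_all add: bond_diagram_def bond_vertex_def live tl zero_arrow_Zero vertex_Z\<close>)
  next
    case 3
    then have "(\<lambda>V W. bond_diagram C \<sigma> X (s, corner p q V) (s, corner p q W)) = (\<lambda>V W. Id C (Zero C))"
      by (auto simp: fun_eq_iff bond_diagram_def bond_vertex_def live zero_arrow_Zero)
    then show ?thesis using cofibration_cube_zero by simp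
  qed
qed

text \<open>In an old coordinate the square is one of \<open>X\<close> or entirely zero. In the new
  coordinate it is entirely zero or one of the two trivial cofibre sequences, with \<open>A\<close>
  as quotient or as subobject.\<close>

lemma bond_diagram_pushout:
  assumes \<sigma>: "simplex_op k 1 \<sigma>" and X: "wS_diagram C n k X"
    and p: "(s, p) \<in> indices (Suc n) k" and c: "c < Suc n" "p ! c = (i, j)" "j \<le> l" "l \<le> k"
  defines "B \<equiv> bond_diagram C \<sigma> X"
  shows "is_pushout C
    (B (s, p) (s, p[c := (i, l)])) (B (s, p) (s, p[c := (j, j)]))
    (B (s, p[c := (i, l)]) (s, p[c := (j, l)])) (B (s, p[c := (j, j)]) (s, p[c := (j, l)]))"
proof -
  obtain i0 j0 p' where p': "p = (i0, j0) # p'" "(s, p') \<in> indices n k" "j0 \<le> k" "i0 \<le> j0"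
    using p by (elim indices_SucE) simp
  have zero: "is_pushout C (Id C (Zero C)) (Id C (Zero C)) (Id C (Zero C)) (Id C (Zero C))"
    by (rule pushout_Id_right[OF Id_Zero])
  let ?A = "vertex C X (s, p')"
  have A: "?A \<in> Obj C" "X (s, p') (s, p') = Id C ?A"
    using diagram_Obj[OF wS_diagram[OF X] p'(2)] diagram_Id[OF wS_diagram[OF X] p'(2)] by blast+
  show ?thesis
  proof (cases c)
    case 0
    then have ij: "i0 = i" "j0 = j" using c p' by simp_all
    have "\<sigma> i \<le> \<sigma> j" "\<sigma> j \<le> \<sigma> l" "\<sigma> l \<le> 1"
      using simplex_op_mono[OF \<sigma>] simplex_op_le[OF \<sigma>] c p' ij by auto
    \<comment> \<open>The first two cases give only zero vertices. In the third,
      \<open>(i, l)\<close> and \<open>(j, l)\<close> are live, giving the sequence from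
      \<open>0\<close> to \<open>A\<close> to \<open>A\<close>; in the fourth, \<open>(i, j)\<close>
      and \<open>(i, l)\<close> are, giving \<open>A\<close> to \<open>A\<close> to
      \<open>0\<close>.\<close>
    then consider "\<sigma> i \<noteq> 0" "\<sigma> j = 1" | "\<sigma> i = 0" "\<sigma> j = 0" "\<sigma> l = 0"
      | "\<sigma> i = 0" "\<sigma> j = 0" "\<sigma> l = 1" | "\<sigma> i = 0" "\<sigma> j = 1" "\<sigma> l = 1"
      by linarith
    then show ?thesis
    proof cases
      case 3
      then show ?thesis
        using pushout_Id_right[OF zero_arrow_hom[OF Zero_Obj A(1)]] 0 p' ij A
        by (simp add: B_def bond_diagram_def bond_vertex_def zero_arrow_Zero)
    next
      case 4
      then show ?thesis
        using pushout_Id_left[OF zero_arrow_hom[OF A(1) Zero_Obj]] 0 p' ij A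
        by (simp add: B_def bond_diagram_def bond_vertex_def zero_arrow_Zero)
    qed (use zero 0 p' ij in \<open>simp_all add: B_def bond_diagram_def bond_vertex_def zero_arrow_Zero\<close>)
  next
    case (Suc c')
    show ?thesis
    proof (cases "\<sigma> i0 = 0 \<and> \<sigma> j0 = 1")
      case True
      then show ?thesis
        using wS_pushout[OF X p'(2), of c' i j l] c Suc p' by (simp add: B_def bond_diagram_def)
    next
      case False
      then have "bond_live \<sigma> (s, (i0, j0) # w) = False" for w by simp
      then show ?thesis
        using zero Suc p' unfolding B_def bond_diagram_def bond_vertex_def by (simp add: zero_arrow_Zero del: bond_live_Cons)
    qed
  qed
qed

lemma wS_diagram_bond:
  assumes \<sigma>: "simplex_op k 1 \<sigma>" and X: "wS_diagram C n k X"
  shows "wS_diagram C (Suc n) k (bond_diagram C \<sigma> X)"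
proof (rule wS_diagramI)
  show "vertex C (bond_diagram C \<sigma> X) (s, p) = Zero C"
    if p: "(s, p) \<in> indices (Suc n) k" "(i, i) \<in> set p" for s p i
  proof -
    obtain i0 j0 p' where p': "p = (i0, j0) # p'" "(s, p') \<in> indices n k"
      using p(1) by (elim indices_SucE) simp
    show ?thesis
      using p(2) p' wS_zero[OF X p'(2)] unfolding vertex_bond_diagram[OF X p(1)]
      by (auto simp: bond_vertex_def)
  qed
  show "bond_diagram C \<sigma> X (s, p) (t, p) \<in> Weq C"
    if p: "(s, p) \<in> indices (Suc n) k" "(t, p) \<in> indices (Suc n) k" "s \<le> t" for s t p
  proof -
    obtain i j p' where p': "p = (i, j) # p'" "(s, p') \<in> indices n k" "(t, p') \<in> indices n k"
      using p(1,2) by (elim indices_SucE) simp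
    then show ?thesis
      using wS_Weq[OF X p'(2,3) p(3)] Id_Weq[OF Zero_Obj]
      by (auto simp: bond_diagram_def bond_vertex_def zero_arrow_Zero)
  qed
qed (rule bond_diagram_diagram[OF \<sigma> X] bond_diagram_cube[OF \<sigma> X] bond_diagram_pushout[OF \<sigma> X]; assumption)+

section \<open>Levels and structure maps form a spectrum\<close>

lemma K_level_pointed_simplicial_set: "pointed_simplicial_set (K_level C n)"
proof
  fix l k \<theta> x assume \<theta>: "simplex_op l k \<theta>" and "x \<in> simplices (K_level C n) k"
  then have x: "wS_diagram C n k x" by (simp add: K_level_def wS_simplices_iff)
  show "pull (K_level C n) l k \<theta> x \<in> simplices (K_level C n) l"
    using index_restrict_in_wS_simplices[OF wS_diagram_reindex[OF \<theta> x]] by (simp add: K_level_def)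
next
  fix l k :: nat and \<theta> \<theta>' :: "nat \<Rightarrow> nat" and x assume "\<And>i. i \<le> l \<Longrightarrow> \<theta> i = \<theta>' i"
  then have "reindex \<theta> y = reindex \<theta>' y" if "y \<in> indices n l" for y
    using reindex_cong[OF that] by blast
  then show "pull (K_level C n) l k \<theta> x = pull (K_level C n) l k \<theta>' x"
    by (auto simp: K_level_def intro: index_restrict_cong)
next
  fix k x assume "x \<in> simplices (K_level C n) k"
  then show "pull (K_level C n) k k id x = x"
    by (simp add: K_level_def wS_simplices_iff reindex_id)
next
  fix j l k :: nat and \<eta> \<theta> :: "nat \<Rightarrow> nat" and x assume "simplex_op j l \<eta>"
  then show "pull (K_level C n) j k (\<theta> \<circ> \<eta>) x = pull (K_level C n) j l \<eta> (pull (K_level C n) l k \<theta> x)"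
    by (auto simp: K_level_def reindex_comp reindex_in_indices reindex_le intro!: index_restrict_cong)
next
  show "base (K_level C n) k \<in> simplices (K_level C n) k" for k
    using index_restrict_in_wS_simplices[OF wS_diagram_zero] by (simp add: K_level_def)
next
  show "pull (K_level C n) l k \<theta> (base (K_level C n) k) = base (K_level C n) l" if "simplex_op l k \<theta>" for l k \<theta>
    using that by (auto simp: K_level_def reindex_in_indices reindex_le intro!: index_restrict_cong)
qed

lemma K_spectrum_simplicial: "simplicial_spectrum (K_spectrum C)"
proof (rule simplicial_spectrum.intro)
  fix n k \<sigma> x assume \<sigma>: "simplex_op k 1 \<sigma>" and "x \<in> simplices (level (K_spectrum C) n) k"
  then have x: "wS_diagram C n k x" by (simp add: K_spectrum_def K_level_def wS_simplices_iff)
  show "bond (K_spectrum C) n k \<sigma> x \<in> simplices (level (K_spectrum C) (Suc n)) k"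
    using index_restrict_in_wS_simplices[OF wS_diagram_bond[OF \<sigma> x]]
    by (simp add: K_spectrum_def K_level_def K_bond_eq)
  show "bond (K_spectrum C) n k \<sigma> x = base (level (K_spectrum C) (Suc n)) k" if const: "\<sigma> 0 = \<sigma> k"
  proof -
    \<comment> \<open>A monotone map with equal end values is constant, and a constant \<sigma>
      cannot take both values that a live index requires.\<close>
    have \<sigma>_eq: "\<sigma> i = \<sigma> k" if "i \<le> k" for i
      using simplex_op_mono[OF \<sigma>, of 0 i] simplex_op_mono[OF \<sigma>, of i k] that const by simp
    have "\<not> bond_live \<sigma> y" if y: "y \<in> indices (Suc n) k" for y
    proof -
      obtain s i j p where "y = (s, (i, j) # p)" "i \<le> k" "j \<le> k"
        using y by (elim indices_SucE) auto
      then show ?thesis using \<sigma>_eq[of i] \<sigma>_eq[of j] by auto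
    qed
    then show ?thesis
      by (auto simp: K_spectrum_def K_level_def K_bond_eq bond_diagram_def bond_vertex_def zero_arrow_Zero
          intro!: index_restrict_cong)
  qed
next
  fix n k :: nat and \<sigma> \<sigma>' :: "nat \<Rightarrow> nat" and x assume \<sigma>_eq: "\<And>i. i \<le> k \<Longrightarrow> \<sigma> i = \<sigma>' i"
  have "bond_live \<sigma> y = bond_live \<sigma>' y" if y: "y \<in> indices (Suc n) k" for y
  proof -
    obtain s i j p where "y = (s, (i, j) # p)" "i \<le> k" "j \<le> k"
      using y by (elim indices_SucE) auto
    then show ?thesis using \<sigma>_eq[of i] \<sigma>_eq[of j] by simp
  qed
  then show "bond (K_spectrum C) n k \<sigma> x = bond (K_spectrum C) n k \<sigma>' x"
    by (auto simp: K_spectrum_def K_bond_eq bond_diagram_def bond_vertex_def intro!: index_restrict_cong)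
next
  fix n k :: nat and \<sigma> :: "nat \<Rightarrow> nat"
  have "bond_diagram C \<sigma> (index_restrict n k (\<lambda>x y. Id C (Zero C))) x y = Id C (Zero C)"
    if "x \<in> indices (Suc n) k" "y \<in> indices (Suc n) k" "index_le x y" for x y
    using that by (elim indices_SucE)
      (simp add: bond_diagram_def bond_vertex_def vertex_def index_le_Cons_iff Dom_Id_Zero zero_arrow_Zero)
  then show "bond (K_spectrum C) n k \<sigma> (base (level (K_spectrum C) n) k) = base (level (K_spectrum C) (Suc n)) k"
    by (auto simp: K_spectrum_def K_level_def K_bond_eq intro!: index_restrict_cong)
next
  fix l k \<theta> \<sigma> x n assume \<theta>: "simplex_op l k \<theta>" and "x \<in> simplices (level (K_spectrum C) n) k"
  \<comment> \<open>Reindexing acts on each coordinate separately, so it commutes with dropping the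
    first one, and testing the reindexed first coordinate with \<sigma> is testing the original with
    \<open>\<sigma> \<circ> \<theta>\<close>.\<close>
  have live: "bond_live \<sigma> (reindex \<theta> y) = bond_live (\<sigma> \<circ> \<theta>) y"
    and tl: "(fst (reindex \<theta> y), tl (snd (reindex \<theta> y))) = reindex \<theta> (fst y, tl (snd y))"
    and rest: "(fst y, tl (snd y)) \<in> indices n l"
    if "y \<in> indices (Suc n) l" for y
    using that by (auto elim!: indices_SucE simp: reindex_def)
  have le: "index_le (fst y, tl (snd y)) (fst z, tl (snd z))" if "index_le y z" "y \<in> indices (Suc n) l" "z \<in> indices (Suc n) l" for y z
    using that by (auto elim!: indices_SucE simp: index_le_Cons_iff)
  let ?P = "index_restrict n l (\<lambda>y z. x (reindex \<theta> y) (reindex \<theta> z))"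
  have vertex: "bond_vertex C \<sigma> x (reindex \<theta> y) = bond_vertex C (\<sigma> \<circ> \<theta>) ?P y" if "y \<in> indices (Suc n) l" for y
    using live[OF that] tl[OF that] rest[OF that] by (simp add: bond_vertex_def vertex_def)
  have "bond_diagram C \<sigma> x (reindex \<theta> y) (reindex \<theta> z) = bond_diagram C (\<sigma> \<circ> \<theta>) ?P y z"
    if yz: "y \<in> indices (Suc n) l" "z \<in> indices (Suc n) l" "index_le y z" for y z
    unfolding bond_diagram_def live[OF yz(1)] live[OF yz(2)] tl[OF yz(1)] tl[OF yz(2)] vertex[OF yz(1)] vertex[OF yz(2)]
    using rest[OF yz(1)] rest[OF yz(2)] le[OF yz(3,1,2)] by simp
  then show "pull (level (K_spectrum C) (Suc n)) l k \<theta> (bond (K_spectrum C) n k \<sigma> x) =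
      bond (K_spectrum C) n l (\<sigma> \<circ> \<theta>) (pull (level (K_spectrum C) n) l k \<theta> x)"
    using \<theta> by (auto simp: K_spectrum_def K_level_def K_bond_eq reindex_in_indices reindex_le intro!: index_restrict_cong)
next
  show "pointed_simplicial_set (level (K_spectrum C) n)" for n
    using K_level_pointed_simplicial_set by (simp add: K_spectrum_def)
qed

text \<open>The colimit over the proper subsets of a singleton is the source of the edge itself.\<close>

lemma wS_cofibration:
  assumes X: "wS_diagram C n k X" and p: "(s, p) \<in> indices n k" and c: "c < n" "p ! c = (i, j)" "j \<le> l" "l \<le> k"
  shows "X (s, p) (s, p[c := (i, l)]) \<in> Cof C"
proof -
  let ?q = "p[c := (i, l)]"
  let ?Y = "\<lambda>V W. X (s, corner p ?q V) (s, corner p ?q W)"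
  have q: "(s, ?q) \<in> indices n k"
    using indices_update[OF p] indices_nth[OF p c(1,2)] c by simp
  have len: "c < length p" using p c by (simp add: indices_def)
  have "map fst p = map fst ?q"
    using c(2) len by (simp add: list_eq_iff_nth_eq nth_list_update)
  then have "cofibration_cube C n ?Y"
    using wS_cube[OF X p q] index_le_components(1)[OF p c(1-3)] by blast
  then have "\<exists>L \<iota>. \<exists>u\<in>Cof C. is_colimit C {V. V \<subset> {c}} (\<subseteq>) ?Y L \<iota> \<and> u \<in> hom C L (vertex C ?Y {c}) \<and>
      (\<forall>V. V \<subset> {c} \<longrightarrow> Comp C u (\<iota> V) = ?Y V {c})"
    using c(1) unfolding cofibration_cube_def by simp
  then obtain L \<iota> u where u: "u \<in> Cof C" "is_colimit C {V. V \<subset> {c}} (\<subseteq>) ?Y L \<iota>" "u \<in> hom C L (vertex C ?Y {c})"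
    "Comp C u (\<iota> {}) = ?Y {} {c}" by blast
  let ?A = "vertex C X (s, p)"
  have A: "?A \<in> Obj C" "X (s, p) (s, p) = Id C ?A"
    using diagram_Obj[OF wS_diagram[OF X] p] diagram_Id[OF wS_diagram[OF X] p] by blast+
  have J: "{V. V \<subset> {c}} = {{}}" by auto
  have Y0: "?Y {} {} = Id C ?A" "vertex C ?Y {} = ?A"
    by (simp add: corner_empty A(2), simp add: corner_empty vertex_def)
  note col = u(2)[unfolded J]
  have \<iota>: "\<iota> {} \<in> hom C ?A L" using cocone_hom[OF colimit_cocone[OF col]] Y0 by simp
  have L: "L \<in> Obj C" using hom_Obj[OF \<iota>] by blast
  have "is_cocone C {{}} (\<subseteq>) ?Y ?A (\<lambda>_. Id C ?A)"
  proof (rule coconeI[OF A(1)])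
    show "Id C ?A \<in> hom C (vertex C ?Y V) ?A" if "V \<in> {{}}" for V
    proof -
      have "V = {}" using that by simp
      then show ?thesis using Id_hom[OF A(1)] by (simp only: Y0(2))
    qed
    show "Comp C (Id C ?A) (?Y V W) = Id C ?A" if "V \<in> {{}}" "W \<in> {{}}" for V W
      using that Comp_Id_left[OF Id_hom[OF A(1)]] Y0(1) by simp
  qed
  \<comment> \<open>\<open>w\<close> is the inverse of \<open>\<iota> {}\<close>: one composite is
    given by construction, the other follows from uniqueness. The edge is then the cofibration
    \<open>u\<close> after an isomorphism.\<close>
  from colimit_factor[OF col this] obtain w where w: "w \<in> hom C L ?A" "Comp C w (\<iota> {}) = Id C ?A" by auto
  have "Comp C (\<iota> {}) w = Id C L"
  proof -
    have "\<exists>!v. v \<in> hom C L L \<and> (\<forall>V\<in>{{}}. Comp C v (\<iota> V) = \<iota> V)"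
      by (rule colimit_factor[OF col colimit_cocone[OF col]])
    moreover have "Comp C (Comp C (\<iota> {}) w) (\<iota> {}) = \<iota> {}"
      by (rule Comp_cancel(1)[OF \<iota> w \<iota>])
    ultimately show ?thesis
      using Comp_hom[OF w(1) \<iota>] Id_hom[OF L] Comp_Id_left[OF \<iota>] by auto
  qed
  then have "\<iota> {} \<in> Cof C" using isoI[OF \<iota> w(1,2)] iso_Cof by blast
  moreover have "Cod C (\<iota> {}) = Dom C u" using \<iota> u(3) by (simp add: hom_def)
  ultimately have "Comp C u (\<iota> {}) \<in> Cof C" using Comp_Cof u(1) by blast
  then show ?thesis using u(4) len by (simp add: corner_empty corner_update)
qed

end

section \<open>The map of spectra induced by an exact functor\<close>

context exact_functor
begin

lemma vertex_image:
  assumes "diagram C J le X" "p \<in> J"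
  shows "vertex D (\<lambda>x y. FA (X x y)) p = FO (vertex C X p)"
proof -
  have "X p p \<in> hom C (vertex C X p) (vertex C X p)"
    using diagram_Obj[OF assms] diagram_Id[OF assms] C.Id_hom by simp
  then show ?thesis using F_hom by (simp add: vertex_def hom_def)
qed

lemma diagram_image:
  assumes X: "diagram C J le X"
  shows "diagram D J le (\<lambda>x y. FA (X x y))"
  unfolding diagram_def
proof (intro conjI ballI impI)
  fix p assume p: "p \<in> J"
  show "vertex D (\<lambda>x y. FA (X x y)) p \<in> Obj D"
    using F_Obj[OF diagram_Obj[OF X p]] by (simp add: vertex_image[OF X p])
  show "FA (X p p) = Id D (vertex D (\<lambda>x y. FA (X x y)) p)"
    using F_Id[OF diagram_Obj[OF X p]] diagram_Id[OF X p] by (simp add: vertex_image[OF X p])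
  fix q assume q: "q \<in> J" and pq: "le p q"
  show "FA (X p q) \<in> hom D (vertex D (\<lambda>x y. FA (X x y)) p) (vertex D (\<lambda>x y. FA (X x y)) q)"
    using F_hom[OF diagram_hom[OF X p q pq]] by (simp add: vertex_image[OF X] p q)
  fix r assume r: "r \<in> J" and qr: "le q r"
  show "FA (X p r) = Comp D (FA (X q r)) (FA (X p q))"
    using F_Comp[OF diagram_hom[OF X p q pq] diagram_hom[OF X q r qr]] diagram_Comp[OF X p q r pq qr] by simp
qed

text \<open>A factorisation through \<open>Zero C\<close> is sent to one through
  \<open>Zero D\<close>, and only zero arrows admit such a factorisation.\<close>

lemma zero_arrow_image:
  assumes "x \<in> Obj C" "y \<in> Obj C"
  shows "FA (zero_arrow C x y) = zero_arrow D (FO x) (FO y)"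
proof -
  obtain i p where i: "i \<in> hom C (Zero C) y" "p \<in> hom C x (Zero C)" "zero_arrow C x y = Comp C i p"
    using C.zero_arrow_factors[OF assms] .
  have "FA p \<in> hom D (FO x) (Zero D)" "FA i \<in> hom D (Zero D) (FO y)"
    using F_hom[OF i(1)] F_hom[OF i(2)] by (simp_all add: F_Zero)
  then show ?thesis
    using F_Comp[OF i(2,1)] i(3) D.zero_arrow_eq(2)[of "FA p" "FO x"] D.zero_arrow_Comp(1) F_Obj[OF assms(1)] by metis
qed

text \<open>Exactness preserves pushouts along cofibrations, and \<open>wS_cofibration\<close> shows
  that the squares in question are of this kind. The latching objects of cubes are colimits of
  another shape; \<open>colimits\<close> covers them, as finite posets of subsets.\<close>

lemma wS_diagram_image:
  assumes colimits: "\<And>(J :: nat set set) X L \<iota>. finite J \<Longrightarrow> diagram C J (\<subseteq>) X \<Longrightarrow> is_colimit C J (\<subseteq>) X L \<iota> \<Longrightarrow>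
      is_colimit D J (\<subseteq>) (\<lambda>x y. FA (X x y)) (FO L) (\<lambda>x. FA (\<iota> x))"
    and X: "wS_diagram C n k X"
  shows "wS_diagram D n k (\<lambda>x y. FA (X x y))"
proof (rule wS_diagramI)
  let ?Y = "\<lambda>x y. FA (X x y)"
  show "diagram D (indices n k) index_le ?Y" by (rule diagram_image[OF wS_diagram[OF X]])
  show "vertex D ?Y (s, p) = Zero D" if "(s, p) \<in> indices n k" "(i, i) \<in> set p" for s p i
    using vertex_image[OF wS_diagram[OF X] that(1)] wS_zero[OF X that] by (simp add: F_Zero)
  show "?Y (s, p) (t, p) \<in> Weq D" if "(s, p) \<in> indices n k" "(t, p) \<in> indices n k" "s \<le> t" for s t p
    by (rule F_Weq[OF wS_Weq[OF X that]])
  show "is_pushout D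
      (?Y (s, p) (s, p[c := (i, l)])) (?Y (s, p) (s, p[c := (j, j)]))
      (?Y (s, p[c := (i, l)]) (s, p[c := (j, l)])) (?Y (s, p[c := (j, j)]) (s, p[c := (j, l)]))"
    if "(s, p) \<in> indices n k" "c < n" "p ! c = (i, j)" "j \<le> l" "l \<le> k" for s p c i j l
    by (rule F_pushout[OF C.wS_cofibration[OF X that] wS_pushout[OF X that]])
  show "cofibration_cube D n (\<lambda>V W. ?Y (s, corner p q V) (s, corner p q W))"
    if pq: "(s, p) \<in> indices n k" "(s, q) \<in> indices n k" "index_le (s, p) (s, q)" "map fst p = map fst q" for s p q
    unfolding cofibration_cube_def
  proof (intro allI impI)
    fix U assume U: "U \<subseteq> {..<n}"
    let ?Z = "\<lambda>V W. X (s, corner p q V) (s, corner p q W)"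
    note Z = wS_cube_diagram[OF X pq(1-3)]
    obtain L \<iota> u where u: "u \<in> Cof C" "is_colimit C {V. V \<subset> U} (\<subseteq>) ?Z L \<iota>" "u \<in> hom C L (vertex C ?Z U)"
      "\<And>V. V \<subset> U \<Longrightarrow> Comp C u (\<iota> V) = ?Z V U"
      using wS_cube[OF X pq] U unfolding cofibration_cube_def by metis
    have "finite U" using U by (rule finite_subset) simp
    then have "finite {V. V \<subset> U}" by (rule finite_subset[OF _ finite_Pow_iff[THEN iffD2], rotated]) auto
    moreover have "diagram C {V. V \<subset> U} (\<subseteq>) ?Z"
      by (rule diagram_subset[OF Z]) (use U in auto)
    ultimately have "is_colimit D {V. V \<subset> U} (\<subseteq>) (\<lambda>V W. FA (?Z V W)) (FO L) (\<lambda>V. FA (\<iota> V))"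
      using colimits u(2) by blast
    moreover have "FA u \<in> hom D (FO L) (vertex D (\<lambda>V W. FA (?Z V W)) U)"
      using F_hom[OF u(3)] vertex_image[OF Z, of U] U by simp
    moreover have "Comp D (FA u) (FA (\<iota> V)) = FA (?Z V U)" if V: "V \<subset> U" for V
    proof -
      have "\<iota> V \<in> hom C (vertex C ?Z V) L" using cocone_hom[OF colimit_cocone[OF u(2)]] V by blast
      then show ?thesis using F_Comp[OF _ u(3)] u(4)[OF V] by metis
    qed
    ultimately show "\<exists>L \<iota>. \<exists>u\<in>Cof D. is_colimit D {V. V \<subset> U} (\<subseteq>) (\<lambda>V W. FA (?Z V W)) L \<iota> \<and>
        u \<in> hom D L (vertex D (\<lambda>V W. FA (?Z V W)) U) \<and> (\<forall>V. V \<subset> U \<longrightarrow> Comp D u (\<iota> V) = FA (?Z V U))"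
      by (intro exI[of _ "FO L"] exI[of _ "\<lambda>V. FA (\<iota> V)"] bexI[of _ "FA u"] F_Cof[OF u(1)]) simp
  qed
qed

lemma K_map_spectrum_map:
  assumes colimits: "\<And>(J :: nat set set) X L \<iota>. finite J \<Longrightarrow> diagram C J (\<subseteq>) X \<Longrightarrow> is_colimit C J (\<subseteq>) X L \<iota> \<Longrightarrow>
      is_colimit D J (\<subseteq>) (\<lambda>x y. FA (X x y)) (FO L) (\<lambda>x. FA (\<iota> x))"
  shows "spectrum_map (K_spectrum C) (K_spectrum D) (K_map FA)"
proof -
  interpret E: simplicial_spectrum "K_spectrum C" by (rule C.K_spectrum_simplicial)
  interpret F: simplicial_spectrum "K_spectrum D" by (rule D.K_spectrum_simplicial)
  show ?thesis
  proof
    fix n k x assume "x \<in> simplices (level (K_spectrum C) n) k"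
    then have x: "wS_diagram C n k x" by (simp add: K_spectrum_def K_level_def wS_simplices_iff)
    show "K_map FA n k x \<in> simplices (level (K_spectrum D) n) k"
    proof -
      have "wS_diagram D n k (\<lambda>y z. FA (x y z))" by (rule wS_diagram_image[OF colimits x])
      then show ?thesis
        using index_restrict_in_wS_simplices by (simp add: K_spectrum_def K_level_def K_map_def)
    qed
    fix \<sigma>
    \<comment> \<open>Being live depends only on the index and on \<sigma>, so both sides make the
      same case distinction. On live pairs \<open>FA\<close> is applied to the same arrow, elsewhere
      to a zero arrow.\<close>
    have "FA (bond_diagram C \<sigma> x y z) = bond_diagram D \<sigma> (K_map FA n k x) y z"
      if "y \<in> indices (Suc n) k" "z \<in> indices (Suc n) k" "index_le y z" for y z
    proof -
      have rest: "(fst w, tl (snd w)) \<in> indices n k" if "w \<in> indices (Suc n) k" for w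
        using that by (elim indices_SucE) simp
      have le: "index_le (fst y, tl (snd y)) (fst z, tl (snd z))"
        using that by (auto elim!: indices_SucE simp: index_le_Cons_iff)
      have vertex: "bond_vertex D \<sigma> (K_map FA n k x) w = FO (bond_vertex C \<sigma> x w)" if "w \<in> indices (Suc n) k" for w
        using vertex_image[OF wS_diagram[OF x] rest[OF that]] rest[OF that]
        by (simp add: bond_vertex_def vertex_def K_map_def F_Zero)
      show ?thesis
        using rest[OF that(1)] rest[OF that(2)] le vertex that(1,2) zero_arrow_image[OF C.bond_vertex_Obj[OF x that(1)] C.bond_vertex_Obj[OF x that(2)]]
        by (simp add: bond_diagram_def K_map_def)
    qed
    then show "K_map FA (Suc n) k (bond (K_spectrum C) n k \<sigma> x) = bond (K_spectrum D) n k \<sigma> (K_map FA n k x)"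
      by (auto simp: K_spectrum_def K_bond_eq K_map_def[of _ "Suc n"] intro!: index_restrict_cong)
  next
    fix l k \<theta> x n assume "simplex_op l k \<theta>"
    then show "K_map FA n l (pull (level (K_spectrum C) n) l k \<theta> x) = pull (level (K_spectrum D) n) l k \<theta> (K_map FA n k x)"
      by (auto simp: K_spectrum_def K_level_def K_map_def reindex_in_indices reindex_le intro!: index_restrict_cong)
  next
    show "K_map FA n k (base (level (K_spectrum C) n) k) = base (level (K_spectrum D) n) k" for n k
      using F_Id[OF C.Zero_Obj] F_Zero
      by (auto simp: K_spectrum_def K_level_def K_map_def intro!: index_restrict_cong)
  qed
qed

end

theorem lemma3p9:
  fixes \<phi> :: "'m::{monoid_mult, mult_zero} \<Rightarrow> 'n::{monoid_mult, mult_zero}"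
  assumes hom: "pointed_monoid_hom \<phi>"
    and fg: "finitely_generated (restrict_scalars \<phi> (regular_module :: ('n, 'n) pmod))"
    and universe: "infinite (UNIV :: 'u set)"
      "\<exists>e :: 'm \<Rightarrow> 'u. inj e" "\<exists>e :: 'n \<Rightarrow> 'u. inj e"
  shows "exact_functor (FG TYPE('n) TYPE('u)) (FG TYPE('m) TYPE('u))
           (restrict_scalars \<phi>) (restrict_scalars_arrow \<phi>)
       \<and> spectrum_map (G_spectrum TYPE('n) TYPE('u)) (G_spectrum TYPE('m) TYPE('u))
           (transfer_map \<phi>)"
proof -
  interpret finite_extension \<phi> "TYPE('u)"
    using hom fg universe(1) by unfold_locales
  interpret E: exact_functor N_mod M_mod "restrict_scalars \<phi>" "restrict_scalars_arrow \<phi>"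
    by (rule res_exact)
  have "spectrum_map (K_spectrum N_mod) (K_spectrum M_mod) (K_map (restrict_scalars_arrow \<phi>))"
    by (rule E.K_map_spectrum_map[OF res_colimit])
  then show ?thesis
    unfolding G_spectrum_def transfer_map_def using res_exact by blast
qed

end
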